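(* Let $d\ge2$, $L\ge5$, $T>0$ and $\sigma\ge d+3$. With the notation of the context, there is a constant $C_{d,\sigma}$ (depending only on $d,\sigma$) such that, uniformly in $L$ and $T$, $$\mathfrak R_{L,\mathrm{nc}}(T)\le C_{d,\sigma},\qquad \mathfrak R_{L,\mathrm{col}}(T)\le C_{d,\sigma}(1+T)L^{1-d},$$ and consequently, for arbitrary $T>0$ and $L\ge5$, $$\|\mathcal V^S_{L,T}\|_{Y_L(T)\to Y_L(T)}\le C_{d,\sigma}\left[1+(1+T)L^{1-d}\right].$$ Moreover, there are constants $c_{d,\sigma}>0$, $T_0\ge1$ and $L_0\ge5$ such that for all $T\ge T_0$ and $L\ge L_0$ $$c_{d,\sigma}\,TL^{1-d}\le\|\mathcal V^S_{L,T,\mathrm{col}}\|_{Y_L(T)\to Y_L(T)}\le C_{d,\sigma}\,TL^{1-d},$$ and, on the same range, $$c_{d,\sigma}\left(1+TL^{1-d}\right)\le\|\mathcal V^S_{L,T}\|_{Y_L(T)\to Y_L(T)}\le C_{d,\sigma}\left(1+TL^{1-d}\right).$$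
   Context: $\langle x\rangle=(1+|x|^2)^{1/2}$. $\Lambda_L=(\mathbb Z/L)^d\setminus\{0\}$, $d\nu_L=L^{-d}\sum_{k\in\Lambda_L}\delta_k$, and $Y_L(T)=L^2([0,T]\times\Lambda_L,\,dt\,d\nu_L(k))$. For $0\le\tau\le t$ and $k,\ell\in\Lambda_L$ the echo kernel is $$K^S_\sigma(t,\tau;k,\ell)=\frac{|k|^{1/2}|\ell|^{1/2}}{\langle\ell\rangle^2}|k(t-\tau)|\langle k-\ell\rangle^{-\sigma}\langle kt-\ell\tau\rangle^{-\sigma},$$ and the polynomially weighted echo--Volterra operator on $[0,T]$ is $$(\mathcal V^S_{L,T}F)(t,k)=\frac1{L^d}\sum_{\ell\in\Lambda_L}\int_0^tK^S_\sigma(t,\tau;k,\ell)F(\tau,\ell)\,d\tau .$$ Split $K^S_\sigma=K^S_{\sigma,\mathrm{nc}}+K^S_{\sigma,\mathrm{col}}$, where $K^S_{\sigma,\mathrm{nc}}$ is the restriction of $K^S_\sigma$ to pairs with $k\wedge\ell\ne0$ (linearly independent) and $K^S_{\sigma,\mathrm{col}}$ its restriction to pairs with $k\wedge\ell=0$ (linearly dependent); $\mathcal V^S_{L,T,\mathrm{nc}}$ and $\mathcal V^S_{L,T,\mathrm{col}}$ are the operators with these kernels. For $\mathrm a\in\{\mathrm{nc},\mathrm{col}\}$ set $$\mathfrak S^+_{\mathrm a}(T)=\sup_{k\in\Lambda_L,\,0<t\le T}\frac1{L^d}\sum_{\ell\in\Lambda_L}\int_0^tK^S_{\sigma,\mathrm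 a}(t,\tau;k,\ell)\,d\tau,\qquad \mathfrak S^-_{\mathrm a}(T)=\sup_{\ell\in\Lambda_L,\,0\le\tau<T}\frac1{L^d}\sum_{k\in\Lambda_L}\int_\tau^TK^S_{\sigma,\mathrm a}(t,\tau;k,\ell)\,dt,$$ $$\mathfrak R_{L,\mathrm a}(T)=\max\{\mathfrak S^+_{\mathrm a}(T),\mathfrak S^-_{\mathrm a}(T)\}.$$ *)

theory Defs
  imports "HOL-Analysis.Analysis"
begin

text \<open>The dimension is \<open>d = CARD('n)\<close>; \<open>L\<close> is an arbitrary (not necessarily integer)
  positive real.\<close>

type_synonym 'n kernel = "real \<Rightarrow> real \<Rightarrow> real^'n \<Rightarrow> real^'n \<Rightarrow> real"

definition jap :: "real^'n \<Rightarrow> real" where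
  "jap x = sqrt (1 + (norm x)\<^sup>2)"

definition lattice :: "real \<Rightarrow> (real^'n) set" where
  "lattice L = {k. \<forall>i. \<exists>m::int. k $ i = of_int m / L} - {0}"

text \<open>The measure \<open>L\<close>-to-the-power-\<open>-d\<close> times the sum of the Dirac masses at the lattice points,
  so that integration against it is the normalised lattice sum.\<close>

definition nu :: "real \<Rightarrow> (real^'n) measure" where
  "nu L = density (count_space (lattice L)) (\<lambda>_. ennreal (1 / L ^ CARD('n)))"

text \<open>Coordinates of the exterior product. (The library's \<open>independent {k, l}\<close> alone would not
  do for linear independence of the pair, since it holds for \<open>k = l \<noteq> 0\<close>.)\<close>

definition wedge :: "real^'n \<Rightarrow> real^'n \<Rightarrow> real^'n^'n" where
  "wedge k l = (\<chi> i j. k $ i * l $ j - k $ j * l $ i)"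

lemma wedge_nonzero_iff: "wedge k l \<noteq> 0 \<longleftrightarrow> k \<noteq> l \<and> independent {k, l}"
proof -
  have "wedge k l = 0 \<longleftrightarrow> k = 0 \<or> (\<exists>c. l = c *\<^sub>R k)"
  proof
    assume "wedge k l = 0"
    then have w: "k $ i * l $ j = k $ j * l $ i" for i j
      by (simp add: wedge_def vec_eq_iff)
    show "k = 0 \<or> (\<exists>c. l = c *\<^sub>R k)"
    proof (cases "k = 0")
      case False
      then obtain i where i: "k $ i \<noteq> 0" by (auto simp: vec_eq_iff)
      have "l = (l $ i / k $ i) *\<^sub>R k"
        using i w[of i] by (simp add: vec_eq_iff field_simps)
      then show ?thesis by blast
    qed simp
  next
    assume "k = 0 \<or> (\<exists>c. l = c *\<^sub>R k)"
    then show "wedge k l = 0" by (auto simp: wedge_def vec_eq_iff)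
  qed
  moreover have "k \<noteq> l \<and> independent {k, l} \<longleftrightarrow> \<not> (k = 0 \<or> (\<exists>c. l = c *\<^sub>R k))"
  proof (cases "k = l")
    case True
    then show ?thesis by (auto intro: exI[of _ 1])
  next
    case False
    then have "independent {k, l} \<longleftrightarrow> independent {l, k}" by (simp add: insert_commute)
    also have "\<dots> \<longleftrightarrow> l \<notin> span {k} \<and> k \<noteq> 0"
      using False by (auto simp: independent_insert)
    finally show ?thesis using False by (auto simp: span_singleton)
  qed
  ultimately show ?thesis by simp
qed

definition echo_kernel :: "real \<Rightarrow> 'n::finite kernel" where
  "echo_kernel \<sigma> t \<tau> k l =
     sqrt (norm k) * sqrt (norm l) / (jap l)\<^sup>2 * norm ((t - \<tau>) *\<^sub>R k)
       * jap (k - l) powr (- \<sigma>) * jap (t *\<^sub>R k - \<tau> *\<^sub>R l) powr (- \<sigma>)"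

definition echo_kernel_nc :: "real \<Rightarrow> 'n::finite kernel" where
  "echo_kernel_nc \<sigma> t \<tau> k l = (if wedge k l \<noteq> 0 then echo_kernel \<sigma> t \<tau> k l else 0)"

definition echo_kernel_col :: "real \<Rightarrow> 'n::finite kernel" where
  "echo_kernel_col \<sigma> t \<tau> k l = (if wedge k l = 0 then echo_kernel \<sigma> t \<tau> k l else 0)"

text \<open>The row and column quantities are extended nonnegative numbers: a priori the sums and
  suprema may be infinite. They are only meaningful for nonnegative kernels.\<close>

definition schur_plus :: "real \<Rightarrow> real \<Rightarrow> 'n::finite kernel \<Rightarrow> ennreal" where
  "schur_plus L T K =
     (SUP k\<in>lattice L. SUP t\<in>{0<..T}.
        \<integral>\<^sup>+ l. (\<integral>\<^sup>+ \<tau>\<in>{0..t}. ennreal (K t \<tau> k l) \<partial>lborel) \<partial>nu L)"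

definition schur_minus :: "real \<Rightarrow> real \<Rightarrow> 'n::finite kernel \<Rightarrow> ennreal" where
  "schur_minus L T K =
     (SUP l\<in>lattice L. SUP \<tau>\<in>{0..<T}.
        \<integral>\<^sup>+ k. (\<integral>\<^sup>+ t\<in>{\<tau>..T}. ennreal (K t \<tau> k l) \<partial>lborel) \<partial>nu L)"

definition schur_R :: "real \<Rightarrow> real \<Rightarrow> 'n::finite kernel \<Rightarrow> ennreal" where
  "schur_R L T K = max (schur_plus L T K) (schur_minus L T K)"

definition Y_measure :: "real \<Rightarrow> real \<Rightarrow> (real \<times> (real^'n)) measure" where
  "Y_measure L T = restrict_space lborel {0..T} \<Otimes>\<^sub>M nu L"

text \<open>Elements of \<open>L\<^sup>2\<close> are represented by functions, not by classes modulo null sets.\<close>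

definition Y_space :: "real \<Rightarrow> real \<Rightarrow> (real \<times> (real^'n) \<Rightarrow> complex) set" where
  "Y_space L T = {F \<in> borel_measurable (Y_measure L T).
                    integrable (Y_measure L T) (\<lambda>p. (norm (F p))\<^sup>2)}"

definition Y_norm :: "real \<Rightarrow> real \<Rightarrow> (real \<times> (real^'n) \<Rightarrow> complex) \<Rightarrow> real" where
  "Y_norm L T F = sqrt (\<integral>p. (norm (F p))\<^sup>2 \<partial>Y_measure L T)"

definition volterra ::
    "real \<Rightarrow> 'n::finite kernel \<Rightarrow> (real \<times> (real^'n) \<Rightarrow> complex) \<Rightarrow> real \<times> (real^'n) \<Rightarrow> complex" where
  "volterra L K F = (\<lambda>(t, k). \<integral>l. (LINT \<tau>:{0..t}|lborel. of_real (K t \<tau> k l) * F (\<tau>, l)) \<partial>nu L)"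

text \<open>Convergence of the integrals and of the lattice sum defining \<^term>\<open>volterra L K F (t, k)\<close>
  (without it the library integral takes the value 0).\<close>

definition volterra_converges ::
    "real \<Rightarrow> 'n::finite kernel \<Rightarrow> (real \<times> (real^'n) \<Rightarrow> complex) \<Rightarrow> real \<times> (real^'n) \<Rightarrow> bool" where
  "volterra_converges L K F = (\<lambda>(t, k).
     (\<forall>l\<in>lattice L. set_integrable lborel {0..t} (\<lambda>\<tau>. of_real (K t \<tau> k l) * F (\<tau>, l))) \<and>
     integrable (nu L) (\<lambda>l. LINT \<tau>:{0..t}|lborel. of_real (K t \<tau> k l) * F (\<tau>, l)))"

text \<open>The operator norm on \<open>Y\<close> of the Volterra operator with kernel \<open>K\<close>, as the least bound; it is
  \<open>\<infinity>\<close> if the operator is not well defined from \<open>Y\<close> to \<open>Y\<close> or is unbounded.\<close>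

definition volterra_norm :: "real \<Rightarrow> real \<Rightarrow> 'n::finite kernel \<Rightarrow> ennreal" where
  "volterra_norm L T K = Inf {ennreal B | B. 0 \<le> B \<and>
     (\<forall>F\<in>Y_space L T. (AE p in Y_measure L T. volterra_converges L K F p) \<and>
        volterra L K F \<in> Y_space L T \<and>
        Y_norm L T (volterra L K F) \<le> B * Y_norm L T F)}"

end

theory Submission
  imports Defs
begin

text \<open>
  Put \<open>v = t k - \<tau> l\<close>. For each minor \<open>w\<close> of \<open>k \<and> l\<close> one has \<open>\<bar>v\<bar> \<ge> t \<bar>w\<bar> / \<bar>l\<bar>\<close> and
  \<open>\<bar>v\<bar> \<ge> \<bar>l\<bar> \<bar>\<tau> - \<tau>\<^sub>0\<bar>\<close>, so integrating in \<open>\<tau>\<close> gains \<open>1 / \<bar>l\<bar>\<close> and leaves a profile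
  \<open>A / (1 + (A w)\<^sup>2)\<close> with \<open>A\<close> proportional to \<open>t\<close>; the column integrals are similar with the roles
  of \<open>k\<close> and \<open>l\<close> exchanged. For noncollinear pairs some minor is nonzero. As \<open>l\<close> runs through the
  lattice, that minor runs through the nonzero multiples of a fixed step with bounded multiplicity,
  and the sum of the profile is dominated by the integral of \<open>1 / (1 + x\<^sup>2)\<close>, whatever the size of
  \<open>A\<close>: the growth in time is absorbed. For collinear pairs the profile is just \<open>A\<close>, hence the factor
  \<open>T\<close>, but such \<open>l\<close> lie on a line and carry only the fraction \<open>L / L\<^sup>d\<close> of the lattice. If one of
  \<open>k\<close>, \<open>l\<close> is too large for resonance, the phase itself controls the growing factor. The norm bounds
  follow from the Schur test. They are saturated by indicator functions: of points on a coordinate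
  axis with \<open>l\<close> longer than \<open>k\<close>, where the resonant time is a fixed proportion of \<open>t\<close>, and of a box
  of lattice points for bounded times.
\<close>

section \<open>Counting lattice points\<close>

text \<open>The obstacle is uniformity: no constant may depend on \<open>A\<close>, \<open>L\<close>
  or the arithmetic of the two frequencies. Summing the profile over the lattice costs a factor 1 +
  2 r / |p_i|, where p is the fixed frequency and i a pivot coordinate. It is bad for small p; the
  pivot is taken largest, so that the factor |p| left in front by the time integral compensates it.
  Columns are harder than rows: integration in t gains 1/|k|, and now k is summed. This leaves the
  singular weight sqrt(|l|/|k|) and, for small k, a profile whose scale |k| cannot be frozen. Dyadic
  balls around k = 0 treat both at once; they converge even in dimension 2, since rescaling the
  profile releases a factor equal to the radius. The exponent is spent as follows. Of d+3 powers of
  <k-l>, d+1 make the lattice sum converge, and two pay in the rows for freezing the scale of the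
  profile. Of the powers of the phase, of which at least 5 are present as d is at least 2, four pay
  for the product of the two phase bounds, and the fifth absorbs, in the columns, the part of the
  growing factor that is as large as the phase.\<close>

lemma finite_int_interval:
  fixes a b :: real
  shows "finite {m::int. a \<le> of_int m \<and> of_int m \<le> b}"
proof -
  have "{m::int. a \<le> of_int m \<and> of_int m \<le> b} = {\<lceil>a\<rceil>..\<lfloor>b\<rfloor>}"
    by (auto simp: ceiling_le_iff le_floor_iff)
  then show ?thesis by simp
qed

lemma card_int_interval_le:
  assumes "a \<le> (b::real)"
  shows "real (card {m::int. a \<le> of_int m \<and> of_int m \<le> b}) \<le> b - a + 1"
proof -
  have "{m::int. a \<le> of_int m \<and> of_int m \<le> b} = {\<lceil>a\<rceil>..\<lfloor>b\<rfloor>}"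
    by (auto simp: ceiling_le_iff le_floor_iff)
  then have "card {m::int. a \<le> of_int m \<and> of_int m \<le> b} = nat (\<lfloor>b\<rfloor> - \<lceil>a\<rceil> + 1)"
    by simp
  moreover have "of_int (\<lfloor>b\<rfloor> - \<lceil>a\<rceil> + 1) \<le> b - a + 1" by (simp; linarith)
  ultimately show ?thesis using assms by linarith
qed

lemma card_int_interval_ge:
  "real (card {m::int. a \<le> of_int m \<and> of_int m \<le> b}) \<ge> b - (a::real) - 1"
proof -
  have "{m::int. a \<le> of_int m \<and> of_int m \<le> b} = {\<lceil>a\<rceil>..\<lfloor>b\<rfloor>}"
    by (auto simp: ceiling_le_iff le_floor_iff)
  then have "card {m::int. a \<le> of_int m \<and> of_int m \<le> b} = nat (\<lfloor>b\<rfloor> - \<lceil>a\<rceil> + 1)"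
    by simp
  then show ?thesis by linarith
qed

lemma lattice_coordE:
  assumes "z \<in> lattice L" "L > 0"
  shows "real_of_int \<lfloor>z $ i * L\<rfloor> = z $ i * L"
proof -
  obtain m :: int where "z $ i = of_int m / L" using assms by (auto simp: lattice_def)
  then show ?thesis using assms(2) by simp
qed

abbreviation int_box :: "real^'n \<Rightarrow> real \<Rightarrow> real \<Rightarrow> 'n \<Rightarrow> int set" where
  "int_box c r L m \<equiv> {x::int. (c $ m - r) * L \<le> of_int x \<and> of_int x \<le> (c $ m + r) * L}"

lemma card_restrict_box:
  fixes c :: "real^'n"
  assumes L: "L > 0" and r: "r \<ge> 1 / L"
  shows "finite (\<Pi>\<^sub>E m\<in>J. int_box c r L m)"
    and "real (card (\<Pi>\<^sub>E m\<in>J. int_box c r L m))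
         \<le> (3 * r * L) ^ card J"
proof -
  show "finite (\<Pi>\<^sub>E m\<in>J. int_box c r L m)"
    by (intro finite_PiE finite_int_interval) simp
  have rL: "1 \<le> r * L" using L r by (simp add: field_simps)
  \<comment> \<open>An interval of length 2 r L holds at most 2 r L + 1 integers; the hypothesis on
    \<open>r\<close> absorbs the 1 and gives 3 r L.\<close>
  have *: "real (card (int_box c r L m)) \<le> 3 * r * L" for m
    using card_int_interval_le[of "(c $ m - r) * L" "(c $ m + r) * L"] rL by
      (simp add: algebra_simps)
  have "real (card (\<Pi>\<^sub>E m\<in>J. int_box c r L m))
     = (\<Prod>m\<in>J. real (card (int_box c r L m)))"
    by (simp add: card_PiE)
  also have "\<dots> \<le> (\<Prod>m\<in>J. 3 * r * L)"
    by (intro prod_mono conjI *) simp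
  finally show "real (card (\<Pi>\<^sub>E m\<in>J. int_box c r L m))
         \<le> (3 * r * L) ^ card J" by simp
qed

lemma lattice_box_coords:
  assumes "z \<in> lattice L" "L > 0" "\<forall>m\<in>J. \<bar>z $ m - c $ m\<bar> \<le> r"
  shows "(\<lambda>m\<in>J. \<lfloor>z $ m * L\<rfloor>) \<in>
    (\<Pi>\<^sub>E m\<in>J. int_box c r L m)"
proof -
  have "(c $ m - r) * L \<le> z $ m * L \<and> z $ m * L \<le> (c $ m + r) * L" if "m \<in> J" for m
  proof -
    have "c $ m - r \<le> z $ m" "z $ m \<le> c $ m + r" using assms(3) that by (auto simp: abs_le_iff)
    then show ?thesis using assms(2) by simp
  qed
  then show ?thesis by (auto simp: lattice_coordE[OF assms(1,2)])
qed

text \<open>Only the coordinates in \<open>J\<close> are counted, provided that they determine the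
  points of \<open>S\<close>. The choice \<open>J = UNIV\<close> serves full boxes, a single
  coordinate serves lines through the origin, where it saves all other factors L.\<close>

lemma lattice_box_card:
  fixes c :: "real^'n"
  assumes L: "L > 0" and r: "r \<ge> 1 / L" and S: "S \<subseteq> lattice L"
    and box: "\<And>z m. z \<in> S \<Longrightarrow> m \<in> J \<Longrightarrow> \<bar>z $ m - c $ m\<bar> \<le> r"
    and det: "\<And>x y. x \<in> S \<Longrightarrow> y \<in> S \<Longrightarrow> \<forall>m\<in>J. x $ m = y $ m \<Longrightarrow> x = y"
  shows "finite S" "real (card S) \<le> (3 * r * L) ^ card J"
proof -
  let ?h = "\<lambda>z::real^'n. \<lambda>m\<in>J. \<lfloor>z $ m * L\<rfloor>"
  let ?P = "\<Pi>\<^sub>E m\<in>J. int_box c r L m"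
  have inj: "inj_on ?h S"
  proof (rule inj_onI)
    fix x y assume xy: "x \<in> S" "y \<in> S" "?h x = ?h y"
    have "x $ m = y $ m" if "m \<in> J" for m
    proof -
      have "\<lfloor>x $ m * L\<rfloor> = \<lfloor>y $ m * L\<rfloor>" using fun_cong[OF xy(3), of m] that by simp
      then have "x $ m * L = y $ m * L" using lattice_coordE[of _ L m] xy S L by (metis subsetD)
      then show ?thesis using L by simp
    qed
    then show "x = y" using det xy by blast
  qed
  have sub: "?h ` S \<subseteq> ?P"
    by (intro image_subsetI lattice_box_coords[OF _ L]) (use S box in auto)
  show "finite S" by (rule inj_on_finite[OF inj sub card_restrict_box(1)[OF L r]])
  have "card S \<le> card ?P" by (rule card_inj_on_le[OF inj sub card_restrict_box(1)[OF L r]])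
  then show "real (card S) \<le> (3 * r * L) ^ card J"
    using card_restrict_box(2)[OF L r, where c = c and J = J] by linarith
qed

section \<open>Sums of the profile along a minor\<close>

lemma arctan_increment_ge:
  assumes "a > 0" "x \<ge> 0"
  shows "a / (1 + (a * (x + 1))\<^sup>2) \<le> arctan (a * (x + 1)) - arctan (a * x)"
proof -
  \<comment> \<open>Comparison with the integral: the intermediate point lies to the left of a (x +
    1), where the decreasing derivative of arctan is at least the profile at the right end.\<close>
  have "\<exists>z>a * x. z < a * (x + 1) \<and>
      arctan (a * (x + 1)) - arctan (a * x) = (a * (x + 1) - a * x) * (inverse (1 + z\<^sup>2))"
    by (rule MVT2) (use assms in \<open>auto intro: DERIV_arctan\<close>)
  then obtain z where z: "a * x < z" "z < a * (x + 1)"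
    "arctan (a * (x + 1)) - arctan (a * x) = a * inverse (1 + z\<^sup>2)" by (auto simp: algebra_simps)
  have "0 \<le> z" using z(1) assms by (meson less_imp_le mult_nonneg_nonneg order_trans)
  then have "z\<^sup>2 \<le> (a * (x + 1))\<^sup>2" using z(2) by (intro power_mono) auto
  then have "inverse (1 + (a * (x + 1))\<^sup>2) \<le> inverse (1 + z\<^sup>2)"
    by (intro le_imp_inverse_le) (auto intro: add_pos_nonneg)
  then show ?thesis using z(3) assms by (simp add: divide_inverse)
qed

abbreviation minor :: "real^'n \<Rightarrow> real^'n \<Rightarrow> 'n \<Rightarrow> 'n \<Rightarrow> real" where
  "minor x y i j \<equiv> x $ i * y $ j - x $ j * y $ i"

text \<open>A lower Riemann sum of step \<open>a\<close> for the integral of 1 / (1 + x^2) over the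
  half line, hence bounded whatever \<open>a\<close> is. It must start at 1: the term at 0 would be
  \<open>a\<close> itself, which is exactly what collinear pairs contribute.\<close>

lemma sum_Lorentz_nat:
  assumes "a > 0"
  shows "(\<Sum>n<N. a / (1 + (a * (real n + 1))\<^sup>2)) \<le> pi / 2"
proof -
  have "(\<Sum>n<N. a / (1 + (a * (real n + 1))\<^sup>2))
    \<le> (\<Sum>n<N. arctan (a * real (Suc n)) - arctan (a * real n))"
    by (intro sum_mono) (use arctan_increment_ge[OF assms, of
      "real _"] in \<open>simp only: of_nat_Suc add.commute[of 1]\<close>)
  also have "\<dots> = arctan (a * real N) - arctan (a * real 0)"
    by (rule sum_lessThan_telescope)
  also have "\<dots> \<le> pi / 2" using arctan_ubound[of "a * real N"] by simp
  finally show ?thesis .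
qed

lemma sum_Lorentz_int:
  assumes a: "a > 0" and N: "finite N" "0 \<notin> N"
  shows "(\<Sum>n\<in>N. a / (1 + (a * real_of_int n)\<^sup>2)) \<le> pi"
proof -
  obtain M where M: "\<forall>n\<in>N. \<bar>n\<bar> \<le> int M"
  proof
    show "\<forall>n\<in>N. \<bar>n\<bar> \<le> int (nat (Max (abs ` N)))"
    proof
      fix n assume n: "n \<in> N"
      then have "\<bar>n\<bar> \<le> Max (abs ` N)" using N(1) by simp
      then show "\<bar>n\<bar> \<le> int (nat (Max (abs ` N)))" by linarith
    qed
  qed
  let ?f = "\<lambda>n::int. a / (1 + (a * real_of_int n)\<^sup>2)"
  let ?P = "(\<lambda>n. int n + 1) ` {..<M}" and ?Q = "(\<lambda>n. - (int n + 1)) ` {..<M}"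
  have "N \<subseteq> ?P \<union> ?Q"
  proof
    fix n assume n: "n \<in> N"
    then have 1: "\<bar>n\<bar> \<le> int M" "n \<noteq> 0" using M N(2) by auto
    show "n \<in> ?P \<union> ?Q"
    proof (cases "n > 0")
      case True
      then have "n = int (nat (n - 1)) + 1" "nat (n - 1) < M" using 1 by auto
      then show ?thesis by blast
    next
      case False
      then have "n = - (int (nat (- n - 1)) + 1)" "nat (- n - 1) < M" using 1 by auto
      then show ?thesis by blast
    qed
  qed
  then have "sum ?f N \<le> sum ?f (?P \<union> ?Q)"
    using a by (intro sum_mono2) auto
  also have "\<dots> = sum ?f ?P + sum ?f ?Q"
    by (intro sum.union_disjoint) auto
  also have "sum ?f ?P = (\<Sum>n<M. a / (1 + (a * (real n + 1))\<^sup>2))"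
    by (subst sum.reindex) (auto simp: inj_on_def)
  also have "sum ?f ?Q = (\<Sum>n<M. a / (1 + (a * (real n + 1))\<^sup>2))"
  proof -
    have "(a * real_of_int (- (int n + 1)))\<^sup>2 = (a * (real n + 1))\<^sup>2" for n
      by (simp add: power_mult_distrib power2_eq_square algebra_simps)
    then show ?thesis by (subst sum.reindex) (auto simp: inj_on_def simp del: of_int_minus)
  qed
  also have "(\<Sum>n<M. a / (1 + (a * (real n + 1))\<^sup>2)) + (\<Sum>n<M. a / (1 + (a * (real n + 1))\<^sup>2)) \<le> pi"
    using sum_Lorentz_nat[OF a, of M] by simp
  finally show ?thesis by simp
qed

text \<open>After division by \<open>g = gcd\<close> of the two integer coordinates of \<open>p\<close>, a pair \<open>(z\<^sub>i, z\<^sub>j)\<close>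
  is determined by the value of the minor together with the block of length \<open>\<bar>a\<bar>\<close> containing
  \<open>z\<^sub>i\<close>, and the minor takes only values in \<open>(g / L\<^sup>2) \<int>\<close>. This makes the bound
  independent of \<open>A\<close>.\<close>

lemma sum_wedge_Lorentz:
  fixes p c :: "real^'n"
  assumes L: "L > 0" and r: "r \<ge> 1 / L" and p: "p \<in> lattice L" and pi: "p $ i \<noteq> 0" and A: "A \<ge> 0"
    and S: "S = {z \<in> lattice L. (\<forall>m. \<bar>z $ m - c $ m\<bar> \<le> r) \<and> minor p z i j \<noteq> 0}"
  shows "(\<Sum>z\<in>S. A / (1 + (A * minor p z i j)\<^sup>2))
     \<le> pi * L\<^sup>2 * (1 + 2 * r / \<bar>p $ i\<bar>) * (3 * r * L) ^ (CARD('n) - 2)"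
proof (cases "S = {} \<or> A = 0")
  case True
  have "r > 0" using L r by (metis less_le_trans zero_less_divide_1_iff)
  then show ?thesis using True L by (auto intro!: mult_nonneg_nonneg add_nonneg_nonneg)
next
  case False
  then have A: "A > 0" and ij: "i \<noteq> j" using A S by auto
  have r0: "r > 0" using L r by (metis less_le_trans zero_less_divide_1_iff)
  define X where "X z m = \<lfloor>z $ m * L\<rfloor>" for z :: "real^'n" and m
  have X: "z $ m = of_int (X z m) / L" if "z \<in> lattice L" for z m
    using lattice_coordE[OF that L, of m] L unfolding X_def
      by (metis nonzero_mult_div_cancel_right less_irrefl)
  define g where "g = gcd (X p i) (X p j)"
  define a where "a = X p i div g"
  define b where "b = X p j div g"
  have Xpi: "X p i \<noteq> 0" using pi X[OF p, of i] by auto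
  have g: "g > 0" using Xpi by (simp add: g_def)
  have ga: "X p i = g * a" and gb: "X p j = g * b" by (auto simp: a_def b_def g_def)
  have a0: "a \<noteq> 0" using Xpi ga by auto
  have cop: "coprime a b" using Xpi unfolding a_def b_def g_def by (simp add: div_gcd_coprime)
  have pa: "\<bar>p $ i\<bar> = of_int g * of_int \<bar>a\<bar> / L"
    using X[OF p, of i] ga g L by (simp add: abs_mult)
  define n where "n z = a * X z j - b * X z i" for z
  \<comment> \<open>Lower end of the i-th integer coordinates on \<open>S\<close>; subtracting it
    makes \<open>q\<close> a block number that starts at 0, so at most Q + 1 blocks occur.\<close>
  define lo where "lo = \<lceil>(c $ i - r) * L\<rceil>"
  define q where "q z = nat ((X z i - lo) div \<bar>a\<bar>)" for z
  define J where "J = UNIV - {i, j}"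
  define h where "h z = (n z, q z, (\<lambda>m\<in>J. X z m))" for z
  define Q where "Q = nat \<lfloor>2 * r * L / of_int \<bar>a\<bar>\<rfloor>"
  define P where "P = (\<Pi>\<^sub>E m\<in>J. int_box c r L m)"
  have w: "minor p z i j = of_int g * of_int (n z) / L\<^sup>2" if "z \<in> lattice L" for z
    by (simp add: X[OF that] X[OF p] ga gb n_def power2_eq_square algebra_simps diff_divide_distrib)
  have lo: "0 \<le> X z i - lo" "of_int (X z i - lo) \<le> 2 * r * L" if "z \<in> S" for z
  proof -
    have z: "z \<in> lattice L" "\<bar>z $ i - c $ i\<bar> \<le> r" using that S by auto
    have "c $ i - r \<le> z $ i" "z $ i \<le> c $ i + r" using z(2) by (auto simp: abs_le_iff)
    then have "(c $ i - r) * L \<le> z $ i * L" "z $ i * L \<le> (c $ i + r) * L" using L by auto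
    then have 1: "(c $ i - r) * L \<le> of_int (X z i)" "of_int (X z i) \<le> (c $ i + r) * L"
      using lattice_coordE[OF z(1) L, of i] by (auto simp: X_def)
    show "0 \<le> X z i - lo" using 1(1) by (simp add: lo_def ceiling_le_iff)
    have "(c $ i - r) * L \<le> of_int lo" by (simp add: lo_def)
    then have "of_int (X z i) - of_int lo \<le> (c $ i + r) * L - (c $ i - r) * L" using 1(2)
      by linarith
    also have "\<dots> = 2 * r * L" by (simp add: algebra_simps)
    finally show "of_int (X z i - lo) \<le> 2 * r * L" by simp
  qed
  have finS: "finite S"
    by (rule lattice_box_card(1)[OF L r, where J = UNIV and c = c]) (auto simp: S vec_eq_iff)
  have inj: "inj_on h S"
  proof (rule inj_onI)
    fix x y assume xy: "x \<in> S" "y \<in> S" "h x = h y"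
    have nn: "n x = n y" and qq: "q x = q y" and JJ': "(\<lambda>m\<in>J. X x m) = (\<lambda>m\<in>J. X y m)"
      using xy(3) by (simp_all add: h_def)
    have JJ: "X x m = X y m" if "m \<in> J" for m using fun_cong[OF JJ', of m] that by simp
    \<comment> \<open>Equal minors and coprimality make the two i-th coordinates congruent modulo
      \<open>a\<close>; within one block of length |a| they must then be equal.\<close>
    have "a * (X x j - X y j) = b * (X x i - X y i)" using nn by (simp add: n_def algebra_simps)
    then have "a dvd b * (X x i - X y i)" by (metis dvd_triv_left)
    then have dvd: "a dvd X x i - X y i" using cop by (simp add: coprime_dvd_mult_right_iff)
    have "(X x i - lo) div \<bar>a\<bar> = (X y i - lo) div \<bar>a\<bar>"
      using qq lo(1)[OF xy(1)] lo(1)[OF xy(2)] a0 unfolding q_def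
      by (metis nat_eq_iff2 pos_imp_zdiv_nonneg_iff zero_less_abs_iff)
    moreover have "(X x i - lo) mod \<bar>a\<bar> = (X y i - lo) mod \<bar>a\<bar>"
      using dvd by (simp add: mod_eq_dvd_iff)
    ultimately have "X x i - lo = X y i - lo" by (metis div_mult_mod_eq)
    then have i: "X x i = X y i" by simp
    then have j: "X x j = X y j" using nn a0 by (simp add: n_def)
    have "X x m = X y m" for m using i j JJ by (cases "m \<in> J") (auto simp: J_def)
    then have "x $ m = y $ m" for m using X xy S by simp
    then show "x = y" by (simp add: vec_eq_iff)
  qed
  define N where "N = n ` S"
  have N: "finite N" "0 \<notin> N"
  proof -
    show "finite N" using finS by (simp add: N_def)
    show "0 \<notin> N" using w unfolding N_def S by fastforce
  qed
  have qQ: "q z \<le> Q" if "z \<in> S" for z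
  proof -
    have "of_int ((X z i - lo) div \<bar>a\<bar>) \<le> of_int (X z i - lo) / (of_int \<bar>a\<bar> :: real)"
      by (rule real_of_int_div4)
    also have "\<dots> \<le> 2 * r * L / of_int \<bar>a\<bar>"
      by (rule divide_right_mono[OF lo(2)[OF that]]) simp
    finally have "(X z i - lo) div \<bar>a\<bar> \<le> \<lfloor>2 * r * L / of_int \<bar>a\<bar>\<rfloor>" by (simp add: le_floor_iff)
    then show ?thesis unfolding q_def Q_def by (rule nat_mono)
  qed
  have inP: "(\<lambda>m\<in>J. X z m) \<in> P" if "z \<in> S" for z
    using lattice_box_coords[of z L J c r] that L by (simp add: P_def X_def S)
  have sub: "h ` S \<subseteq> N \<times> {..Q} \<times> P"
  proof
    fix x assume "x \<in> h ` S"
    then obtain z where "z \<in> S" "x = h z" by blast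
    then show "x \<in> N \<times> {..Q} \<times> P"
      using qQ[of z] inP[of z] by (simp add: h_def N_def)
  qed
  have finP: "finite P" and cardP: "real (card P) \<le> (3 * r * L) ^ card J"
    using card_restrict_box[OF L r, where J = J and c = c] by (auto simp: P_def)
  have cJ: "card J = CARD('n) - 2" using ij by (simp add: J_def card_Diff_subset)
  \<comment> \<open>The minor equals g n / L^2 with an integer n, so the profile becomes L^2 / g
    times an integer Lorentz sum of step \<open>B\<close>.\<close>
  define B where "B = A * of_int g / L\<^sup>2"
  have B: "B > 0" using A g L by (simp add: B_def)
  define \<phi> where "\<phi> m = A / (1 + (B * real_of_int m)\<^sup>2)" for m
  have \<phi>0: "\<phi> m \<ge> 0" for m using A by (simp add: \<phi>_def)
  have "(\<Sum>z\<in>S. A / (1 + (A * minor p z i j)\<^sup>2)) = (\<Sum>z\<in>S. \<phi> (fst (h z)))"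
    by (intro sum.cong refl) (simp add: w S \<phi>_def h_def B_def mult.assoc)
  also have "\<dots> = (\<Sum>x\<in>h ` S. \<phi> (fst x))"
    by (subst sum.reindex[OF inj]) simp
  also have "\<dots> \<le> (\<Sum>x\<in>N \<times> {..Q} \<times> P. \<phi> (fst x))"
    using sub N finP \<phi>0 by (intro sum_mono2) auto
  also have "\<dots> = (\<Sum>m\<in>N. \<phi> m) * ((1 + real Q) * real (card P))"
  proof -
    have "(\<Sum>x\<in>N \<times> {..Q} \<times> P. \<phi> (fst x)) = (\<Sum>m\<in>N. \<Sum>y\<in>{..Q} \<times> P. \<phi> m)"
      by (subst sum.cartesian_product) (simp add: case_prod_beta)
    also have "\<dots> = (\<Sum>m\<in>N. \<phi> m) * ((1 + real Q) * real (card P))"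
      by (simp add: card_cartesian_product sum_distrib_left sum_distrib_right sum.distrib[symmetric]
        algebra_simps)
    finally show ?thesis .
  qed
  also have "(\<Sum>m\<in>N. \<phi> m) \<le> pi * L\<^sup>2 / of_int g"
  proof -
    have "\<phi> m = L\<^sup>2 / of_int g * (B / (1 + (B * real_of_int m)\<^sup>2))" for m
      using g L by (simp add: \<phi>_def B_def)
    then have "(\<Sum>m\<in>N. \<phi> m) = L\<^sup>2 / of_int g * (\<Sum>m\<in>N. B / (1 + (B * real_of_int m)\<^sup>2))"
      by (simp add: sum_distrib_left)
    also have "\<dots> \<le> L\<^sup>2 / of_int g * pi"
      using sum_Lorentz_int[OF B N] g by (intro mult_left_mono) auto
    finally show ?thesis by (simp add: mult.commute)
  qed
  also have "pi * L\<^sup>2 / of_int g * ((1 + real Q) * real (card P))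
      \<le> pi * L\<^sup>2 * (1 + 2 * r / \<bar>p $ i\<bar>) * (3 * r * L) ^ (CARD('n) - 2)"
  proof -
    \<comment> \<open>The spacing of the minors contributes 1/g and the number of blocks about 2 r L
      / |a|. As g |a| = L |p_i|, the common divisor disappears from the main term and only helps in
      the other one.\<close>
    have "real Q \<le> 2 * r * L / of_int \<bar>a\<bar>" unfolding Q_def using r0 L by simp
    then have "(1 + real Q) / of_int g \<le> (1 + 2 * r * L / of_int \<bar>a\<bar>) / of_int g"
      using g by (intro divide_right_mono) auto
    also have "\<dots> = 1 / of_int g + 2 * r / \<bar>p $ i\<bar>"
      using g a0 L by (simp add: pa field_simps)
    also have "\<dots> \<le> 1 + 2 * r / \<bar>p $ i\<bar>" using g by simp
    finally have "pi * L\<^sup>2 * ((1 + real Q) / of_int g) * real (card P)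
       \<le> pi * L\<^sup>2 * (1 + 2 * r / \<bar>p $ i\<bar>) * (3 * r * L) ^ (CARD('n) - 2)"
      using cardP cJ r0 by (intro mult_mono mult_left_mono) auto
    then show ?thesis by (simp only: times_divide_eq_left times_divide_eq_right mult.assoc)
  qed
  finally show ?thesis using \<phi>0 by (simp add: mult_right_mono)
qed

section \<open>Dyadic summation over the lattice\<close>

lemma borel_measurable_nu [measurable, simp]: "f \<in> borel_measurable (nu L)"
  by (simp add: nu_def)

lemma space_nu [simp]: "space (nu L) = lattice L"
  by (simp add: nu_def)

lemma nn_integral_nu:
  fixes f :: "real^'n \<Rightarrow> ennreal"
  shows "(\<integral>\<^sup>+z. f z \<partial>nu L) = ennreal (1 / L ^ CARD('n)) * (\<integral>\<^sup>+z. f z \<partial>count_space (lattice L))"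
  unfolding nu_def by (subst nn_integral_density) (auto simp: nn_integral_cmult)

lemma nn_integral_nu_finite:
  fixes f :: "real^'n \<Rightarrow> real"
  assumes L: "L > 0" and S: "finite S" "S \<subseteq> lattice L" and f: "\<And>z. z \<in> S \<Longrightarrow> f z \<ge> 0"
  shows "(\<integral>\<^sup>+z. ennreal (f z) * indicator S z \<partial>nu L) = ennreal ((\<Sum>z\<in>S. f z) / L ^ CARD('n))"
proof -
  have "(\<integral>\<^sup>+z. ennreal (f z) * indicator S z \<partial>count_space (lattice L)) = (\<Sum>z\<in>S. ennreal (f z))"
    using S by (subst nn_integral_count_space'[where A = S]) (auto simp: indicator_def)
  then show ?thesis
    using L f by (simp add: nn_integral_nu sum_ennreal sum_nonneg flip: ennreal_mult)
qed

lemma nn_integral_nu_box: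
  fixes c :: "real^'n"
  assumes L: "L > 0" and r: "r \<ge> 1 / L" and S: "S \<subseteq> lattice L"
    and box: "\<And>z m. z \<in> S \<Longrightarrow> m \<in> J \<Longrightarrow> \<bar>z $ m - c $ m\<bar> \<le> r"
    and det: "\<And>x y. x \<in> S \<Longrightarrow> y \<in> S \<Longrightarrow> \<forall>m\<in>J. x $ m = y $ m \<Longrightarrow> x = y"
  shows "(\<integral>\<^sup>+z. indicator S z \<partial>nu L) \<le> ennreal ((3 * r * L) ^ card J / L ^ CARD('n))"
proof -
  have *: "finite S" "real (card S) \<le> (3 * r * L) ^ card J"
    using lattice_box_card[OF L r S box det] by blast+
  have "(\<integral>\<^sup>+z. indicator S z \<partial>nu L) = ennreal (real (card S) / L ^ CARD('n))"
    using nn_integral_nu_finite[OF L *(1) S, of "\<lambda>_. 1"] by simp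
  also have "\<dots> \<le> ennreal ((3 * r * L) ^ card J / L ^ CARD('n))"
    using * L by (intro ennreal_leI divide_right_mono) auto
  finally show ?thesis .
qed

text \<open>The powers of L cancel exactly: L^2 comes from the spacing of the minors and L^(d-2)
  from the coordinates other than i and j.\<close>

lemma nn_integral_nu_wedge_Lorentz:
  fixes p c :: "real^'n"
  assumes d: "CARD('n) \<ge> 2"
    and L: "L > 0" and r: "r \<ge> 1 / L" and p: "p \<in> lattice L" and pi: "p $ i \<noteq> 0" and A: "A \<ge> 0"
    and S: "S = {z \<in> lattice L. (\<forall>m. \<bar>z $ m - c $ m\<bar> \<le> r) \<and> minor p z i j \<noteq> 0}"
  shows "(\<integral>\<^sup>+z. ennreal (A / (1 + (A * minor p z i j)\<^sup>2)) * indicator S z \<partial>nu L)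
     \<le> ennreal (pi * (1 + 2 * r / \<bar>p $ i\<bar>) * (3 * r) ^ (CARD('n) - 2))"
proof -
  have finS: "finite S"
    by (rule lattice_box_card(1)[OF L r, where J = UNIV and c = c]) (auto simp: S vec_eq_iff)
  have "(\<integral>\<^sup>+z. ennreal (A / (1 + (A * minor p z i j)\<^sup>2)) * indicator S z \<partial>nu L)
    = ennreal ((\<Sum>z\<in>S. A / (1 + (A * minor p z i j)\<^sup>2)) / L ^ CARD('n))"
    by (rule nn_integral_nu_finite[OF L finS])
      (use A in \<open>auto simp: S intro!: divide_nonneg_nonneg\<close>)
  also have "\<dots> \<le> ennreal ((pi * L\<^sup>2 * (1 + 2 * r / \<bar>p $ i\<bar>)
    * (3 * r * L) ^ (CARD('n) - 2)) / L ^ CARD('n))"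
    using sum_wedge_Lorentz[OF L r p pi A S] L by (intro ennreal_leI divide_right_mono) auto
  also have "(pi * L\<^sup>2 * (1 + 2 * r / \<bar>p $ i\<bar>) * (3 * r * L) ^ (CARD('n) - 2)) / L ^ CARD('n)
    = pi * (1 + 2 * r / \<bar>p $ i\<bar>) * (3 * r) ^ (CARD('n) - 2)"
  proof -
    have "L ^ CARD('n) = L\<^sup>2 * L ^ (CARD('n) - 2)" using d by (metis le_add_diff_inverse power_add)
    then show ?thesis using L by (simp add: power_mult_distrib)
  qed
  finally show ?thesis .
qed

lemma lattice_norm_ge:
  assumes z: "z \<in> lattice L" and L: "L > 0"
  shows "1 / L \<le> norm z"
proof -
  obtain i where i: "z $ i \<noteq> 0" using z by (auto simp: lattice_def vec_eq_iff)
  obtain m :: int where m: "z $ i = of_int m / L" using z by (auto simp: lattice_def)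
  then have "1 \<le> \<bar>real_of_int m\<bar>" using i by auto
  then have "1 / L \<le> \<bar>z $ i\<bar>" using L by (simp add: m divide_right_mono)
  then show ?thesis using component_le_norm_cart[of z i] by linarith
qed

text \<open>Turns estimates on balls into estimates with a decaying weight. In use \<open>x\<close>
  is the distance to a centre c and \<open>D\<close> is <z - c>. The gap of one between
  \<open>e\<close> and \<open>s\<close> makes the dyadic series geometric with ratio 1/2.\<close>

lemma dyadic_decay:
  fixes M :: "'a measure" and g :: "'a \<Rightarrow> ennreal" and x D :: "'a \<Rightarrow> real"
  assumes [measurable]: "g \<in> borel_measurable M" "x \<in> borel_measurable M" "D \<in> borel_measurable M"
    and D: "\<And>z. z \<in> space M \<Longrightarrow> D z \<ge> 1" "\<And>z. z \<in> space M \<Longrightarrow> D z \<ge> x z"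
    and a: "a \<ge> 0" and es: "e + 1 \<le> s"
    and I: "\<And>n. (\<integral>\<^sup>+z. g z * indicator {z. x z \<le> 2 ^ n} z \<partial>M) \<le> ennreal (a * 2 ^ (n * e))"
  shows "(\<integral>\<^sup>+z. g z * ennreal (1 / D z ^ s) \<partial>M) \<le> ennreal (2 ^ (s + 1) * a)"
proof -
  let ?J = "\<lambda>n::nat. \<integral>\<^sup>+z. g z * indicator {z. x z \<le> 2 ^ n} z \<partial>M"
  define b :: "nat \<Rightarrow> real" where "b n = 2 ^ s / 2 ^ (n * s)" for n
  have pt: "g z * ennreal (1 / D z ^ s)
    \<le> (\<Sum>n. ennreal (b n) * (g z * indicator {z. x z \<le> 2 ^ n} z))"
    if z: "z \<in> space M" for z
  proof -
    \<comment> \<open>No partition into shells is needed: each point is charged to the smallest ball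
      containing it, one term of a nonnegative series. Minimality gives \<open>D z\<close> at least
      half the radius; at n = 0 this comes from \<open>D z\<close> being at least 1.\<close>
    define n where "n = (LEAST n. x z \<le> 2 ^ n)"
    have "\<exists>n. x z \<le> 2 ^ n" using real_arch_pow[of 2 "x z"] by (auto intro: less_imp_le)
    then have n: "x z \<le> 2 ^ n" unfolding n_def by (rule LeastI_ex)
    have "D z \<ge> 2 ^ n / 2"
    proof (cases n)
      case 0
      then show ?thesis using D(1)[OF z] by simp
    next
      case (Suc m)
      then have "\<not> x z \<le> 2 ^ m" using not_less_Least[of m "\<lambda>n. x z \<le> 2 ^ n"] by (simp add: n_def)
      then show ?thesis using D(2)[OF z] Suc by simp
    qed
    then have "(2 ^ n / 2) ^ s \<le> D z ^ s" by (intro power_mono) auto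
    then have "1 / D z ^ s \<le> 1 / (2 ^ n / 2) ^ s" by (intro divide_left_mono)
      (use D(1)[OF z] in auto)
    also have "\<dots> = b n" by (simp add: b_def power_divide power_mult)
    finally have "g z * ennreal (1 / D z ^ s) \<le> g z * ennreal (b n)"
      by (intro mult_left_mono ennreal_leI) auto
    also have "\<dots> = (\<Sum>k\<in>{n}. ennreal (b k) * (g z * indicator {z. x z \<le> 2 ^ k} z))"
      using n by (simp add: mult.commute)
    also have "\<dots> \<le> (\<Sum>n. ennreal (b n) * (g z * indicator {z. x z \<le> 2 ^ n} z))"
      by (rule sum_le_suminf) auto
    finally show ?thesis .
  qed
  have "(\<integral>\<^sup>+z. g z * ennreal (1 / D z ^ s) \<partial>M)
     \<le> (\<integral>\<^sup>+z. (\<Sum>n. ennreal (b n) * (g z * indicator {z. x z \<le> 2 ^ n} z)) \<partial>M)"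
    by (rule nn_integral_mono) (rule pt)
  also have "\<dots> = (\<Sum>n. ennreal (b n) * ?J n)"
    by (subst nn_integral_suminf) (auto simp: nn_integral_cmult)
  also have "\<dots> \<le> (\<Sum>n. ennreal (2 ^ s * a * (1 / 2) ^ n))"
  proof (rule suminf_le)
    fix n
    have "ennreal (b n) * ?J n \<le> ennreal (b n) * ennreal (a * 2 ^ (n * e))"
      by (intro mult_left_mono I) auto
    also have "\<dots> = ennreal (b n * (a * 2 ^ (n * e)))"
      using a by (subst ennreal_mult) (auto simp: b_def)
    also have "\<dots> \<le> ennreal (2 ^ s * a * (1 / 2) ^ n)"
    proof (rule ennreal_leI)
      have "(2::real) ^ (n * e) * 2 ^ n \<le> 2 ^ (n * s)"
        using mult_le_mono2[OF es, of n] by (simp flip: power_add)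
      then have "2 ^ s * a * (2 ^ (n * e) * 2 ^ n) \<le> 2 ^ s * a * 2 ^ (n * s)"
        using a by (intro mult_left_mono) auto
      then show "b n * (a * 2 ^ (n * e)) \<le> 2 ^ s * a * (1 / 2) ^ n"
        by (simp add: b_def field_simps)
    qed
    finally show "ennreal (b n) * ?J n \<le> ennreal (2 ^ s * a * (1 / 2) ^ n)" .
  qed auto
  also have "\<dots> = ennreal (\<Sum>n. 2 ^ s * a * (1 / 2) ^ n)"
    using a by (intro suminf_ennreal2) (auto intro: summable_mult summable_geometric)
  also have "(\<Sum>n. 2 ^ s * a * (1 / 2) ^ n) = 2 ^ s * a * 2"
    by (subst suminf_mult) (auto simp: suminf_geometric summable_geometric)
  finally show ?thesis by (simp add: mult_ac)
qed

text \<open>The counterpart at small scales, for the weight sqrt(\<rho>/|z|) of the columns. The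
  function \<open>G\<close> has a radius as a parameter because the profile there has scale |z|;
  monotonicity replaces this scale by the radius of the ball. Mass that halves with the radius beats
  the growth of the square root.\<close>

lemma dyadic_singularity:
  fixes M :: "'a measure" and G :: "real \<Rightarrow> 'a \<Rightarrow> ennreal" and x :: "'a \<Rightarrow> real"
  assumes [measurable]: "\<And>r. G r \<in> borel_measurable M" "x \<in> borel_measurable M"
    and x: "\<And>z. z \<in> space M \<Longrightarrow> x z > 0"
    and G: "\<And>z r. z \<in> space M \<Longrightarrow> x z \<le> r \<Longrightarrow> G (x z) z \<le> G r z"
    and \<rho>: "\<rho> > 0" and a: "a \<ge> 0"
    and I: "\<And>n. (\<integral>\<^sup>+z. G (\<rho> / 2 ^ n) z * indicator {z. x z \<le> \<rho> / 2 ^ n} z \<partial>M) \<le> ennreal (a / 2 ^ n)"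
  shows "(\<integral>\<^sup>+z. ennreal (sqrt (\<rho> / x z)) * G (x z) z * indicator {z. x z \<le> \<rho>} z \<partial>M)
    \<le> ennreal (8 * a)"
proof -
  let ?J = "\<lambda>n::nat. \<integral>\<^sup>+z. G (\<rho> / 2 ^ n) z * indicator {z. x z \<le> \<rho> / 2 ^ n} z \<partial>M"
  \<comment> \<open>A substitute for sqrt(2^(n+1)), valid because the square root of 2 is below 3/2.
    Together with the mass a / 2^n the ratio is 3/4, the series sums to 4 times its first term 2 a,
    and this gives the 8.\<close>
  define b :: "nat \<Rightarrow> real" where "b n = 2 * (3 / 2) ^ n" for n
  have pt: "ennreal (sqrt (\<rho> / x z)) * G (x z) z * indicator {z. x z \<le> \<rho>} z
     \<le> (\<Sum>n. ennreal (b n) * (G (\<rho> / 2 ^ n) z * indicator {z. x z \<le> \<rho> / 2 ^ n} z))"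
    if z: "z \<in> space M" for z
  proof (cases "x z \<le> \<rho>")
    case True
    define n where "n = (LEAST n. \<rho> / 2 ^ Suc n < x z)"
    have "\<exists>n. \<rho> / 2 ^ Suc n < x z"
    proof -
      obtain n where "\<rho> / x z < 2 ^ n" using real_arch_pow[of 2 "\<rho> / x z"] by auto
      also have "(2::real) ^ n \<le> 2 ^ Suc n" by simp
      finally have "\<rho> / 2 ^ Suc n < x z" using x[OF z] \<rho> by (simp add: field_simps)
      then show ?thesis by blast
    qed
    then have n: "\<rho> / 2 ^ Suc n < x z" unfolding n_def by (rule LeastI_ex)
    have n2: "x z \<le> \<rho> / 2 ^ n"
    proof (cases n)
      case 0
      then show ?thesis using True by simp
    next
      case (Suc m)
      then show ?thesis using not_less_Least[of m "\<lambda>n. \<rho> / 2 ^ Suc n < x z"] by (simp add: n_def)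
    qed
    have "sqrt (\<rho> / x z) \<le> sqrt ((b n)\<^sup>2)"
    proof (rule real_sqrt_le_mono)
      have "\<rho> / x z \<le> 2 ^ Suc n" using n x[OF z] \<rho> by (simp add: field_simps)
      also have "\<dots> \<le> 4 * (9 / 4) ^ n" 
        using power_mono[of 2 "9/4 :: real" n] zero_le_power[of "9/4 :: real" n] unfolding power_Suc
          by linarith
      also have "\<dots> = (b n)\<^sup>2"
      proof -
        have "((3 / 2 :: real) ^ n)\<^sup>2 = ((3 / 2)\<^sup>2) ^ n" by (metis mult.commute power_mult)
        then show ?thesis by (simp add: b_def power_mult_distrib power2_eq_square)
      qed
      finally show "\<rho> / x z \<le> (b n)\<^sup>2" .
    qed
    also have "\<dots> = b n" by (subst real_sqrt_abs) (simp add: b_def)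
    finally have "ennreal (sqrt (\<rho> / x z)) * G (x z) z * indicator {z. x z \<le> \<rho>} z \<le> ennreal (b n)
      * G (\<rho> / 2 ^ n) z"
      using True G[OF z n2] by (auto intro!: mult_mono ennreal_leI)
    also have "\<dots> = (\<Sum>k\<in>{n}. ennreal (b k) * (G (\<rho> / 2 ^ k) z * indicator {z. x z \<le> \<rho> / 2 ^ k} z))"
      using n2 by simp
    also have "\<dots> \<le> (\<Sum>n. ennreal (b n) * (G (\<rho> / 2 ^ n) z * indicator {z. x z \<le> \<rho> / 2 ^ n} z))"
      by (rule sum_le_suminf) auto
    finally show ?thesis .
  qed simp
  have "(\<integral>\<^sup>+z. ennreal (sqrt (\<rho> / x z)) * G (x z) z * indicator {z. x z \<le> \<rho>} z \<partial>M)
     \<le> (\<integral>\<^sup>+z. (\<Sum>n. ennreal (b n) * (G (\<rho> / 2 ^ n) z * indicator {z. x z \<le> \<rho> / 2 ^ n} z)) \<partial>M)"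
    by (rule nn_integral_mono) (rule pt)
  also have "\<dots> = (\<Sum>n. ennreal (b n) * ?J n)"
    by (subst nn_integral_suminf) (auto simp: nn_integral_cmult)
  also have "\<dots> \<le> (\<Sum>n. ennreal (2 * a * (3 / 4) ^ n))"
  proof (rule suminf_le)
    fix n
    have "ennreal (b n) * ?J n \<le> ennreal (b n) * ennreal (a / 2 ^ n)"
      by (intro mult_left_mono I) auto
    also have "\<dots> = ennreal (b n * (a / 2 ^ n))"
      using a by (subst ennreal_mult) (auto simp: b_def)
    also have "b n * (a / 2 ^ n) = 2 * a * ((3 / 2) ^ n / 2 ^ n)"
      by (simp add: b_def)
    also have "(3 / 2) ^ n / 2 ^ n = ((3 / 4) ^ n :: real)"
      by (simp flip: power_divide)
    finally show "ennreal (b n) * ?J n \<le> ennreal (2 * a * (3 / 4) ^ n)" .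
  qed auto
  also have "\<dots> = ennreal (\<Sum>n. 2 * a * (3 / 4) ^ n)"
    using a by (intro suminf_ennreal2) (auto intro!: summable_mult summable_geometric)
  also have "(\<Sum>n. 2 * a * (3 / 4) ^ n) = 2 * a * 4"
    by (subst suminf_mult) (auto simp: suminf_geometric summable_geometric)
  finally show ?thesis by (simp add: mult_ac)
qed

section \<open>Weighted sums over the whole lattice, over lines and along a minor\<close>

lemma jap_ge_1: "jap x \<ge> 1"
  by (simp add: jap_def)

lemma jap_pos: "jap x > 0"
  using jap_ge_1[of x] by linarith

lemma jap_ge_norm: "jap x \<ge> norm x"
  unfolding jap_def by (rule real_le_rsqrt) simp

lemma jap_power2: "(jap x)\<^sup>2 = 1 + (norm x)\<^sup>2"
  by (simp add: jap_def)

text \<open>Balls of radius r have normalised mass of order r^d, so d + 1 powers suffice. As L is at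
  least 1, even the smallest ball, of radius 1, is large enough for the counting bound.\<close>

lemma nn_integral_nu_jap:
  fixes c :: "real^'n"
  assumes L: "L \<ge> 1"
  shows "(\<integral>\<^sup>+z. ennreal (1 / jap (z - c) ^ (CARD('n) + 1)) \<partial>nu L)
    \<le> ennreal (2 ^ (CARD('n) + 2) * 3 ^ CARD('n))"
proof -
  let ?d = "CARD('n)"
  have "(\<integral>\<^sup>+z. 1 * ennreal (1 / jap (z - c) ^ (?d + 1)) \<partial>nu L)
    \<le> ennreal (2 ^ (?d + 1 + 1) * 3 ^ ?d)"
  proof (rule dyadic_decay[where x = "\<lambda>z. norm (z - c)" and e = "?d"])
    fix n :: nat
    have r: "1 / L \<le> 2 ^ n" using L by (simp add: order_trans[of _ 1])
    have "(\<integral>\<^sup>+z. 1 * indicator {z. norm (z - c) \<le> 2 ^ n} z \<partial>nu L)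
       = (\<integral>\<^sup>+z. indicator {z \<in> lattice L. norm (z - c) \<le> 2 ^ n} z \<partial>nu L)"
      by (intro nn_integral_cong) (simp add: indicator_def)
    also have "\<dots> \<le> ennreal ((3 * 2 ^ n * L) ^ card (UNIV :: 'n set) / L ^ ?d)"
      using L r by (intro nn_integral_nu_box[where c = c])
        (auto simp: vec_eq_iff intro: order_trans[OF component_le_norm_cart, of
          "_ - c", simplified])
    also have "(3 * 2 ^ n * L) ^ card (UNIV :: 'n set) / L ^ ?d = 3 ^ ?d * 2 ^ (n * ?d)"
      using L by (simp add: power_mult_distrib power_mult)
    finally show "(\<integral>\<^sup>+z. 1 * indicator {z. norm (z - c) \<le> 2 ^ n} z \<partial>nu L)
      \<le> ennreal (3 ^ ?d * 2 ^ (n * ?d))" .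
  qed (auto simp: jap_ge_1 jap_ge_norm)
  then show ?thesis by simp
qed

text \<open>A point collinear with p is a multiple of it, and the multiple can be read off at a
  coordinate where p does not vanish.\<close>

lemma collinear_det:
  fixes p x y :: "real^'n"
  assumes "p $ i \<noteq> 0" "wedge p x = 0" "wedge p y = 0" "x $ i = y $ i"
  shows "x = y"
proof -
  have "x $ j = y $ j" for j
  proof -
    have "p $ i * x $ j = p $ j * x $ i" "p $ i * y $ j = p $ j * y $ i"
      using assms(2,3) by (simp_all add: wedge_def vec_eq_iff)
    then have "p $ i * x $ j = p $ i * y $ j" using assms(4) by simp
    then show ?thesis using assms(1) by simp
  qed
  then show ?thesis by (simp add: vec_eq_iff)
qed

text \<open>One free coordinate yields one factor L against the normalisation:
  \<open>L / L ^ CARD('n)\<close> is the form in which the gain L^(1-d) is carried until the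
  end.\<close>

lemma nn_integral_nu_collinear_box:
  fixes p c :: "real^'n"
  assumes L: "L > 0" and r: "r \<ge> 1 / L" and p: "p $ i \<noteq> 0"
  shows "(\<integral>\<^sup>+z. indicator {z. wedge p z = 0} z * indicator {z. norm (z - c) \<le> r} z \<partial>nu L)
    \<le> ennreal (3 * r * (L / L ^ CARD('n)))"
proof -
  have "(\<integral>\<^sup>+z. indicator {z. wedge p z = 0} z * indicator {z. norm (z - c) \<le> r} z \<partial>nu L)
     = (\<integral>\<^sup>+z. indicator {z \<in> lattice L. wedge p z = 0 \<and> norm (z - c) \<le> r} z \<partial>nu L)"
    by (intro nn_integral_cong) (simp add: indicator_def)
  also have "\<dots> \<le> ennreal ((3 * r * L) ^ card {i} / L ^ CARD('n))"
    using L r p by (intro nn_integral_nu_box[where c = c])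
        (auto intro: collinear_det order_trans[OF component_le_norm_cart, of "_ - c", simplified])
  finally show ?thesis by simp
qed

lemma nn_integral_nu_collinear_jap:
  fixes p c :: "real^'n"
  assumes L: "L \<ge> 1" and p: "p $ i \<noteq> 0"
  shows "(\<integral>\<^sup>+z. indicator {z. wedge p z = 0} z * ennreal (1 / jap (z - c) ^ (CARD('n) + 1)) \<partial>nu L)
    \<le> ennreal (2 ^ (CARD('n) + 2) * (3 * (L / L ^ CARD('n))))"
proof -
  let ?d = "CARD('n)"
  have "(\<integral>\<^sup>+z. indicator {z. wedge p z = 0} z * ennreal (1 / jap (z - c) ^ (?d + 1)) \<partial>nu L)
    \<le> ennreal (2 ^ (?d + 1 + 1) * (3 * (L / L ^ ?d)))"
  proof (rule dyadic_decay[where x = "\<lambda>z. norm (z - c)" and e = 1])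
    fix n :: nat
    have r: "1 / L \<le> 2 ^ n" using L by (simp add: order_trans[of _ 1])
    show "(\<integral>\<^sup>+z. indicator {z. wedge p z = 0} z * indicator {z. norm (z - c) \<le> 2 ^ n} z \<partial>nu L)
      \<le> ennreal (3 * (L / L ^ ?d) * 2 ^ (n * 1))"
      using nn_integral_nu_collinear_box[OF _ r p, of c] L by (simp add: mult_ac)
  qed (use L in \<open>auto simp: jap_ge_1 jap_ge_norm Suc_leI\<close>)
  then show ?thesis by simp
qed

lemma nn_integral_nu_wedge_ball:
  fixes p c :: "real^'n"
  assumes d: "CARD('n) \<ge> 2"
    and L: "L > 0" and r: "r \<ge> 1 / L" and p: "p \<in> lattice L" and pi: "p $ i \<noteq> 0" and A: "A \<ge> 0"
  shows "(\<integral>\<^sup>+z. ennreal (A / (1 + (A * minor p z i j)\<^sup>2))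
       * indicator {z. minor p z i j \<noteq> 0} z * indicator {z. norm (z - c) \<le> r} z \<partial>nu L)
     \<le> ennreal (pi * (1 + 2 * r / \<bar>p $ i\<bar>) * (3 * r) ^ (CARD('n) - 2))"
proof -
  have "(\<integral>\<^sup>+z. ennreal (A / (1 + (A * minor p z i j)\<^sup>2))
       * indicator {z. minor p z i j \<noteq> 0} z * indicator {z. norm (z - c) \<le> r} z \<partial>nu L)
    \<le> (\<integral>\<^sup>+z. ennreal (A / (1 + (A * minor p z i j)\<^sup>2))
       * indicator {z \<in> lattice L. (\<forall>m. \<bar>z $ m - c $ m\<bar> \<le> r) \<and> minor p z i j \<noteq> 0} z \<partial>nu L)"
    using order_trans[OF component_le_norm_cart, of "_ - c", simplified]
    by (intro nn_integral_mono) (auto simp: indicator_def)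
  also have "\<dots> \<le> ennreal (pi * (1 + 2 * r / \<bar>p $ i\<bar>) * (3 * r) ^ (CARD('n) - 2))"
    by (rule nn_integral_nu_wedge_Lorentz[OF d L r p pi A refl])
  finally show ?thesis .
qed

text \<open>On a ball of radius r the profile sums to order r^(d-2) times 1 + 2 r / |p_i|, which
  grows like r^(d-1) at most; this is why the dyadic exponent is \<open>?d - 1\<close>. The factor
  with 1 / |p_i| is kept explicit and is compensated only in
  \<open>norm_div_jap_bound\<close>.\<close>

lemma nn_integral_nu_wedge_jap:
  fixes p c :: "real^'n"
  assumes d: "CARD('n) \<ge> 2"
    and L: "L \<ge> 1" and p: "p \<in> lattice L" and pi: "p $ i \<noteq> 0" and A: "A \<ge> 0"
  shows "(\<integral>\<^sup>+z. ennreal (A / (1 + (A * minor p z i j)\<^sup>2))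
       * indicator {z. minor p z i j \<noteq> 0} z * ennreal (1 / jap (z - c) ^ (CARD('n) + 1)) \<partial>nu L)
     \<le> ennreal (2 ^ (CARD('n) + 2) * (pi * (1 + 2 / \<bar>p $ i\<bar>) * 3 ^ (CARD('n) - 2)))"
proof -
  let ?d = "CARD('n)"
  have "(\<integral>\<^sup>+z. ennreal (A / (1 + (A * minor p z i j)\<^sup>2))
       * indicator {z. minor p z i j \<noteq> 0} z * ennreal (1 / jap (z - c) ^ (?d + 1)) \<partial>nu L)
     \<le> ennreal (2 ^ (?d + 1 + 1) * (pi * (1 + 2 / \<bar>p $ i\<bar>) * 3 ^ (?d - 2)))"
  proof (rule dyadic_decay[where x = "\<lambda>z. norm (z - c)" and e = "?d - 1"])
    fix n :: nat
    have r: "1 / L \<le> 2 ^ n" using L by (simp add: order_trans[of _ 1])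
    have "(\<integral>\<^sup>+z. ennreal (A / (1 + (A * minor p z i j)\<^sup>2))
       * indicator {z. minor p z i j \<noteq> 0} z * indicator {z. norm (z - c) \<le> 2 ^ n} z \<partial>nu L)
     \<le> ennreal (pi * (1 + 2 * 2 ^ n / \<bar>p $ i\<bar>) * (3 * 2 ^ n) ^ (?d - 2))"
      using L by (intro nn_integral_nu_wedge_ball d r p pi A) auto
    also have "\<dots> \<le> ennreal (pi * (1 + 2 / \<bar>p $ i\<bar>) * 3 ^ (?d - 2) * 2 ^ (n * (?d - 1)))"
    proof (rule ennreal_leI)
      have "1 + 2 * 2 ^ n / \<bar>p $ i\<bar> \<le> 2 ^ n * (1 + 2 / \<bar>p $ i\<bar>)"
        using one_le_power[of "2::real" n] by (simp add: distrib_left mult.commute)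
      then have "pi * (1 + 2 * 2 ^ n / \<bar>p $ i\<bar>) * (3 * 2 ^ n) ^ (?d - 2)
         \<le> pi * (2 ^ n * (1 + 2 / \<bar>p $ i\<bar>)) * (3 * 2 ^ n) ^ (?d - 2)"
        by (intro mult_right_mono mult_left_mono) auto
      also have "\<dots> = pi * (1 + 2 / \<bar>p $ i\<bar>) * 3 ^ (?d - 2) * (2 ^ n * 2 ^ (n * (?d - 2)))"
        by (simp add: power_mult_distrib power_mult)
      also have "(2::real) ^ n * 2 ^ (n * (?d - 2)) = 2 ^ (n * (?d - 1))"
      proof -
        have "n + n * (?d - 2) = n * (?d - 1)"
          using d by (cases "?d" rule: nat.exhaust) (auto simp: algebra_simps Suc_diff_le)
        then show ?thesis by (metis power_add)
      qed
      finally show "pi * (1 + 2 * 2 ^ n / \<bar>p $ i\<bar>) * (3 * 2 ^ n) ^ (?d - 2)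
         \<le> pi * (1 + 2 / \<bar>p $ i\<bar>) * 3 ^ (?d - 2) * 2 ^ (n * (?d - 1))" .
    qed
    finally show "(\<integral>\<^sup>+z. ennreal (A / (1 + (A * minor p z i j)\<^sup>2))
       * indicator {z. minor p z i j \<noteq> 0} z * indicator {z. norm (z - c) \<le> 2 ^ n} z \<partial>nu L)
      \<le> ennreal (pi * (1 + 2 / \<bar>p $ i\<bar>) * 3 ^ (?d - 2) * 2 ^ (n * (?d - 1)))" .
  qed (use d in \<open>simp_all add: jap_ge_1 jap_ge_norm\<close>)
  then show ?thesis by simp
qed

text \<open>Disposes of the dyadic balls of radius below 1 / L, to which the counting bounds do not
  apply: they contain no lattice point, as the origin is excluded.\<close>

lemma nn_integral_nu_indicator_small:
  assumes "L > 0" "r < 1 / L"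
  shows "(\<integral>\<^sup>+z. f z * indicator {z. norm z \<le> r} z \<partial>nu L) = 0"
proof -
  have "f z * indicator {z. norm z \<le> r} z = 0" if "z \<in> lattice L" for z
    using lattice_norm_ge[OF that assms(1)] assms(2) by (simp add: indicator_def)
  then show ?thesis by (subst nn_integral_cong[where v = "\<lambda>_. 0"]) auto
qed

lemma nn_integral_nu_singular:
  fixes \<rho> L :: real
  assumes L: "L > 0" and \<rho>: "\<rho> > 0"
  shows "(\<integral>\<^sup>+z. ennreal (sqrt (\<rho> / norm z))
    * indicator {z. norm z \<le> \<rho>} z \<partial>(nu L :: (real^'n) measure))
    \<le> ennreal (8 * (3 * \<rho>) ^ CARD('n))"
proof -
  let ?d = "CARD('n)"
  let ?M = "nu L :: (real^'n) measure"
  have "(\<integral>\<^sup>+z. ennreal (sqrt (\<rho> / norm z)) * 1 * indicator {z. norm z \<le> \<rho>} z \<partial>?M)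
    \<le> ennreal (8 * (3 * \<rho>) ^ ?d)"
  proof (rule dyadic_singularity[where G = "\<lambda>_ _. 1"])
    fix n :: nat
    show "(\<integral>\<^sup>+z. 1 * indicator {z. norm z \<le> \<rho> / 2 ^ n} z \<partial>?M) \<le> ennreal ((3 * \<rho>) ^ ?d / 2 ^ n)"
    proof (cases "\<rho> / 2 ^ n < 1 / L")
      case True
      show ?thesis by (subst nn_integral_nu_indicator_small[OF L True]) simp
    next
      case False
      have "(\<integral>\<^sup>+z. 1 * indicator {z. norm z \<le> \<rho> / 2 ^ n} z \<partial>?M)
        = (\<integral>\<^sup>+z. indicator {z \<in> lattice L. norm z \<le> \<rho> / 2 ^ n} z \<partial>?M)"
        by (intro nn_integral_cong) (simp add: indicator_def)
      also have "\<dots> \<le> ennreal ((3 * (\<rho> / 2 ^ n) * L) ^ card (UNIV :: 'n set) / L ^ ?d)"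
        using False L by (intro nn_integral_nu_box[where c = 0])
          (auto simp: vec_eq_iff intro: order_trans[OF component_le_norm_cart])
      also have "(3 * (\<rho> / 2 ^ n) * L) ^ card (UNIV :: 'n set) / L ^ ?d
        = (3 * \<rho>) ^ ?d / (2 ^ n) ^ ?d"
        using L by (simp add: power_mult_distrib power_divide)
      also have "\<dots> \<le> (3 * \<rho>) ^ ?d / 2 ^ n"
        using \<rho> by (intro divide_left_mono) (auto intro: self_le_power)
      finally show ?thesis by (simp add: ennreal_leI order_trans)
    qed
  qed (use \<rho> in \<open>auto simp: lattice_def\<close>)
  then show ?thesis by simp
qed

lemma nn_integral_nu_collinear_singular:
  fixes p :: "real^'n"
  assumes L: "L > 0" and \<rho>: "\<rho> > 0" and p: "p $ i \<noteq> 0"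
  shows "(\<integral>\<^sup>+z. ennreal (sqrt (\<rho> / norm z)) * indicator {z. wedge p z = 0} z
    * indicator {z. norm z \<le> \<rho>} z \<partial>nu L)
    \<le> ennreal (8 * (3 * \<rho> * (L / L ^ CARD('n))))"
proof (rule dyadic_singularity[where G = "\<lambda>_. indicator {z. wedge p z = 0}"])
  fix n :: nat
  show "(\<integral>\<^sup>+z. indicator {z. wedge p z = 0} z * indicator {z. norm z \<le> \<rho> / 2 ^ n} z \<partial>nu L)
    \<le> ennreal (3 * \<rho> * (L / L ^ CARD('n)) / 2 ^ n)"
  proof (cases "\<rho> / 2 ^ n < 1 / L")
    case True
    show ?thesis by (subst nn_integral_nu_indicator_small[OF L True]) simp
  next
    case False
    then show ?thesis using nn_integral_nu_collinear_box[OF L _ p, of "\<rho> / 2 ^ n" 0] by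
      (simp add: mult_ac)
  qed
qed (use \<rho> L in \<open>auto simp: lattice_def\<close>)

text \<open>For small k in a column the profile has scale |z| instead of a fixed one. It increases
  with its scale, so on each ball the scale may be replaced by the radius. The decay required by
  \<open>dyadic_singularity\<close> then comes from rescaling, not from the volume, which gives
  nothing when d = 2.\<close>

lemma nn_integral_nu_wedge_singular:
  fixes p :: "real^'n"
  assumes d: "CARD('n) \<ge> 2" and L: "L > 0" and \<rho>: "\<rho> > 0"
    and p: "p \<in> lattice L" and pi: "p $ i \<noteq> 0" and \<tau>: "\<tau> \<ge> 0"
  shows "(\<integral>\<^sup>+z. ennreal (sqrt (\<rho> / norm z)) *
      (ennreal (\<tau> / (1 + (\<tau> * minor p z i j / norm z)\<^sup>2))
        * indicator {z. minor p z i j \<noteq> 0} z) * indicator {z. norm z \<le> \<rho>} z \<partial>nu L)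
    \<le> ennreal (8 * (\<rho> * (pi * (1 + 2 * \<rho> / \<bar>p $ i\<bar>) * (3 * \<rho>) ^ (CARD('n) - 2))))"
proof (rule dyadic_singularity[where G = "\<lambda>r z. ennreal (\<tau> / (1 + (\<tau> * minor p z i j / r)\<^sup>2))
        * indicator {z. minor p z i j \<noteq> 0} z"])
  fix z :: "real^'n" and r assume z: "z \<in> space (nu L)" and r: "norm z \<le> r"
  have n: "norm z > 0" using z by (simp add: lattice_def)
  let ?x = "\<tau> * minor p z i j"
  have "(?x / r)\<^sup>2 \<le> (?x / norm z)\<^sup>2"
    unfolding power_divide using n r by (intro divide_left_mono power_mono mult_pos_pos) auto
  then have "\<tau> / (1 + (?x / norm z)\<^sup>2) \<le> \<tau> / (1 + (?x / r)\<^sup>2)"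
    using \<tau> by (intro divide_left_mono mult_pos_pos) (auto intro: add_pos_nonneg)
  then show "ennreal (\<tau> / (1 + (?x / norm z)\<^sup>2)) * indicator {z. minor p z i j \<noteq> 0} z
    \<le> ennreal (\<tau> / (1 + (?x / r)\<^sup>2)) * indicator {z. minor p z i j \<noteq> 0} z"
    by (intro mult_right_mono ennreal_leI) auto
next
  fix n :: nat
  let ?r = "\<rho> / 2 ^ n"
  let ?w = "\<lambda>z. minor p z i j"
  show "(\<integral>\<^sup>+z. ennreal (\<tau> / (1 + (\<tau> * ?w z / ?r)\<^sup>2)) * indicator {z. ?w z \<noteq> 0} z
    * indicator {z. norm z \<le> ?r} z \<partial>nu L)
     \<le> ennreal (\<rho> * (pi * (1 + 2 * \<rho> / \<bar>p $ i\<bar>) * (3 * \<rho>) ^ (CARD('n) - 2)) / 2 ^ n)"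
  proof (cases "?r < 1 / L")
    case True
    show ?thesis by (subst nn_integral_nu_indicator_small[OF L True]) simp
  next
    case False
    have r: "?r > 0" using \<rho> by simp
    \<comment> \<open>Rescaling to the profile with A = \<tau> / \<open>?r\<close> releases a factor
      \<open>?r\<close>, and this factor alone supplies the 2^(-n); the other radii are later
      bounded by \<rho>.\<close>
    have eq: "ennreal (\<tau> / (1 + (\<tau> * ?w z / ?r)\<^sup>2)) = ennreal ?r
      * ennreal (\<tau> / ?r / (1 + (\<tau> / ?r * ?w z)\<^sup>2))" for z :: "real^'n"
    proof -
      have *: "\<tau> / (1 + (\<tau> * w / r)\<^sup>2) = r * (\<tau> / r / (1 + (\<tau> / r * w)\<^sup>2))" if "r > 0"
        for r w :: real
        using that by simp
      have "ennreal (\<tau> / (1 + (\<tau> * ?w z / ?r)\<^sup>2))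
        = ennreal (?r * (\<tau> / ?r / (1 + (\<tau> / ?r * ?w z)\<^sup>2)))"
        by (rule arg_cong[OF *[OF r]])
      also have "\<dots> = ennreal ?r * ennreal (\<tau> / ?r / (1 + (\<tau> / ?r * ?w z)\<^sup>2))"
        by (rule ennreal_mult[OF less_imp_le[OF r]], intro divide_nonneg_nonneg add_nonneg_nonneg)
          (use r \<tau> \<rho> in auto)
      finally show ?thesis .
    qed
    have "(\<integral>\<^sup>+z. ennreal (\<tau> / (1 + (\<tau> * ?w z / ?r)\<^sup>2)) * indicator {z. ?w z \<noteq> 0} z
      * indicator {z. norm z \<le> ?r} z \<partial>nu L)
      = ennreal ?r * (\<integral>\<^sup>+z. ennreal (\<tau> / ?r / (1 + (\<tau> / ?r * ?w z)\<^sup>2)) * indicator {z. ?w z \<noteq> 0} z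
        * indicator {z. norm (z - 0) \<le> ?r} z \<partial>nu L)"
      unfolding eq by (subst nn_integral_cmult[symmetric]) (auto simp: mult.assoc)
    also have "\<dots> \<le> ennreal ?r * ennreal (pi * (1 + 2 * ?r / \<bar>p $ i\<bar>) * (3 * ?r) ^ (CARD('n) - 2))"
      using False \<rho> by (intro mult_left_mono nn_integral_nu_wedge_ball d L p pi divide_nonneg_nonneg
        \<tau>) auto
    also have "\<dots> = ennreal (?r * (pi * (1 + 2 * ?r / \<bar>p $ i\<bar>) * (3 * ?r) ^ (CARD('n) - 2)))"
      by (rule ennreal_mult[symmetric]) (use \<rho> in auto)
    also have "\<dots> \<le> ennreal (?r * (pi * (1 + 2 * \<rho> / \<bar>p $ i\<bar>) * (3 * \<rho>) ^ (CARD('n) - 2)))"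
    proof (rule ennreal_leI, rule mult_left_mono)
      have "?r \<le> \<rho>" using \<rho> by (simp add: divide_le_eq)
      then have 1: "1 + 2 * ?r / \<bar>p $ i\<bar> \<le> 1 + 2 * \<rho> / \<bar>p $ i\<bar>"
        by (intro add_left_mono divide_right_mono) auto
      have 2: "(3 * ?r) ^ (CARD('n) - 2) \<le> (3 * \<rho>) ^ (CARD('n) - 2)"
        using \<open>?r \<le> \<rho>\<close> \<rho> by (intro power_mono) auto
      show "pi * (1 + 2 * ?r / \<bar>p $ i\<bar>) * (3 * ?r) ^ (CARD('n) - 2) \<le> pi * (1 + 2 * \<rho> / \<bar>p $ i\<bar>)
        * (3 * \<rho>) ^ (CARD('n) - 2)"
        by (rule mult_mono[OF mult_left_mono[OF 1] 2]) (use \<rho> in auto)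
    qed (use \<rho> in auto)
    finally show ?thesis by simp
  qed
qed (use \<rho> \<tau> in \<open>auto simp: lattice_def\<close>)

section \<open>Time integrals of the echo kernel\<close>

lemma nn_integral_Lorentz:
  fixes a s0 b c :: real
  assumes a: "a > 0"
  shows "(\<integral>\<^sup>+s. ennreal (1 / (1 + (a * (s - s0))\<^sup>2)) * indicator {b..c} s \<partial>lborel)
    \<le> ennreal (pi / a)"
proof (cases "b \<le> c")
  case True
  let ?F = "\<lambda>s. arctan (a * (s - s0)) / a"
  have "(\<integral>\<^sup>+s. ennreal (1 / (1 + (a * (s - s0))\<^sup>2)) * indicator {b..c} s \<partial>lborel)
    = ennreal (?F c - ?F b)"
  proof (rule nn_integral_FTC_Icc)
    fix x
    show "(?F has_real_derivative 1 / (1 + (a * (x - s0))\<^sup>2)) (at x)"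
      using a by (auto intro!: derivative_eq_intros simp: divide_simps add_nonneg_eq_0_iff)
  qed (use True in \<open>auto intro!: divide_nonneg_nonneg\<close>)
  also have "\<dots> \<le> ennreal (pi / a)"
  proof (rule ennreal_leI)
    have "?F c - ?F b = (arctan (a * (c - s0)) - arctan (a * (b - s0))) / a" by
      (simp add: diff_divide_distrib)
    also have "\<dots> \<le> pi / a"
      using arctan_ubound[of "a * (c - s0)"] arctan_lbound[of "a * (b - s0)"] a
        by (intro divide_right_mono) auto
    finally show "?F c - ?F b \<le> pi / a" .
  qed
  finally show ?thesis .
next
  case False
  then show ?thesis by simp
qed

text \<open>Lagrange's identity in the plane of the coordinates i and j.\<close>

lemma minor_power2_le:
  fixes x y :: "real^'n"
  shows "(minor x y i j)\<^sup>2 \<le> (norm x)\<^sup>2 * (norm y)\<^sup>2"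
proof (cases "i = j")
  case False
  have *: "(z $ i)\<^sup>2 + (z $ j)\<^sup>2 \<le> (norm z)\<^sup>2" for z :: "real^'n"
  proof -
    have "(z $ i)\<^sup>2 + (z $ j)\<^sup>2 = (\<Sum>m\<in>{i, j}. (z $ m)\<^sup>2)" using False by simp
    also have "\<dots> \<le> (\<Sum>m\<in>UNIV. (z $ m)\<^sup>2)" by (rule sum_mono2) auto
    also have "\<dots> = (norm z)\<^sup>2"
      by (subst power2_norm_eq_inner) (simp add: inner_vec_def power2_eq_square)
    finally show ?thesis .
  qed
  have "(minor x y i j)\<^sup>2 + (x $ i * y $ i + x $ j * y $ j)\<^sup>2
     = ((x $ i)\<^sup>2 + (x $ j)\<^sup>2) * ((y $ i)\<^sup>2 + (y $ j)\<^sup>2)"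
    by (simp add: power2_eq_square algebra_simps)
  then have "(minor x y i j)\<^sup>2 \<le> ((x $ i)\<^sup>2 + (x $ j)\<^sup>2) * ((y $ i)\<^sup>2 + (y $ j)\<^sup>2)"
    using zero_le_power2[of "x $ i * y $ i + x $ j * y $ j"] by linarith
  also have "\<dots> \<le> (norm x)\<^sup>2 * (norm y)\<^sup>2" by (intro mult_mono *) auto
  finally show ?thesis .
qed simp

text \<open>With \<open>v = s x - u y\<close>: the first bound comes from \<open>v \<and> y = s (x \<and> y)\<close>, the second from
  projecting \<open>v\<close> to \<open>y\<close>.\<close>

lemma jap_phase_ge:
  fixes x y :: "real^'n"
  assumes y: "y \<noteq> 0"
  shows "1 + (s * minor x y i j / norm y)\<^sup>2 \<le> (jap (s *\<^sub>R x - u *\<^sub>R y))\<^sup>2"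
    and "1 + (norm y * (u - s * (x \<bullet> y) / (norm y)\<^sup>2))\<^sup>2 \<le> (jap (s *\<^sub>R x - u *\<^sub>R y))\<^sup>2"
proof -
  let ?v = "s *\<^sub>R x - u *\<^sub>R y"
  have n: "norm y > 0" using y by simp
  have "(s * minor x y i j)\<^sup>2 = (?v $ i * y $ j - ?v $ j * y $ i)\<^sup>2"
    by (simp add: algebra_simps)
  also have "\<dots> \<le> (norm ?v)\<^sup>2 * (norm y)\<^sup>2" by (rule minor_power2_le)
  finally show "1 + (s * minor x y i j / norm y)\<^sup>2 \<le> (jap ?v)\<^sup>2"
    using n by (simp add: jap_power2 power_divide divide_le_eq)
  have "\<bar>?v \<bullet> y\<bar> \<le> norm ?v * norm y" by (rule Cauchy_Schwarz_ineq2)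
  moreover have "?v \<bullet> y = - ((norm y)\<^sup>2 * (u - s * (x \<bullet> y) / (norm y)\<^sup>2))"
    using y by (simp add: inner_diff_left power2_norm_eq_inner algebra_simps)
  ultimately have "(norm y)\<^sup>2 * \<bar>u - s * (x \<bullet> y) / (norm y)\<^sup>2\<bar> \<le> norm ?v * norm y" by
    (simp add: abs_mult)
  then have "norm y * (norm y * \<bar>u - s * (x \<bullet> y) / (norm y)\<^sup>2\<bar>) \<le> norm y * norm ?v"
    by (simp only: power2_eq_square mult.assoc mult.commute)
  then have "norm y * \<bar>u - s * (x \<bullet> y) / (norm y)\<^sup>2\<bar> \<le> norm ?v" using n
    by (rule mult_left_le_imp_le)
  then have "(norm y * \<bar>u - s * (x \<bullet> y) / (norm y)\<^sup>2\<bar>)\<^sup>2 \<le> (norm ?v)\<^sup>2"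
    by (intro power_mono) auto
  then show "1 + (norm y * (u - s * (x \<bullet> y) / (norm y)\<^sup>2))\<^sup>2 \<le> (jap ?v)\<^sup>2"
    by (simp add: jap_power2 power_mult_distrib)
qed

text \<open>The product form separates the variables: the first factor depends on the minor only and
  is summed over the lattice, the second depends on the time \<open>u\<close> and is integrated. The
  price is four powers of the weight instead of two.\<close>

lemma jap_phase_ge_prod:
  fixes x y :: "real^'n"
  assumes y: "y \<noteq> 0"
  shows "(1 + (s * minor x y i j / norm y)\<^sup>2) * (1 + (norm y * (u - s * (x \<bullet> y) / (norm y)\<^sup>2))\<^sup>2)
    \<le> jap (s *\<^sub>R x - u *\<^sub>R y) ^ 4"
proof -
  have eq: "jap (s *\<^sub>R x - u *\<^sub>R y) ^ 4 = (jap (s *\<^sub>R x - u *\<^sub>R y))\<^sup>2 * (jap (s *\<^sub>R x - u *\<^sub>R y))\<^sup>2"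
    by (simp flip: power_add)
  show ?thesis unfolding eq by (intro mult_mono jap_phase_ge y) auto
qed

lemma jap_powr_le:
  assumes "real m \<le> \<sigma>"
  shows "jap x powr (- \<sigma>) \<le> 1 / jap x ^ m"
proof -
  have "jap x powr (- \<sigma>) \<le> jap x powr (- real m)"
    using assms jap_ge_1 by (intro powr_mono) auto
  also have "\<dots> = 1 / jap x ^ m" using jap_pos by
    (simp add: powr_minus_divide powr_realpow[OF jap_pos])
  finally show ?thesis .
qed

lemma echo_kernel_nonneg: "0 \<le> echo_kernel \<sigma> t \<tau> k l"
  by (simp add: echo_kernel_def)

text \<open>Real powers become integer powers, as many as are spent later. The phase keeps 5 of
  them, available because d + 3 is at least 5: four for \<open>jap_phase_ge_prod\<close> and one
  against the growing factor.\<close>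

lemma echo_kernel_le:
  fixes k l :: "real^'n"
  assumes d: "CARD('n) \<ge> 2" and \<sigma>: "\<sigma> \<ge> real CARD('n) + 3" and t: "\<tau> \<le> t"
  shows "echo_kernel \<sigma> t \<tau> k l \<le> sqrt (norm k) * sqrt (norm l) / (jap l)\<^sup>2
    * (1 / jap (k - l) ^ (CARD('n) + 3))
      * ((t - \<tau>) * norm k / jap (t *\<^sub>R k - \<tau> *\<^sub>R l) ^ 5)"
proof -
  have "echo_kernel \<sigma> t \<tau> k l \<le> sqrt (norm k) * sqrt (norm l) / (jap l)\<^sup>2 * ((t - \<tau>) * norm k)
     * (1 / jap (k - l) ^ (CARD('n) + 3)) * (1 / jap (t *\<^sub>R k - \<tau> *\<^sub>R l) ^ 5)"
    unfolding echo_kernel_def using \<sigma> d t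
    by (intro mult_mono mult_left_mono jap_powr_le)
      (auto simp: jap_pos less_imp_le intro!: mult_nonneg_nonneg divide_nonneg_nonneg)
  then show ?thesis by (simp add: mult_ac)
qed

section \<open>Integration in \<tau>, for the rows\<close>

lemma echo_prefactor_le:
  fixes k l :: "real^'n"
  assumes lk: "2 * norm l < norm k"
  shows "sqrt (norm k) * sqrt (norm l) / (jap l)\<^sup>2 \<le> norm k"
proof -
  have "norm l \<le> norm k" using lk norm_ge_zero[of l] by linarith
  then have "sqrt (norm k) * sqrt (norm l) \<le> sqrt (norm k) * sqrt (norm k)"
    by (intro mult_left_mono real_sqrt_le_mono) auto
  moreover have "(jap l)\<^sup>2 \<ge> 1" by (simp add: jap_power2)
  ultimately show ?thesis using frac_le[of "norm k" "sqrt (norm k) * sqrt (norm l)" 1 "(jap l)\<^sup>2"]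
    by simp
qed

text \<open>Without resonance: as |l| < |k|/2 and \<tau> is at most t, the phase is at least y/2
  with y = t |k|. The supremum times the length t of the interval is then enough, because y^2 / (1 +
  (y/2)^2) is at most 4.\<close>

lemma row_time_integral_far:
  fixes k l :: "real^'n"
  assumes d: "CARD('n) \<ge> 2" and \<sigma>: "\<sigma> \<ge> real CARD('n) + 3" and t: "0 < t"
    and lk: "2 * norm l < norm k"
  shows "(\<integral>\<^sup>+\<tau>\<in>{0..t}. ennreal (echo_kernel \<sigma> t \<tau> k l) \<partial>lborel)
    \<le> ennreal (4 / jap (k - l) ^ (CARD('n) + 1))"
  (is "?I \<le> _")
proof -
  let ?d = "CARD('n)"
  define c where "c = (norm k * (norm k * t / (1 + (norm k * t / 2)\<^sup>2))) / jap (k - l) ^ (?d + 1)"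
  have pos: "1 + (norm k * t / 2)\<^sup>2 > 0" by (simp add: add_pos_nonneg)
  have c0: "c \<ge> 0" using t pos unfolding c_def by (intro divide_nonneg_nonneg mult_nonneg_nonneg)
    (auto simp: jap_pos less_imp_le)
  have "echo_kernel \<sigma> t \<tau> k l \<le> c" if \<tau>: "0 \<le> \<tau>" "\<tau> \<le> t" for \<tau>
  proof -
    let ?v = "t *\<^sub>R k - \<tau> *\<^sub>R l"
    have "norm (t *\<^sub>R k) - norm (\<tau> *\<^sub>R l) \<le> norm ?v" by (rule norm_triangle_ineq2)
    moreover have "\<tau> * norm l \<le> t * (norm k / 2)" using \<tau> t lk by (intro mult_mono) auto
    ultimately have v: "norm k * t / 2 \<le> norm ?v" using \<tau> t by (simp add: mult.commute)
    then have "1 + (norm k * t / 2)\<^sup>2 \<le> (jap ?v)\<^sup>2"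
      unfolding jap_power2 using t by (intro add_left_mono power_mono) auto
    also have "\<dots> \<le> jap ?v ^ 5" by (intro power_increasing) (auto simp: jap_ge_1)
    finally have 1: "1 + (norm k * t / 2)\<^sup>2 \<le> jap ?v ^ 5" .
    have "(t - \<tau>) * norm k / jap ?v ^ 5 \<le> norm k * t / (1 + (norm k * t / 2)\<^sup>2)"
      using \<tau> t pos by (intro frac_le 1)
        (auto simp: mult.commute[of "norm k"] intro!: mult_right_mono)
    moreover have "sqrt (norm k) * sqrt (norm l) / (jap l)\<^sup>2 \<le> norm k"
      by (rule echo_prefactor_le[OF lk])
    moreover have "1 / jap (k - l) ^ (?d + 3) \<le> 1 / jap (k - l) ^ (?d + 1)"
      by (intro divide_left_mono power_increasing) (auto simp: jap_ge_1 jap_pos)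
    ultimately have "sqrt (norm k) * sqrt (norm l) / (jap l)\<^sup>2 * (1 / jap (k - l) ^ (?d + 3))
      * ((t - \<tau>) * norm k / jap ?v ^ 5)
      \<le> norm k * (1 / jap (k - l) ^ (?d + 1)) * (norm k * t / (1 + (norm k * t / 2)\<^sup>2))"
      using \<tau> by (intro mult_mono) (auto simp: jap_pos less_imp_le)
    then show ?thesis using echo_kernel_le[OF d \<sigma> \<tau>(2), of k l] by (simp add: c_def mult_ac)
  qed
  then have "?I \<le> (\<integral>\<^sup>+\<tau>. ennreal c * indicator {0..t} \<tau> \<partial>lborel)"
    by (intro nn_integral_mono) (auto simp: indicator_def intro!: ennreal_leI)
  also have "\<dots> = ennreal (c * t)"
    using t c0 by (subst nn_integral_cmult) (auto simp: ennreal_mult)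
  also have "\<dots> \<le> ennreal (4 / jap (k - l) ^ (?d + 1))"
  proof (rule ennreal_leI)
    have *: "norm k * (norm k * t / (1 + (norm k * t / 2)\<^sup>2)) * t \<le> 4"
      using pos by (simp add: divide_le_eq power2_eq_square algebra_simps)
    have "c * t = norm k * (norm k * t / (1 + (norm k * t / 2)\<^sup>2)) * t / jap (k - l) ^ (?d + 1)"
      by (simp add: c_def)
    also have "\<dots> \<le> 4 / jap (k - l) ^ (?d + 1)"
      by (rule divide_right_mono[OF *]) (simp add: jap_pos less_imp_le)
    finally show "c * t \<le> 4 / jap (k - l) ^ (?d + 1)" .
  qed
  finally show ?thesis .
qed

lemma time_integral_Lorentz_bound:
  fixes f :: "real \<Rightarrow> real"
  assumes a: "a > 0" and c: "c \<ge> 0"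
    and f: "\<And>s. b1 \<le> s \<Longrightarrow> s \<le> b2 \<Longrightarrow> f s \<le> c * (1 / (1 + (a * (s - s0))\<^sup>2))"
  shows "(\<integral>\<^sup>+s\<in>{b1..b2}. ennreal (f s) \<partial>lborel) \<le> ennreal (c * (pi / a))"
proof -
  have "(\<integral>\<^sup>+s\<in>{b1..b2}. ennreal (f s) \<partial>lborel)
    \<le> (\<integral>\<^sup>+s. ennreal c * (ennreal (1 / (1 + (a * (s - s0))\<^sup>2)) * indicator {b1..b2} s) \<partial>lborel)"
    using f c by (intro nn_integral_mono)
      (auto simp: indicator_def ennreal_mult[symmetric] intro!: ennreal_leI)
  also have "\<dots> \<le> ennreal c * ennreal (pi / a)"
    by (subst nn_integral_cmult) (auto intro!: mult_left_mono nn_integral_Lorentz a)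
  finally show ?thesis using c a by (simp add: ennreal_mult[symmetric])
qed

text \<open>Used to change the scale of the profile: a factor m in the scale costs m^2.\<close>

lemma one_plus_power2_div_le:
  fixes x m :: real
  assumes m: "m \<ge> 1" and xy: "\<bar>y\<bar> \<le> m * \<bar>x\<bar>"
  shows "1 / (1 + x\<^sup>2) \<le> m\<^sup>2 * (1 / (1 + y\<^sup>2))"
proof -
  have "y\<^sup>2 \<le> (m * x)\<^sup>2" using xy m by (subst abs_le_square_iff[symmetric]) (simp add: abs_mult)
  moreover have "1 \<le> m\<^sup>2" using m by simp
  ultimately have "1 + y\<^sup>2 \<le> m\<^sup>2 * (1 + x\<^sup>2)" by (simp add: power_mult_distrib distrib_left)
  then show ?thesis by (simp add: field_simps add_pos_nonneg)
qed

text \<open>The phase is integrated around its point of closest approach t (k . l) / |l|^2, which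
  gains \<pi> / |l|; this cancels against sqrt|k| sqrt|l|. For the lattice sum over l the profile
  needs a scale independent of l: hence |l| is traded for <k>, at the expense of two powers of
  <k-l>.\<close>

lemma row_time_integral_near:
  fixes k l :: "real^'n"
  assumes d: "CARD('n) \<ge> 2" and \<sigma>: "\<sigma> \<ge> real CARD('n) + 3" and t: "0 < t"
    and l0: "l \<noteq> 0" and lk: "norm k \<le> 2 * norm l"
  shows "(\<integral>\<^sup>+\<tau>\<in>{0..t}. ennreal (echo_kernel \<sigma> t \<tau> k l) \<partial>lborel)
    \<le> ennreal (32 * pi * (norm k / jap k) * (t / jap k / (1 + (t / jap k * minor k l i j)\<^sup>2))
        * (1 / jap (k - l) ^ (CARD('n) + 1)))"
  (is "?I \<le> _")
proof -
  let ?d = "CARD('n)"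
  define w where "w = minor k l i j"
  define D where "D = jap (k - l)"
  define J where "J = jap k"
  have D: "D \<ge> 1" and J: "J \<ge> 1" by (simp_all add: D_def J_def jap_ge_1)
  have nl: "norm l > 0" using l0 by simp
  define q where "q = 1 / (1 + (t * w / norm l)\<^sup>2)"
  have q0: "q \<ge> 0" by (simp add: q_def)
  define c where "c = sqrt (norm k) * sqrt (norm l) / (jap l)\<^sup>2 * (1 / D ^ (?d + 3))
    * (t * norm k * q)"
  have c0: "c \<ge> 0" unfolding c_def using t D q0
    by (intro mult_nonneg_nonneg divide_nonneg_nonneg) auto
  have "?I \<le> ennreal (c * (pi / norm l))"
  proof (rule time_integral_Lorentz_bound[OF nl c0, where ?s0.0 = "t * (k \<bullet> l) / (norm l)\<^sup>2"])
    fix \<tau> assume \<tau>: "0 \<le> \<tau>" "\<tau> \<le> t"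
    let ?v = "t *\<^sub>R k - \<tau> *\<^sub>R l"
    let ?z = "1 / (1 + (norm l * (\<tau> - t * (k \<bullet> l) / (norm l)\<^sup>2))\<^sup>2)"
    have "(1 + (t * w / norm l)\<^sup>2) * (1 + (norm l * (\<tau> - t * (k \<bullet> l) / (norm l)\<^sup>2))\<^sup>2) \<le> jap ?v ^ 4"
      unfolding w_def by (rule jap_phase_ge_prod[OF l0])
    also have "\<dots> \<le> jap ?v ^ 5" by (intro power_increasing) (auto simp: jap_ge_1)
    finally have "1 / jap ?v ^ 5
      \<le> 1 / ((1 + (t * w / norm l)\<^sup>2) * (1 + (norm l * (\<tau> - t * (k \<bullet> l) / (norm l)\<^sup>2))\<^sup>2))"
      by (intro divide_left_mono) (auto simp: jap_pos intro!: mult_pos_pos add_pos_nonneg)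
    also have "\<dots> = q * ?z" by (simp add: q_def)
    finally have "1 / jap ?v ^ 5 \<le> q * ?z" .
    then have "((t - \<tau>) * norm k) * (1 / jap ?v ^ 5) \<le> (t * norm k) * (q * ?z)"
      using \<tau> by (intro mult_mono) (auto simp: jap_pos less_imp_le)
    then have "sqrt (norm k) * sqrt (norm l) / (jap l)\<^sup>2 * (1 / D ^ (?d + 3))
      * ((t - \<tau>) * norm k / jap ?v ^ 5)
       \<le> sqrt (norm k) * sqrt (norm l) / (jap l)\<^sup>2 * (1 / D ^ (?d + 3)) * ((t * norm k) * (q * ?z))"
      using D by (intro mult_left_mono) (auto intro!: mult_nonneg_nonneg divide_nonneg_nonneg)
    also have "\<dots> = c * ?z" by (simp add: c_def)
    finally show "echo_kernel \<sigma> t \<tau> k l \<le> c * ?z"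
      using echo_kernel_le[OF d \<sigma> \<tau>(2), of k l] unfolding D_def by linarith
  qed
  also have "c * (pi / norm l) \<le> 32 * pi * (norm k / J) * (t / J / (1 + (t / J * w)\<^sup>2))
    * (1 / D ^ (?d + 1))"
  proof -
    have s: "sqrt (norm k) * sqrt (norm l) \<le> 2 * norm l"
    proof -
      have "sqrt (norm k) * sqrt (norm l) \<le> sqrt (4 * norm l) * sqrt (norm l)"
        using lk norm_ge_zero[of l]
          by (intro mult_right_mono real_sqrt_le_mono real_sqrt_ge_zero) linarith+
      also have "\<dots> = 2 * norm l" by (simp add: real_sqrt_mult)
      finally show ?thesis .
    qed
    have jl: "1 / (jap l)\<^sup>2 \<le> 4 * (1 / J\<^sup>2)"
    proof -
      have "(norm k)\<^sup>2 \<le> (2 * norm l)\<^sup>2" using lk by (intro power_mono) auto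
      then have "J\<^sup>2 \<le> 4 * (jap l)\<^sup>2" by (simp add: J_def jap_power2 power_mult_distrib)
      then show ?thesis using J jap_pos[of l] by (simp add: field_simps)
    qed
    \<comment> \<open>For numbers at least 1 a sum is at most twice the product; this is what lets
      |l| be compared with <k> without assuming that k is close to l.\<close>
    have lJD: "norm l \<le> 2 * D * J"
    proof -
      have "norm l \<le> norm k + norm (k - l)" using norm_triangle_ineq4[of k "k - l"] by simp
      also have "\<dots> \<le> J + D" by (simp add: J_def D_def add_mono jap_ge_norm)
      also have "\<dots> \<le> 2 * D * J"
      proof -
        have "1 * J \<le> D * J" "D * 1 \<le> D * J" using D J
          by (intro mult_right_mono mult_left_mono; linarith)+
        then show ?thesis by linarith
      qed
      finally show ?thesis .
    qed
    have qq: "q \<le> (2 * D)\<^sup>2 * (1 / (1 + (t / J * w)\<^sup>2))"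
      unfolding q_def
    proof (rule one_plus_power2_div_le)
      have "t / J * \<bar>w\<bar> = t * \<bar>w\<bar> * (1 / J)" by simp
      also have "\<dots> \<le> t * \<bar>w\<bar> * (2 * D / norm l)"
        using lJD nl J t by (intro mult_left_mono) (auto simp: field_simps)
      finally show "\<bar>t / J * w\<bar> \<le> 2 * D * \<bar>t * w / norm l\<bar>"
        using t J nl by (simp add: abs_mult mult_ac)
    qed (use D in simp)
    have "c * (pi / norm l) = (sqrt (norm k) * sqrt (norm l)) * (1 / (jap l)\<^sup>2) * q
      * (t * norm k * (1 / D ^ (?d + 3)) * (pi / norm l))"
      by (simp add: c_def mult_ac)
    also have "\<dots> \<le> (2 * norm l) * (4 * (1 / J\<^sup>2)) * ((2 * D)\<^sup>2 * (1 / (1 + (t / J * w)\<^sup>2)))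
       * (t * norm k * (1 / D ^ (?d + 3)) * (pi / norm l))"
    proof (rule mult_right_mono[OF mult_mono[OF mult_mono[OF s jl] qq]])
      show "0 \<le> t * norm k * (1 / D ^ (?d + 3)) * (pi / norm l)" using t D by simp
    qed (use q0 in auto)
    \<comment> \<open>The constant is 2 from \<open>s\<close>, 4 from \<open>jl\<close> and 4 from
      \<open>qq\<close>. The two powers of <k> gained in \<open>jl\<close> are shared between |k|
      and t.\<close>
    also have "\<dots> = 32 * pi * (norm k / J) * (t / J / (1 + (t / J * w)\<^sup>2)) * (D\<^sup>2 / D ^ (?d + 3))"
    proof -
      have "(2 * a) * (4 * (1 / J\<^sup>2)) * ((2 * D)\<^sup>2 * Q) * (t * b * (1 / E) * (pi / a)) = 32 * pi
        * (b / J) * (t / J * Q) * (D\<^sup>2 / E)"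
        if "a \<noteq> 0" for a b Q E :: real
        using that by (simp add: power2_eq_square mult_ac)
      from this[of "norm l" "1 / (1 + (t / J * w)\<^sup>2)" "norm k" "D ^ (?d + 3)"] nl
      show ?thesis by simp
    qed
    also have "D\<^sup>2 / D ^ (?d + 3) = 1 / D ^ (?d + 1)"
      using D by (simp add: power_add power2_eq_square eval_nat_numeral)
    finally show ?thesis .
  qed
  finally show ?thesis by (simp add: w_def D_def J_def ennreal_leI)
qed

section \<open>Integration in t, for the columns\<close>

lemma norm_k_le_2_norm_phase:
  fixes k l :: "real^'n"
  assumes "0 \<le> \<tau>" "\<tau> \<le> t" "2 * norm l < norm k"
  shows "(t - \<tau>) * norm k \<le> 2 * norm (t *\<^sub>R k - \<tau> *\<^sub>R l)"
proof -
  have "t * norm k - \<tau> * norm l \<le> norm (t *\<^sub>R k - \<tau> *\<^sub>R l)"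
    using norm_triangle_ineq2[of "t *\<^sub>R k" "\<tau> *\<^sub>R l"] assms by simp
  moreover have "2 * (\<tau> * norm l) \<le> t * norm k"
    using assms mult_mono[of \<tau> t "2 * norm l" "norm k"] by simp
  moreover have "0 \<le> \<tau> * norm k" using assms by simp
  ultimately show ?thesis unfolding left_diff_distrib by linarith
qed

text \<open>The range of t is not bounded by the data of the column, so a supremum times a length
  would bring in T. Instead the phase absorbs the growing factor at the cost of one power, and the
  rest is integrated as a Lorentz profile. The |k| from the prefactor cancels the gain
  1/|k|.\<close>

lemma column_time_integral_far:
  fixes k l :: "real^'n"
  assumes d: "CARD('n) \<ge> 2" and \<sigma>: "\<sigma> \<ge> real CARD('n) + 3" and \<tau>: "0 \<le> \<tau>"
    and lk: "2 * norm l < norm k"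
  shows "(\<integral>\<^sup>+t\<in>{\<tau>..T}. ennreal (echo_kernel \<sigma> t \<tau> k l) \<partial>lborel)
    \<le> ennreal (2 * pi * (1 / jap (k - l) ^ (CARD('n) + 1)))"
  (is "?I \<le> _")
proof -
  let ?d = "CARD('n)"
  have nk: "norm k > 0" using lk norm_ge_zero[of l] by linarith
  then have k0: "k \<noteq> 0" by auto
  define D where "D = jap (k - l)"
  have D: "D \<ge> 1" by (simp add: D_def jap_ge_1)
  define c where "c = norm k * (1 / D ^ (?d + 1)) * 2"
  have c0: "c \<ge> 0" using D by (simp add: c_def)
  have "?I \<le> ennreal (c * (pi / norm k))"
  proof (rule time_integral_Lorentz_bound[OF nk c0, where ?s0.0 = "\<tau> * (l \<bullet> k) / (norm k)\<^sup>2"])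
    fix t assume t: "\<tau> \<le> t" "t \<le> T"
    let ?v = "t *\<^sub>R k - \<tau> *\<^sub>R l"
    let ?z = "1 / (1 + (norm k * (t - \<tau> * (l \<bullet> k) / (norm k)\<^sup>2))\<^sup>2)"
    have jv: "jap ?v = jap (\<tau> *\<^sub>R l - t *\<^sub>R k)" by (simp add: jap_def norm_minus_commute)
    have "1 + (norm k * (t - \<tau> * (l \<bullet> k) / (norm k)\<^sup>2))\<^sup>2 \<le> (jap ?v)\<^sup>2"
      unfolding jv by (rule jap_phase_ge(2)[OF k0])
    also have "\<dots> \<le> jap ?v ^ 4" by (intro power_increasing) (auto simp: jap_ge_1)
    finally have z: "1 / jap ?v ^ 4 \<le> ?z"
      by (intro divide_left_mono mult_pos_pos zero_less_power jap_pos add_pos_nonneg) auto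
    have "(t - \<tau>) * norm k / jap ?v ^ 5 \<le> 2 * jap ?v / jap ?v ^ 5"
      using norm_k_le_2_norm_phase[OF \<tau> t(1) lk] jap_ge_norm[of ?v] jap_pos[of ?v]
      by (intro divide_right_mono) auto
    also have "\<dots> = 2 * (1 / jap ?v ^ 4)" using jap_pos[of ?v] by (simp add: eval_nat_numeral)
    also have "\<dots> \<le> 2 * ?z" using z by simp
    finally have 1: "(t - \<tau>) * norm k / jap ?v ^ 5 \<le> 2 * ?z" .
    have 2: "sqrt (norm k) * sqrt (norm l) / (jap l)\<^sup>2 \<le> norm k"
      by (rule echo_prefactor_le[OF lk])
    have 3: "1 / D ^ (?d + 3) \<le> 1 / D ^ (?d + 1)"
      using D by (intro divide_left_mono power_increasing) auto
    have "sqrt (norm k) * sqrt (norm l) / (jap l)\<^sup>2 * (1 / D ^ (?d + 3))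
      * ((t - \<tau>) * norm k / jap ?v ^ 5)
       \<le> norm k * (1 / D ^ (?d + 1)) * (2 * ?z)"
      using 1 2 3 D t jap_pos[of ?v] by (intro mult_mono) auto
    also have "\<dots> = c * ?z" by (simp add: c_def)
    finally show "echo_kernel \<sigma> t \<tau> k l \<le> c * ?z"
      using echo_kernel_le[OF d \<sigma> t(1), of k l] unfolding D_def by linarith
  qed
  also have "c * (pi / norm k) = 2 * pi * (1 / D ^ (?d + 1))" using nk by (simp add: c_def)
  finally show ?thesis by (simp add: D_def)
qed

text \<open>The growing factor is split as \<open>(t - \<tau>) k = v - \<tau> (k - l)\<close> with \<open>v = t k - \<tau> l\<close>.\<close>

lemma column_time_integral:
  fixes k l :: "real^'n"
  assumes d: "CARD('n) \<ge> 2" and \<sigma>: "\<sigma> \<ge> real CARD('n) + 3" and \<tau>: "0 \<le> \<tau>"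
    and k0: "k \<noteq> 0"
  shows "(\<integral>\<^sup>+t\<in>{\<tau>..T}. ennreal (echo_kernel \<sigma> t \<tau> k l) \<partial>lborel)
   \<le> ennreal (pi * sqrt (norm l / norm k) / (jap l)\<^sup>2 * (1 / jap (k - l) ^ (CARD('n) + 3))
      * (1 + \<tau> * jap (k - l) / (1 + (\<tau> * minor l k i j / norm k)\<^sup>2)))"
  (is "?I \<le> _")
proof -
  let ?d = "CARD('n)"
  define w where "w = minor l k i j"
  have nk: "norm k > 0" using k0 by auto
  define D where "D = jap (k - l)"
  have D: "D \<ge> 1" by (simp add: D_def jap_ge_1)
  define q where "q = 1 / (1 + (\<tau> * w / norm k)\<^sup>2)"
  have q0: "q \<ge> 0" by (simp add: q_def)
  define c where "c = sqrt (norm k) * sqrt (norm l) / (jap l)\<^sup>2 * (1 / D ^ (?d + 3))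
    * (1 + \<tau> * D * q)"
  have c0: "c \<ge> 0" unfolding c_def using \<tau> D q0
    by (intro mult_nonneg_nonneg divide_nonneg_nonneg add_nonneg_nonneg) auto
  have "?I \<le> ennreal (c * (pi / norm k))"
  proof (rule time_integral_Lorentz_bound[OF nk c0, where ?s0.0 = "\<tau> * (l \<bullet> k) / (norm k)\<^sup>2"])
    fix t assume t: "\<tau> \<le> t" "t \<le> T"
    let ?v = "t *\<^sub>R k - \<tau> *\<^sub>R l"
    let ?z = "1 / (1 + (norm k * (t - \<tau> * (l \<bullet> k) / (norm k)\<^sup>2))\<^sup>2)"
    have jv: "jap ?v = jap (\<tau> *\<^sub>R l - t *\<^sub>R k)" by (simp add: jap_def norm_minus_commute)
    have "1 + (norm k * (t - \<tau> * (l \<bullet> k) / (norm k)\<^sup>2))\<^sup>2 \<le> (jap ?v)\<^sup>2"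
      unfolding jv by (rule jap_phase_ge(2)[OF k0])
    also have "\<dots> \<le> jap ?v ^ 4" by (intro power_increasing) (auto simp: jap_ge_1)
    finally have z: "1 / jap ?v ^ 4 \<le> ?z"
      by (intro divide_left_mono mult_pos_pos zero_less_power jap_pos add_pos_nonneg) auto
    have "(1 + (\<tau> * w / norm k)\<^sup>2) * (1 + (norm k * (t - \<tau> * (l \<bullet> k) / (norm k)\<^sup>2))\<^sup>2) \<le> jap ?v ^ 4"
      unfolding w_def jv by (rule jap_phase_ge_prod[OF k0])
    also have "\<dots> \<le> jap ?v ^ 5" by (intro power_increasing) (auto simp: jap_ge_1)
    finally have "1 / jap ?v ^ 5
      \<le> 1 / ((1 + (\<tau> * w / norm k)\<^sup>2) * (1 + (norm k * (t - \<tau> * (l \<bullet> k) / (norm k)\<^sup>2))\<^sup>2))"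
      by (intro divide_left_mono) (auto simp: jap_pos intro!: mult_pos_pos add_pos_nonneg)
    also have "\<dots> = q * ?z" by (simp add: q_def)
    finally have qz: "1 / jap ?v ^ 5 \<le> q * ?z" .
    have "?v = (t - \<tau>) *\<^sub>R k + \<tau> *\<^sub>R (k - l)" by (simp add: algebra_simps)
    then have "norm ((t - \<tau>) *\<^sub>R k) \<le> norm ?v + norm (\<tau> *\<^sub>R (k - l))"
      by (metis add_diff_cancel_right' norm_triangle_ineq4)
    also have "\<dots> \<le> jap ?v + \<tau> * D"
      using \<tau> jap_ge_norm by (intro add_mono) (auto simp: D_def intro!: mult_left_mono)
    finally have "(t - \<tau>) * norm k \<le> jap ?v + \<tau> * D" using t by simp
    then have "(t - \<tau>) * norm k / jap ?v ^ 5 \<le> (jap ?v + \<tau> * D) / jap ?v ^ 5"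
      using jap_pos[of ?v] by (intro divide_right_mono) auto
    also have "\<dots> = 1 / jap ?v ^ 4 + \<tau> * D * (1 / jap ?v ^ 5)"
      using jap_pos[of ?v] by (simp add: add_divide_distrib eval_nat_numeral)
    also have "\<dots> \<le> ?z + \<tau> * D * (q * ?z)"
      using z qz \<tau> D by (intro add_mono mult_left_mono) auto
    also have "\<dots> = (1 + \<tau> * D * q) * ?z" by (simp add: add_divide_distrib)
    finally have "(t - \<tau>) * norm k / jap ?v ^ 5 \<le> (1 + \<tau> * D * q) * ?z" .
    then have "sqrt (norm k) * sqrt (norm l) / (jap l)\<^sup>2 * (1 / D ^ (?d + 3))
      * ((t - \<tau>) * norm k / jap ?v ^ 5)
       \<le> sqrt (norm k) * sqrt (norm l) / (jap l)\<^sup>2 * (1 / D ^ (?d + 3)) * ((1 + \<tau> * D * q) * ?z)"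
      using D by (intro mult_left_mono) auto
    also have "\<dots> = c * ?z" by (simp add: c_def)
    finally show "echo_kernel \<sigma> t \<tau> k l \<le> c * ?z"
      using echo_kernel_le[OF d \<sigma> t(1), of k l] unfolding D_def by linarith
  qed
  also have "c * (pi / norm k) = pi * (sqrt (norm k) * sqrt (norm l) / norm k) / (jap l)\<^sup>2
    * (1 / D ^ (?d + 3)) * (1 + \<tau> * D * q)"
    by (simp add: c_def mult_ac)
  \<comment> \<open>The origin of the weight singular at k = 0: the gain 1/|k| is stronger than the
    square root in the kernel.\<close>
  also have "sqrt (norm k) * sqrt (norm l) / norm k = sqrt (norm l / norm k)"
  proof -
    have "sqrt (norm k) * sqrt (norm l) * sqrt (norm k) = sqrt (norm l) * norm k"
      by (simp add: mult.commute mult.left_commute)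
    then show ?thesis using nk by (simp add: real_sqrt_divide frac_eq_eq)
  qed
  finally show ?thesis by (simp add: D_def w_def q_def)
qed

text \<open>With |k| and |l| comparable the weight sqrt(|l|/|k|) is at most 2, and the scale |k| of
  the profile may be replaced by |l|, which is fixed in the column, at the expense of a factor
  4.\<close>

lemma column_time_integral_comparable:
  fixes k l :: "real^'n"
  assumes d: "CARD('n) \<ge> 2" and \<sigma>: "\<sigma> \<ge> real CARD('n) + 3" and \<tau>: "0 \<le> \<tau>"
    and l0: "l \<noteq> 0" and kl: "norm l \<le> 2 * norm k" "norm k \<le> 2 * norm l"
  shows "(\<integral>\<^sup>+t\<in>{\<tau>..T}. ennreal (echo_kernel \<sigma> t \<tau> k l) \<partial>lborel)
   \<le> ennreal ((2 * pi + 8 * pi * (norm l / (jap l)\<^sup>2)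
        * (\<tau> / norm l / (1 + (\<tau> / norm l * minor l k i j)\<^sup>2)))
      * (1 / jap (k - l) ^ (CARD('n) + 1)))"
  (is "?I \<le> _")
proof -
  let ?d = "CARD('n)"
  define w where "w = minor l k i j"
  define D where "D = jap (k - l)"
  have D: "D \<ge> 1" by (simp add: D_def jap_ge_1)
  have nl: "norm l > 0" using l0 by simp
  have nk: "norm k > 0" using kl nl by linarith
  then have k0: "k \<noteq> 0" by auto
  define q where "q = 1 / (1 + (\<tau> / norm l * w)\<^sup>2)"
  have q0: "q \<ge> 0" by (simp add: q_def)
  have s: "sqrt (norm l / norm k) \<le> 2"
  proof -
    have "norm l / norm k \<le> 4" using kl nk by (simp add: divide_le_eq)
    then have "sqrt (norm l / norm k) \<le> sqrt 4" by (rule real_sqrt_le_mono)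
    then show ?thesis by simp
  qed
  have qq: "1 / (1 + (\<tau> * w / norm k)\<^sup>2) \<le> 2\<^sup>2 * q"
    unfolding q_def
  proof (rule one_plus_power2_div_le)
    have "\<tau> * \<bar>w\<bar> * (1 / norm l) \<le> \<tau> * \<bar>w\<bar> * (2 / norm k)"
      using \<tau> nl nk kl by (intro mult_left_mono) (auto simp: field_simps)
    then show "\<bar>\<tau> / norm l * w\<bar> \<le> 2 * \<bar>\<tau> * w / norm k\<bar>"
      using \<tau> by (simp add: abs_mult mult_ac)
  qed simp
  have "pi * sqrt (norm l / norm k) / (jap l)\<^sup>2 * (1 / D ^ (?d + 3))
    * (1 + \<tau> * D * (1 / (1 + (\<tau> * w / norm k)\<^sup>2)))
     \<le> pi * 2 / (jap l)\<^sup>2 * (1 / D ^ (?d + 3)) * (1 + \<tau> * D * (2\<^sup>2 * q))"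
    using s qq D \<tau> q0 by (intro mult_mono divide_right_mono add_left_mono mult_left_mono) auto
  also have "\<dots> = 2 * pi * ((1 / (jap l)\<^sup>2) * (1 / D ^ (?d + 3))) + 8 * pi * (\<tau> * q / (jap l)\<^sup>2)
    * (D / D ^ (?d + 3))"
    by (simp add: algebra_simps add_divide_distrib)
  also have "\<dots> \<le> 2 * pi * (1 * (1 / D ^ (?d + 1))) + 8 * pi * (\<tau> * q / (jap l)\<^sup>2)
    * (1 / D ^ (?d + 1))"
  proof (intro add_mono mult_mono mult_left_mono)
    show "1 / (jap l)\<^sup>2 \<le> 1" by (simp add: jap_power2 divide_le_eq add_pos_nonneg)
    show "1 / D ^ (?d + 3) \<le> 1 / D ^ (?d + 1)"
      using D by (intro divide_left_mono power_increasing) auto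
    have "D / D ^ (?d + 3) = 1 / D ^ (?d + 2)" using D by (simp add: eval_nat_numeral)
    also have "\<dots> \<le> 1 / D ^ (?d + 1)" using D by (intro divide_left_mono power_increasing) auto
    finally show "D / D ^ (?d + 3) \<le> 1 / D ^ (?d + 1)" .
  qed (use D \<tau> q0 in auto)
  also have "\<dots> = (2 * pi + 8 * pi * (norm l / (jap l)\<^sup>2) * (\<tau> / norm l * q)) * (1 / D ^ (?d + 1))"
    using nl by (simp add: add_divide_distrib)
  finally have "ennreal (pi * sqrt (norm l / norm k) / (jap l)\<^sup>2 * (1 / D ^ (?d + 3))
    * (1 + \<tau> * D * (1 / (1 + (\<tau> * w / norm k)\<^sup>2))))
      \<le> ennreal ((2 * pi + 8 * pi * (norm l / (jap l)\<^sup>2) * (\<tau> / norm l * q)) * (1 / D ^ (?d + 1)))"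
    by (rule ennreal_leI)
  moreover have "?I
    \<le> ennreal (pi * sqrt (norm l / norm k) / (jap l)\<^sup>2 * (1 / D ^ (?d + 3))
      * (1 + \<tau> * D * (1 / (1 + (\<tau> * w / norm k)\<^sup>2))))"
    using column_time_integral[OF d \<sigma> \<tau> k0, where T = T and l = l and i = i and j = j]
    by (simp only: D_def w_def times_divide_eq_right mult_1_right)
  ultimately have "?I
    \<le> ennreal ((2 * pi + 8 * pi * (norm l / (jap l)\<^sup>2) * (\<tau> / norm l * q)) * (1 / D ^ (?d + 1)))"
    by (rule order_trans[rotated])
  then show ?thesis by (simp only: D_def w_def q_def times_divide_eq_right mult_1_right)
qed

text \<open>Here |k - l| is at least |l|/2, so decay in k - l turns into decay in l. It has to
  outweigh the sum over all |k| up to |l|, of order at most |l|^d. The scale |k| stays in the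
  profile, since no fixed scale is comparable to it.\<close>

lemma column_time_integral_small:
  fixes k l :: "real^'n"
  assumes d: "CARD('n) \<ge> 2" and \<sigma>: "\<sigma> \<ge> real CARD('n) + 3" and \<tau>: "0 \<le> \<tau>"
    and k0: "k \<noteq> 0" and kl: "2 * norm k < norm l"
  shows "(\<integral>\<^sup>+t\<in>{\<tau>..T}. ennreal (echo_kernel \<sigma> t \<tau> k l) \<partial>lborel)
   \<le> ennreal (pi * 2 ^ (CARD('n) + 3) / jap l ^ (CARD('n) + 4) * sqrt (norm l / norm k)
      * (1 + \<tau> / (1 + (\<tau> * minor l k i j / norm k)\<^sup>2)))"
  (is "?I \<le> _")
proof -
  let ?d = "CARD('n)"
  define w where "w = minor l k i j"
  define D where "D = jap (k - l)"
  define J where "J = jap l"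
  define s where "s = sqrt (norm l / norm k)"
  have D: "D \<ge> 1" and J: "J \<ge> 1" by (simp_all add: D_def J_def jap_ge_1)
  have s0: "s \<ge> 0" by (simp add: s_def)
  define q where "q = 1 / (1 + (\<tau> * w / norm k)\<^sup>2)"
  have q0: "q \<ge> 0" by (simp add: q_def)
  have JD: "J \<le> 2 * D"
  proof -
    have "norm l \<le> norm k + norm (k - l)" using norm_triangle_ineq4[of k "k - l"] by simp
    then have "norm l \<le> 2 * norm (k - l)" using kl by linarith
    then have "(norm l)\<^sup>2 \<le> (2 * norm (k - l))\<^sup>2" by (intro power_mono) auto
    then have "J\<^sup>2 \<le> (2 * D)\<^sup>2" by (simp add: J_def D_def jap_power2 power_mult_distrib)
    then show ?thesis by (rule power2_le_imp_le) (use D in simp)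
  qed
  have inv: "1 / D ^ m \<le> 2 ^ m / J ^ m" for m
  proof -
    have "J ^ m \<le> (2 * D) ^ m" using JD J by (intro power_mono) auto
    then have "2 ^ m / (2 * D) ^ m \<le> 2 ^ m / J ^ m"
      using D J by (intro divide_left_mono mult_pos_pos zero_less_power) auto
    then show ?thesis by (simp add: power_mult_distrib)
  qed
  have J2: "J ^ (?d + 4) \<le> J\<^sup>2 * J ^ (?d + 3)"
  proof -
    have "J ^ (?d + 4) \<le> J ^ (2 + (?d + 3))" by (rule power_increasing[OF _ J]) simp
    then show ?thesis by (simp only: power_add)
  qed
  have J2': "J ^ (?d + 4) = J\<^sup>2 * J ^ (?d + 2)" by (simp add: eval_nat_numeral)
  have a: "1 / J\<^sup>2 * (1 / D ^ (?d + 3)) \<le> 2 ^ (?d + 3) / J ^ (?d + 4)"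
  proof -
    have "1 / J\<^sup>2 * (1 / D ^ (?d + 3)) \<le> 1 / J\<^sup>2 * (2 ^ (?d + 3) / J ^ (?d + 3))"
      by (intro mult_left_mono inv) auto
    also have "\<dots> = 2 ^ (?d + 3) / (J\<^sup>2 * J ^ (?d + 3))" by simp
    also have "\<dots> \<le> 2 ^ (?d + 3) / J ^ (?d + 4)"
      using J J2 by (intro divide_left_mono) auto
    finally show ?thesis .
  qed
  have b: "1 / J\<^sup>2 * (D / D ^ (?d + 3)) \<le> 2 ^ (?d + 3) / J ^ (?d + 4)"
  proof -
    have "D / D ^ (?d + 3) = 1 / D ^ (?d + 2)" using D by (simp add: eval_nat_numeral)
    then have "1 / J\<^sup>2 * (D / D ^ (?d + 3)) \<le> 1 / J\<^sup>2 * (2 ^ (?d + 2) / J ^ (?d + 2))"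
      using inv[of "?d + 2"] by (intro mult_left_mono) auto
    also have "\<dots> = 2 ^ (?d + 2) / J ^ (?d + 4)" by (simp add: J2')
    also have "\<dots> \<le> 2 ^ (?d + 3) / J ^ (?d + 4)"
      using J by (intro divide_right_mono power_increasing) auto
    finally show ?thesis .
  qed
  have "pi * s / J\<^sup>2 * (1 / D ^ (?d + 3)) * (1 + \<tau> * D * q)
    = pi * s * (1 / J\<^sup>2 * (1 / D ^ (?d + 3))) + pi * s * \<tau> * q * (1 / J\<^sup>2 * (D / D ^ (?d + 3)))"
    by (simp add: algebra_simps add_divide_distrib)
  also have "\<dots> \<le> pi * s * (2 ^ (?d + 3) / J ^ (?d + 4)) + pi * s * \<tau> * q
    * (2 ^ (?d + 3) / J ^ (?d + 4))"
    using a b s0 \<tau> q0 by (intro add_mono mult_left_mono) auto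
  also have "\<dots> = pi * 2 ^ (?d + 3) / J ^ (?d + 4) * s * (1 + \<tau> * q)"
    by (simp add: algebra_simps add_divide_distrib)
  finally have "ennreal (pi * s / J\<^sup>2 * (1 / D ^ (?d + 3)) * (1 + \<tau> * D * q))
      \<le> ennreal (pi * 2 ^ (?d + 3) / J ^ (?d + 4) * s * (1 + \<tau> * q))"
    by (rule ennreal_leI)
  moreover have "?I
    \<le> ennreal (pi * s / J\<^sup>2 * (1 / D ^ (?d + 3)) * (1 + \<tau> * D * q))"
    using column_time_integral[OF d \<sigma> \<tau> k0, where T = T and l = l and i = i and j = j]
    by (simp only: D_def w_def q_def J_def s_def times_divide_eq_right mult_1_right)
  ultimately have "?I
    \<le> ennreal (pi * 2 ^ (?d + 3) / J ^ (?d + 4) * s * (1 + \<tau> * q))"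
    by (rule order_trans[rotated])
  then show ?thesis by (simp only: J_def w_def q_def s_def times_divide_eq_right mult_1_right)
qed

section \<open>The Schur sums\<close>

text \<open>The choice of pivot: for the largest coordinate, 1 / |p_i| is comparable to 1 /
  |p|.\<close>

lemma obtain_max_coordinate:
  fixes p :: "real^'n"
  obtains i where "norm p \<le> real CARD('n) * \<bar>p $ i\<bar>"
proof -
  obtain i where i: "\<And>j. \<bar>p $ j\<bar> \<le> \<bar>p $ i\<bar>"
  proof -
    have "Max (range (\<lambda>j. \<bar>p $ j\<bar>)) \<in> range (\<lambda>j. \<bar>p $ j\<bar>)" by (rule Max_in) auto
    then obtain i where "Max (range (\<lambda>j. \<bar>p $ j\<bar>)) = \<bar>p $ i\<bar>" by (rule rangeE)
    then have "\<bar>p $ j\<bar> \<le> \<bar>p $ i\<bar>" for j using Max_ge[of "range (\<lambda>j. \<bar>p $ j\<bar>)" "\<bar>p $ j\<bar>"] by auto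
    then show ?thesis using that by blast
  qed
  have "norm p \<le> (\<Sum>j\<in>UNIV. \<bar>p $ j\<bar>)" by (rule norm_le_l1_cart)
  also have "\<dots> \<le> (\<Sum>j\<in>(UNIV :: 'n set). \<bar>p $ i\<bar>)" by (intro sum_mono i)
  finally show ?thesis using that by simp
qed

text \<open>If all minors containing a nonzero pivot vanish, then z is the multiple z_i / p_i of p.
  Hence only d minors have to be considered, all with the same i.\<close>

lemma wedge_nonzero_minor:
  fixes p z :: "real^'n"
  assumes "p $ i \<noteq> 0" "wedge p z \<noteq> 0"
  obtains j where "minor p z i j \<noteq> 0"
proof (rule ccontr)
  assume "\<not> thesis"
  then have *: "p $ i * z $ j = p $ j * z $ i" for j using that by auto
  have zj: "z $ j = z $ i / p $ i * p $ j" for j using *[of j] assms(1) by (simp add: field_simps)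
  have "p $ a * z $ b = p $ b * z $ a" for a b using zj[of a] zj[of b] by simp
  then have "wedge p z = 0" by (simp add: wedge_def vec_eq_iff)
  then show False using assms(2) by simp
qed

lemma wedge_commute_zero: "wedge k l = 0 \<longleftrightarrow> wedge l k = (0 :: real^'n^'n)"
  by (auto simp: wedge_def vec_eq_iff mult.commute)

lemma ennreal_mult3: "0 \<le> a \<Longrightarrow> 0 \<le> b \<Longrightarrow> 0 \<le> c \<Longrightarrow> ennreal (a * (b * c)) = ennreal a
  * (ennreal b * ennreal c)"
  by (simp add: ennreal_mult)

lemma jap_minus_commute: "jap (k - l) = jap (l - k)"
  by (simp add: jap_def norm_minus_commute)

text \<open>Adding the bounds of both regimes removes the case distinction before the sum over l.
  The indices are left free: equal ones make the minor zero, which is how the collinear case is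
  obtained.\<close>

lemma row_time_integral:
  fixes k l :: "real^'n"
  assumes d: "CARD('n) \<ge> 2" and \<sigma>: "\<sigma> \<ge> real CARD('n) + 3" and t: "0 < t" and l0: "l \<noteq> 0"
  shows "(\<integral>\<^sup>+\<tau>\<in>{0..t}. ennreal (echo_kernel \<sigma> t \<tau> k l) \<partial>lborel)
    \<le> ennreal 4 * ennreal (1 / jap (l - k) ^ (CARD('n) + 1)) +
      ennreal (32 * pi * (norm k / jap k)) *
       (ennreal (t / jap k / (1 + (t / jap k * minor k l i j)\<^sup>2))
         * ennreal (1 / jap (l - k) ^ (CARD('n) + 1)))"
  (is "?I \<le> _")
proof (cases "2 * norm l < norm k")
  case True
  have "?I \<le> ennreal (4 * (1 / jap (l - k) ^ (CARD('n) + 1)))"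
    using row_time_integral_far[OF d \<sigma> t True] by (simp add: jap_minus_commute[of k l])
  also have "\<dots> = ennreal 4 * ennreal (1 / jap (l - k) ^ (CARD('n) + 1))"
    by (rule ennreal_mult) (auto simp: jap_pos less_imp_le)
  finally show ?thesis by (rule order_trans) simp
next
  case False
  then have lk: "norm k \<le> 2 * norm l" by simp
  have "?I
    \<le> ennreal (32 * pi * (norm k / jap k) * (t / jap k / (1 + (t / jap k * minor k l i j)\<^sup>2)
      * (1 / jap (l - k) ^ (CARD('n) + 1))))"
    using row_time_integral_near[OF d \<sigma> t l0 lk, of i j] by
      (simp only: mult.assoc jap_minus_commute[of k l])
  also have "\<dots> = ennreal (32 * pi * (norm k / jap k)) *
       (ennreal (t / jap k / (1 + (t / jap k * minor k l i j)\<^sup>2))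
         * ennreal (1 / jap (l - k) ^ (CARD('n) + 1)))"
    using t jap_pos[of k] jap_pos[of "l - k"]
    by (intro ennreal_mult3 mult_nonneg_nonneg divide_nonneg_nonneg) auto
  finally show ?thesis by (rule order_trans) simp
qed

text \<open>The three regimes added up: k large, k comparable to l, k small. The indicator confines
  the singular terms to |k| at most |l|, the form needed by the dyadic lemmas with \<rho> =
  |l|.\<close>

lemma column_time_integral_le:
  fixes k l :: "real^'n"
  assumes d: "CARD('n) \<ge> 2" and \<sigma>: "\<sigma> \<ge> real CARD('n) + 3" and \<tau>: "0 \<le> \<tau>" and k0: "k \<noteq> 0" and l0:
    "l \<noteq> 0"
  shows "(\<integral>\<^sup>+t\<in>{\<tau>..T}. ennreal (echo_kernel \<sigma> t \<tau> k l) \<partial>lborel)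
    \<le> ennreal (2 * pi) * ennreal (1 / jap (k - l) ^ (CARD('n) + 1)) +
      (ennreal (8 * pi * (norm l / (jap l)\<^sup>2)) *
       (ennreal (\<tau> / norm l / (1 + (\<tau> / norm l * minor l k i j)\<^sup>2))
         * ennreal (1 / jap (k - l) ^ (CARD('n) + 1)))
      + ennreal (pi * 2 ^ (CARD('n) + 3) / jap l ^ (CARD('n) + 4)) *
       (ennreal (sqrt (norm l / norm k)) * indicator {k. norm k \<le> norm l} k
        + ennreal (sqrt (norm l / norm k)) * ennreal (\<tau> / (1 + (\<tau> * minor l k i j / norm k)\<^sup>2))
          * indicator {k. norm k \<le> norm l} k))"
   (is "?I \<le> ?A + (?B + ?C)")
proof -
  consider "2 * norm l < norm k" | "norm l \<le> 2 * norm k" "norm k \<le> 2 * norm l" |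
    "2 * norm k < norm l" by linarith
  then show ?thesis
  proof cases
    case 1
    have "?A = ennreal (2 * pi * (1 / jap (k - l) ^ (CARD('n) + 1)))"
      by (rule ennreal_mult[symmetric]) (auto simp: jap_pos less_imp_le)
    then have "?I \<le> ?A"
      using column_time_integral_far[OF d \<sigma> \<tau> 1, of T] by (simp only:)
    then show ?thesis by (rule order_trans) simp
  next
    case 2
    let ?D = "1 / jap (k - l) ^ (CARD('n) + 1)" and ?L =
      "\<tau> / norm l / (1 + (\<tau> / norm l * minor l k i j)\<^sup>2)"
    have D0: "?D \<ge> 0" by (simp add: jap_pos less_imp_le)
    have L0: "?L \<ge> 0" using \<tau> by (intro divide_nonneg_nonneg) auto
    have c0: "8 * pi * (norm l / (jap l)\<^sup>2) \<ge> 0" by simp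
    have "?I \<le> ennreal ((2 * pi + 8 * pi * (norm l / (jap l)\<^sup>2) * ?L) * ?D)"
      by (rule column_time_integral_comparable[OF d \<sigma> \<tau> l0 2])
    also have "(2 * pi + 8 * pi * (norm l / (jap l)\<^sup>2) * ?L) * ?D = 2 * pi * ?D + 8 * pi
      * (norm l / (jap l)\<^sup>2) * (?L * ?D)"
      by (simp only: distrib_right mult.assoc)
    also have "ennreal \<dots> = ennreal (2 * pi * ?D) + ennreal (8 * pi * (norm l / (jap l)\<^sup>2)
      * (?L * ?D))"
      using D0 L0 c0 by (intro ennreal_plus mult_nonneg_nonneg) auto
    also have "\<dots> = ?A + ?B"
    proof -
      have 1: "ennreal (2 * pi * ?D) = ?A" by (rule ennreal_mult) (use D0 in auto)
      have 2: "ennreal (8 * pi * (norm l / (jap l)\<^sup>2) * (?L * ?D)) = ?B"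
        by (rule ennreal_mult3[OF c0 L0 D0])
      show ?thesis unfolding 1 2 ..
    qed
    finally show ?thesis by (rule order_trans) (simp add: add.assoc[symmetric])
  next
    case 3
    let ?c = "pi * 2 ^ (CARD('n) + 3) / jap l ^ (CARD('n) + 4)" and ?s = "sqrt (norm l / norm k)"
      and ?L = "\<tau> / (1 + (\<tau> * minor l k i j / norm k)\<^sup>2)"
    have c0: "?c \<ge> 0" using jap_pos[of l] by simp
    have s0: "?s \<ge> 0" by simp
    have L0: "?L \<ge> 0" using \<tau> by (intro divide_nonneg_nonneg) auto
    have kl: "norm k \<le> norm l" using 3 norm_ge_zero[of k] by linarith
    have "?I \<le> ennreal (?c * ?s * (1 + ?L))" by (rule column_time_integral_small[OF d \<sigma> \<tau> k0 3])
    also have "?c * ?s * (1 + ?L) = ?c * (?s + ?s * ?L)" by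
      (simp only: distrib_left mult.assoc mult_1_right)
    also have "ennreal \<dots> = ennreal ?c * (ennreal ?s + ennreal ?s * ennreal ?L)"
      by (simp only: ennreal_mult[OF c0 add_nonneg_nonneg[OF s0 mult_nonneg_nonneg[OF s0 L0]]]
        ennreal_plus[OF s0 mult_nonneg_nonneg[OF s0 L0]] ennreal_mult[OF s0 L0])
    also have "\<dots> = ?C" using kl by simp
    finally show ?thesis by (rule order_trans) (simp add: add.assoc[symmetric])
  qed
qed


text \<open>This is where the factor 1 / |p_i| of the lattice sums is paid for: the part without it
  is bounded because |p| is at most <p>, the part with it because |p| / |p_i| is at most d.\<close>

lemma norm_div_jap_bound:
  fixes p :: "real^'n"
  assumes pi: "p $ i \<noteq> 0" and max: "norm p \<le> real CARD('n) * \<bar>p $ i\<bar>"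
  shows "norm p / jap p * (1 + 2 / \<bar>p $ i\<bar>) \<le> 1 + 2 * real CARD('n)"
proof -
  have J: "jap p \<ge> 1" "norm p \<le> jap p" by (rule jap_ge_1 jap_ge_norm)+
  have 1: "norm p / jap p \<le> 1" using J by simp
  have "norm p / jap p \<le> norm p / 1" using J by (intro divide_left_mono) auto
  then have "norm p / jap p * (2 / \<bar>p $ i\<bar>) \<le> norm p * (2 / \<bar>p $ i\<bar>)"
    by (intro mult_right_mono) auto
  also have "\<dots> \<le> real CARD('n) * \<bar>p $ i\<bar> * (2 / \<bar>p $ i\<bar>)" using max by (intro mult_right_mono) auto
  also have "\<dots> = 2 * real CARD('n)" using pi by simp
  finally show ?thesis using 1 by (simp only: distrib_left mult_1_right)
qed

lemma lattice_nonzero: "z \<in> lattice L \<Longrightarrow> z \<noteq> 0"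
  by (simp add: lattice_def)

text \<open>The two time arguments are functions of the integration variable so that rows and
  columns are covered at once.\<close>

lemma set_nn_integral_nc_le:
  assumes "wedge k l \<noteq> 0 \<Longrightarrow> (\<integral>\<^sup>+s\<in>A. ennreal (echo_kernel \<sigma> (f s) (g s) k l) \<partial>lborel) \<le> b"
  shows "(\<integral>\<^sup>+s\<in>A. ennreal (echo_kernel_nc \<sigma> (f s) (g s) k l) \<partial>lborel) \<le> b"
  using assms by (cases "wedge k l = 0") (auto simp: echo_kernel_nc_def)

lemma set_nn_integral_col_le:
  assumes "wedge k l = 0 \<Longrightarrow> (\<integral>\<^sup>+s\<in>A. ennreal (echo_kernel \<sigma> (f s) (g s) k l) \<partial>lborel) \<le> b"
  shows "(\<integral>\<^sup>+s\<in>A. ennreal (echo_kernel_col \<sigma> (f s) (g s) k l) \<partial>lborel) \<le> b"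
  using assms by (cases "wedge k l = 0") (auto simp: echo_kernel_col_def)

lemma sum_const_ennreal: "a \<ge> 0 \<Longrightarrow> (\<Sum>j\<in>(UNIV :: 'n::finite set). ennreal a)
  = ennreal (real CARD('n) * a)"
  by (simp add: ennreal_mult ennreal_of_nat_eq_real_of_nat)

lemma schur_plus_nc:
  assumes d: "CARD('n::finite) \<ge> 2" and \<sigma>: "\<sigma> \<ge> real CARD('n) + 3" and L: "L \<ge> 1"
  shows "schur_plus L T (echo_kernel_nc \<sigma> :: 'n kernel)
    \<le> ennreal (4 * (2 ^ (CARD('n) + 2) * 3 ^ CARD('n))
      + real CARD('n) * (32 * pi * (2 ^ (CARD('n) + 2) * (pi * 3 ^ (CARD('n) - 2))
        * (1 + 2 * real CARD('n)))))"
   (is "_ \<le> ?C")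
  unfolding schur_plus_def
proof (intro SUP_least)
  let ?d = "CARD('n)"
  fix k :: "real^'n" and t assume k: "k \<in> lattice L" and "t \<in> {0<..T}"
  then have t: "0 < t" by simp
  obtain i where i: "norm k \<le> real ?d * \<bar>k $ i\<bar>" by (rule obtain_max_coordinate)
  have ki: "k $ i \<noteq> 0" using i lattice_nonzero[OF k] by auto
  let ?w = "\<lambda>j l. minor k l i j"
  let ?X = "\<lambda>l. ennreal (1 / jap (l - k) ^ (?d + 1))"
  let ?Y = "\<lambda>j l. ennreal (t / jap k / (1 + (t / jap k * ?w j l)\<^sup>2))"
  let ?a = "32 * pi * (norm k / jap k)"
  let ?c = "2 ^ (?d + 2) * (pi * (1 + 2 / \<bar>k $ i\<bar>) * 3 ^ (?d - 2))"
  have "(\<integral>\<^sup>+ l. (\<integral>\<^sup>+ \<tau>\<in>{0..t}. ennreal (echo_kernel_nc \<sigma> t \<tau> k l) \<partial>lborel) \<partial>nu L)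
    \<le> (\<integral>\<^sup>+ l. ennreal 4 * ?X l
      + (\<Sum>j\<in>UNIV. ennreal ?a * (?Y j l * indicator {l. ?w j l \<noteq> 0} l * ?X l)) \<partial>nu L)"
  proof (intro nn_integral_mono set_nn_integral_nc_le)
    fix l assume "l \<in> space (nu L)" and w: "wedge k l \<noteq> 0"
    then have l0: "l \<noteq> 0" by (simp add: lattice_nonzero)
    obtain j where j: "?w j l \<noteq> 0" by (rule wedge_nonzero_minor[OF ki w])
    \<comment> \<open>The nonvanishing minor varies with l; adding the bounds for all j makes the
      choice harmless and puts the factor d into the constant.\<close>
    have "ennreal ?a * (?Y j l * ?X l) = ennreal ?a * (?Y j l * indicator {l. ?w j l \<noteq> 0} l * ?X l)"
      using j by simp
    also have "\<dots> \<le> (\<Sum>j\<in>UNIV. ennreal ?a * (?Y j l * indicator {l. ?w j l \<noteq> 0} l * ?X l))"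
      by (rule member_le_sum) auto
    finally show "(\<integral>\<^sup>+ \<tau>\<in>{0..t}. ennreal (echo_kernel \<sigma> t \<tau> k l) \<partial>lborel)
       \<le> ennreal 4 * ?X l + (\<Sum>j\<in>UNIV. ennreal ?a * (?Y j l * indicator {l. ?w j l \<noteq> 0} l * ?X l))"
      by (intro order_trans[OF row_time_integral[OF d \<sigma> t l0, of k i j]] add_left_mono)
  qed
  also have "\<dots> = ennreal 4 * (\<integral>\<^sup>+ l. ?X l \<partial>nu L)
      + (\<Sum>j\<in>UNIV. ennreal ?a * (\<integral>\<^sup>+ l. ?Y j l * indicator {l. ?w j l \<noteq> 0} l * ?X l \<partial>nu L))"
    by (simp add: nn_integral_add nn_integral_sum nn_integral_cmult)
  also have "\<dots> \<le> ennreal 4 * ennreal (2 ^ (?d + 2) * 3 ^ ?d) + (\<Sum>j\<in>(UNIV :: 'n set). ennreal ?a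
    * ennreal ?c)"
    using t jap_pos[of k]
    by (intro add_mono mult_left_mono sum_mono nn_integral_nu_jap nn_integral_nu_wedge_jap d L k ki)
      auto
  also have "\<dots> = ennreal (4 * (2 ^ (?d + 2) * 3 ^ ?d)) + (\<Sum>j\<in>(UNIV :: 'n set). ennreal (?a * ?c))"
  proof -
    have "ennreal ?a * ennreal ?c = ennreal (?a * ?c)"
      by (rule ennreal_mult[symmetric]) (auto simp: jap_pos less_imp_le)
    moreover have "ennreal 4 * ennreal (2 ^ (?d + 2) * 3 ^ ?d)
      = ennreal (4 * (2 ^ (?d + 2) * 3 ^ ?d))"
      by (rule ennreal_mult[symmetric]) auto
    ultimately show ?thesis by simp
  qed
  also have "(\<Sum>j\<in>(UNIV :: 'n set). ennreal (?a * ?c)) = ennreal (real ?d * (?a * ?c))"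
    by (rule sum_const_ennreal) (auto simp: jap_pos less_imp_le)
  also have "ennreal (4 * (2 ^ (?d + 2) * 3 ^ ?d)) + ennreal (real ?d * (?a * ?c))
    = ennreal (4 * (2 ^ (?d + 2) * 3 ^ ?d) + real ?d * (?a * ?c))"
    by (rule ennreal_plus[symmetric]) (auto simp: jap_pos less_imp_le)
  also have "\<dots> \<le> ?C"
  proof (intro ennreal_leI add_left_mono mult_left_mono)
    have "?a * ?c = 32 * pi * (2 ^ (?d + 2) * (pi * 3 ^ (?d - 2))
      * (norm k / jap k * (1 + 2 / \<bar>k $ i\<bar>)))"
      by (simp only: mult_ac)
    also have "\<dots> \<le> 32 * pi * (2 ^ (?d + 2) * (pi * 3 ^ (?d - 2)) * (1 + 2 * real ?d))"
      by (intro mult_left_mono norm_div_jap_bound ki i) auto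
    finally show "?a * ?c \<le> 32 * pi * (2 ^ (?d + 2) * (pi * 3 ^ (?d - 2)) * (1 + 2 * real ?d))" .
  qed auto
  finally show "(\<integral>\<^sup>+ l. (\<integral>\<^sup>+ \<tau>\<in>{0..t}. ennreal (echo_kernel_nc \<sigma> t \<tau> k l) \<partial>lborel) \<partial>nu L)
    \<le> ?C" .
qed

lemma schur_plus_col:
  assumes d: "CARD('n::finite) \<ge> 2" and \<sigma>: "\<sigma> \<ge> real CARD('n) + 3" and L: "L \<ge> 1" and T: "T > 0"
  shows "schur_plus L T (echo_kernel_col \<sigma> :: 'n kernel)
    \<le> ennreal (32 * pi * (2 ^ (CARD('n) + 2) * 3) * (1 + T) * (L / L ^ CARD('n)))"
  unfolding schur_plus_def
proof (intro SUP_least)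
  let ?d = "CARD('n)"
  fix k :: "real^'n" and t assume k: "k \<in> lattice L" and "t \<in> {0<..T}"
  then have t: "0 < t" "t \<le> T" by simp_all
  obtain i where i: "norm k \<le> real ?d * \<bar>k $ i\<bar>" by (rule obtain_max_coordinate)
  have ki: "k $ i \<noteq> 0" using i lattice_nonzero[OF k] by auto
  let ?X = "\<lambda>l. ennreal (1 / jap (l - k) ^ (?d + 1))"
  let ?b = "32 * pi * (1 + T)"
  have "(\<integral>\<^sup>+ l. (\<integral>\<^sup>+ \<tau>\<in>{0..t}. ennreal (echo_kernel_col \<sigma> t \<tau> k l) \<partial>lborel) \<partial>nu L)
    \<le> (\<integral>\<^sup>+ l. ennreal ?b * (indicator {l. wedge k l = 0} l * ?X l) \<partial>nu L)"
  proof (intro nn_integral_mono set_nn_integral_col_le)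
    fix l assume "l \<in> space (nu L)" and w: "wedge k l = 0"
    then have l0: "l \<noteq> 0" by (simp add: lattice_nonzero)
    have "norm k / jap k * (t / jap k) \<le> 1 * (T / 1)"
      using t jap_ge_1[of k] jap_ge_norm[of k] by (intro mult_mono frac_le divide_nonneg_nonneg)
        (auto simp: divide_le_eq)
    then have "32 * pi * (norm k / jap k * (t / jap k)) \<le> 32 * pi * T"
      by (intro mult_left_mono) auto
    then have le: "4 + 32 * pi * (norm k / jap k) * (t / jap k) \<le> ?b"
      using pi_gt3 by (simp only: distrib_left mult.assoc mult_1_right)
    \<comment> \<open>With both indices equal to \<open>i\<close> the minor is 0 and the profile
      reduces to t / <k>, the source of the growth in T.\<close>
    have "(\<integral>\<^sup>+ \<tau>\<in>{0..t}. ennreal (echo_kernel \<sigma> t \<tau> k l) \<partial>lborel)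
       \<le> ennreal 4 * ?X l + ennreal (32 * pi * (norm k / jap k)) * (ennreal (t / jap k) * ?X l)"
      using row_time_integral[OF d \<sigma> t(1) l0, of k i i] by simp
    also have "\<dots> = ennreal (4 + 32 * pi * (norm k / jap k) * (t / jap k)) * ?X l"
    proof -
      let ?x = "32 * pi * (norm k / jap k)" and ?y = "t / jap k"
      have x0: "?x \<ge> 0" and y0: "?y \<ge> 0" using t jap_pos[of k] by auto
      have "ennreal (4 + ?x * ?y) = ennreal 4 + ennreal ?x * ennreal ?y"
        unfolding ennreal_mult[OF x0 y0, symmetric] by (rule ennreal_plus)
          (use mult_nonneg_nonneg[OF x0 y0] in auto)
      then show ?thesis by (simp only: distrib_right mult.assoc)
    qed
    also have "\<dots> \<le> ennreal ?b * ?X l" by (intro mult_right_mono ennreal_leI le) auto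
    finally show "(\<integral>\<^sup>+ \<tau>\<in>{0..t}. ennreal (echo_kernel \<sigma> t \<tau> k l) \<partial>lborel)
       \<le> ennreal ?b * (indicator {l. wedge k l = 0} l * ?X l)" using w by simp
  qed
  also have "\<dots> = ennreal ?b * (\<integral>\<^sup>+ l. indicator {l. wedge k l = 0} l * ?X l \<partial>nu L)"
    by (simp add: nn_integral_cmult)
  also have "\<dots> \<le> ennreal ?b * ennreal (2 ^ (?d + 2) * (3 * (L / L ^ ?d)))"
    by (intro mult_left_mono nn_integral_nu_collinear_jap[OF L ki]) simp
  also have "\<dots> = ennreal (?b * (2 ^ (?d + 2) * (3 * (L / L ^ ?d))))"
    using T L by (intro ennreal_mult[symmetric]) auto
  also have "?b * (2 ^ (?d + 2) * (3 * (L / L ^ ?d))) = 32 * pi * (2 ^ (?d + 2) * 3) * (1 + T)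
    * (L / L ^ ?d)"
    by (simp only: mult_ac)
  finally show "(\<integral>\<^sup>+ l. (\<integral>\<^sup>+ \<tau>\<in>{0..t}. ennreal (echo_kernel_col \<sigma> t \<tau> k l) \<partial>lborel) \<partial>nu L)
    \<le> ennreal (32 * pi * (2 ^ (?d + 2) * 3) * (1 + T) * (L / L ^ ?d))" .
qed


lemma schur_minus_nc:
  assumes d: "CARD('n::finite) \<ge> 2" and \<sigma>: "\<sigma> \<ge> real CARD('n) + 3" and L: "L \<ge> 1"
  shows "schur_minus L T (echo_kernel_nc \<sigma> :: 'n kernel)
    \<le> ennreal (2 * pi * (2 ^ (CARD('n) + 2) * 3 ^ CARD('n))
      + real CARD('n) * (8 * pi * (2 ^ (CARD('n) + 2) * (pi * 3 ^ (CARD('n) - 2))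
        * (1 + 2 * real CARD('n)))
          + pi * 2 ^ (CARD('n) + 3) * (8 * (pi * (1 + 2 * real CARD('n)) * 3 ^ (CARD('n) - 2))))
      + pi * 2 ^ (CARD('n) + 3) * (8 * 3 ^ CARD('n)))"
   (is "_ \<le> ennreal (?C1 + real CARD('n) * (?C2 + ?C3) + ?C4)")
  unfolding schur_minus_def
proof (intro SUP_least)
  let ?d = "CARD('n)"
  fix l :: "real^'n" and \<tau> assume l: "l \<in> lattice L" and "\<tau> \<in> {0..<T}"
  then have \<tau>: "0 \<le> \<tau>" by simp
  obtain i where i: "norm l \<le> real ?d * \<bar>l $ i\<bar>" by (rule obtain_max_coordinate)
  have l0: "l \<noteq> 0" using lattice_nonzero[OF l] .
  then have li: "l $ i \<noteq> 0" and nl: "norm l > 0" using i by auto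
  have J: "jap l \<ge> 1" "norm l \<le> jap l" by (rule jap_ge_1 jap_ge_norm)+
  let ?w = "\<lambda>j k. minor l k i j"
  let ?W = "\<lambda>j. indicator {k. ?w j k \<noteq> 0} :: real^'n \<Rightarrow> ennreal"
  let ?B = "indicator {k. norm k \<le> norm l} :: real^'n \<Rightarrow> ennreal"
  let ?X = "\<lambda>k. ennreal (1 / jap (k - l) ^ (?d + 1))"
  let ?Y = "\<lambda>j k. ennreal (\<tau> / norm l / (1 + (\<tau> / norm l * ?w j k)\<^sup>2))"
  let ?Z = "\<lambda>j k. ennreal (\<tau> / (1 + (\<tau> * ?w j k / norm k)\<^sup>2))"
  let ?S = "\<lambda>k. ennreal (sqrt (norm l / norm k))"
  let ?a = "8 * pi * (norm l / (jap l)\<^sup>2)"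
  let ?b = "pi * 2 ^ (?d + 3) / jap l ^ (?d + 4)"
  let ?c1 = "2 ^ (?d + 2) * 3 ^ ?d"
  let ?c2 = "2 ^ (?d + 2) * (pi * (1 + 2 / \<bar>l $ i\<bar>) * 3 ^ (?d - 2))"
  let ?c3 = "8 * (norm l * (pi * (1 + 2 * norm l / \<bar>l $ i\<bar>) * (3 * norm l) ^ (?d - 2)))"
  let ?c4 = "8 * (3 * norm l) ^ ?d"
  have b0: "?b \<ge> 0" using jap_pos[of l] by simp
  have "(\<integral>\<^sup>+ k. (\<integral>\<^sup>+ t\<in>{\<tau>..T}. ennreal (echo_kernel_nc \<sigma> t \<tau> k l) \<partial>lborel) \<partial>nu L)
    \<le> (\<integral>\<^sup>+ k. ennreal (2 * pi) * ?X k
        + (\<Sum>j\<in>UNIV. ennreal ?a * (?Y j k * ?W j k * ?X k) + ennreal ?b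
          * (?S k * (?Z j k * ?W j k) * ?B k))
        + ennreal ?b * (?S k * ?B k) \<partial>nu L)"
  proof (intro nn_integral_mono set_nn_integral_nc_le)
    fix k assume "k \<in> space (nu L)" and w: "wedge k l \<noteq> 0"
    then have k0: "k \<noteq> 0" by (simp add: lattice_nonzero)
    have "wedge l k \<noteq> 0" using w wedge_commute_zero by blast
    then obtain j where j: "?w j k \<noteq> 0" by (rule wedge_nonzero_minor[OF li])
    have "ennreal ?a * (?Y j k * ?X k) + ennreal ?b * (?S k * ?Z j k * ?B k)
       = ennreal ?a * (?Y j k * ?W j k * ?X k) + ennreal ?b * (?S k * (?Z j k * ?W j k) * ?B k)"
      using j by simp
    also have "\<dots> \<le> (\<Sum>j\<in>UNIV. ennreal ?a * (?Y j k * ?W j k * ?X k) + ennreal ?b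
      * (?S k * (?Z j k * ?W j k) * ?B k))"
      by (rule member_le_sum[where f = "\<lambda>j. ennreal ?a * (?Y j k * ?W j k * ?X k) + ennreal ?b
        * (?S k * (?Z j k * ?W j k) * ?B k)"]) auto
    finally have *: "ennreal ?a * (?Y j k * ?X k) + ennreal ?b * (?S k * ?Z j k * ?B k) \<le> \<dots>" .
    have "(\<integral>\<^sup>+ t\<in>{\<tau>..T}. ennreal (echo_kernel \<sigma> t \<tau> k l) \<partial>lborel)
      \<le> ennreal (2 * pi) * ?X k + (ennreal ?a * (?Y j k * ?X k) + ennreal ?b
        * (?S k * ?B k + ?S k * ?Z j k * ?B k))"
      by (rule column_time_integral_le[OF d \<sigma> \<tau> k0 l0])
    also have "\<dots> = ennreal (2 * pi) * ?X k + (ennreal ?a * (?Y j k * ?X k) + ennreal ?b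
      * (?S k * ?Z j k * ?B k))
        + ennreal ?b * (?S k * ?B k)"
      by (simp only: distrib_left add_ac)
    finally show "(\<integral>\<^sup>+ t\<in>{\<tau>..T}. ennreal (echo_kernel \<sigma> t \<tau> k l) \<partial>lborel)
      \<le> ennreal (2 * pi) * ?X k
        + (\<Sum>j\<in>UNIV. ennreal ?a * (?Y j k * ?W j k * ?X k) + ennreal ?b
          * (?S k * (?Z j k * ?W j k) * ?B k))
        + ennreal ?b * (?S k * ?B k)"
      by (rule order_trans) (intro add_mono order_refl *)
  qed
  also have "\<dots> = ennreal (2 * pi) * (\<integral>\<^sup>+ k. ?X k \<partial>nu L)
        + (\<Sum>j\<in>UNIV. ennreal ?a * (\<integral>\<^sup>+ k. ?Y j k * ?W j k * ?X k \<partial>nu L) + ennreal ?b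
          * (\<integral>\<^sup>+ k. ?S k * (?Z j k * ?W j k) * ?B k \<partial>nu L))
        + ennreal ?b * (\<integral>\<^sup>+ k. ?S k * ?B k \<partial>nu L)"
    by (simp add: nn_integral_add nn_integral_sum nn_integral_cmult)
  also have "\<dots> \<le> ennreal (2 * pi) * ennreal ?c1 + (\<Sum>j\<in>(UNIV :: 'n set). ennreal ?a * ennreal ?c2
    + ennreal ?b * ennreal ?c3) + ennreal ?b * ennreal ?c4"
    using \<tau> nl L
    by (intro add_mono mult_left_mono sum_mono nn_integral_nu_jap nn_integral_nu_wedge_jap
      nn_integral_nu_wedge_singular
        nn_integral_nu_singular d l li) auto
  also have "\<dots> = ennreal (2 * pi * ?c1 + real ?d * (?a * ?c2 + ?b * ?c3) + ?b * ?c4)"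
  proof -
    have 1: "ennreal (2 * pi) * ennreal ?c1 = ennreal (2 * pi * ?c1)"
      by (rule ennreal_mult[symmetric]) auto
    have 2: "ennreal ?a * ennreal ?c2 = ennreal (?a * ?c2)" by (rule ennreal_mult[symmetric]) auto
    have 3: "ennreal ?b * ennreal ?c3 = ennreal (?b * ?c3)"
      by (rule ennreal_mult[symmetric, OF b0]) auto
    have 4: "ennreal ?b * ennreal ?c4 = ennreal (?b * ?c4)"
      by (rule ennreal_mult[symmetric, OF b0]) auto
    have n2: "0 \<le> ?a * ?c2" and n1: "0 \<le> 2 * pi * ?c1" by auto
    have n3: "0 \<le> ?b * ?c3" by (rule mult_nonneg_nonneg[OF b0]) auto
    have n4: "0 \<le> ?b * ?c4" by (rule mult_nonneg_nonneg[OF b0]) auto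
    have n5: "0 \<le> real ?d * (?a * ?c2 + ?b * ?c3)"
      by (rule mult_nonneg_nonneg[OF _ add_nonneg_nonneg[OF n2 n3]]) auto
    show ?thesis
      unfolding 1 2 3 4 ennreal_plus[OF n2 n3, symmetric]
        sum_const_ennreal[OF add_nonneg_nonneg[OF n2 n3]]
        ennreal_plus[OF n1 n5, symmetric] ennreal_plus[OF add_nonneg_nonneg[OF n1 n5] n4, symmetric]
          ..
  qed
  also have "\<dots> \<le> ennreal (?C1 + real ?d * (?C2 + ?C3) + ?C4)"
  proof (intro ennreal_leI add_mono mult_left_mono)
    have q: "norm l / (jap l)\<^sup>2 * (1 + 2 / \<bar>l $ i\<bar>) \<le> 1 + 2 * real ?d"
    proof -
      have "norm l / (jap l)\<^sup>2 \<le> norm l / jap l"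
        using J by (intro divide_left_mono) (auto simp: power2_eq_square jap_pos)
      then have "norm l / (jap l)\<^sup>2 * (1 + 2 / \<bar>l $ i\<bar>) \<le> norm l / jap l * (1 + 2 / \<bar>l $ i\<bar>)"
        by (intro mult_right_mono) auto
      also have "\<dots> \<le> 1 + 2 * real ?d" by (rule norm_div_jap_bound[OF li i])
      finally show ?thesis .
    qed
    have "?a * ?c2 = 8 * pi * (2 ^ (?d + 2) * (pi * 3 ^ (?d - 2))
      * (norm l / (jap l)\<^sup>2 * (1 + 2 / \<bar>l $ i\<bar>)))"
      by (simp only: mult_ac)
    also have "\<dots> \<le> ?C2" using q by (intro mult_left_mono) auto
    finally show "?a * ?c2 \<le> ?C2" .
    \<comment> \<open>The powers of |l| produced by the singular sums, at most d, are absorbed by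
      the d + 4 powers of <l> of the regime of small k.\<close>
    have pw: "norm l ^ m / jap l ^ (?d + 4) \<le> 1" if "m \<le> ?d + 4" for m
    proof -
      have "norm l ^ m \<le> jap l ^ m" using J by (intro power_mono) auto
      also have "\<dots> \<le> jap l ^ (?d + 4)" by (rule power_increasing[OF that J(1)])
      finally show ?thesis using jap_pos[of l] by (simp add: divide_le_eq)
    qed
    have r: "1 + 2 * norm l / \<bar>l $ i\<bar> \<le> 1 + 2 * real ?d"
      using i li by (simp add: divide_le_eq mult.assoc)
    have "?b * ?c3 = pi * 2 ^ (?d + 3) * (8 * (pi * (1 + 2 * norm l / \<bar>l $ i\<bar>) * 3 ^ (?d - 2)))
       * (norm l ^ (?d - 1) / jap l ^ (?d + 4))"
    proof -
      have "norm l ^ (?d - 1) = norm l * norm l ^ (?d - 2)"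
      proof -
        have "?d - 1 = Suc (?d - 2)" using d by simp
        then show ?thesis by (simp only: power_Suc)
      qed
      then show ?thesis by (simp only: power_mult_distrib times_divide_eq_left times_divide_eq_right
        mult_ac)
    qed
    also have "\<dots> \<le> pi * 2 ^ (?d + 3) * (8 * (pi * (1 + 2 * real ?d) * 3 ^ (?d - 2))) * 1"
      using r by (intro mult_mono[OF _ pw] mult_left_mono mult_right_mono)
        (auto intro!: divide_nonneg_nonneg zero_le_power simp: jap_pos less_imp_le)
    finally show "?b * ?c3 \<le> ?C3" by (simp only: mult_1_right)
    have "?b * ?c4 = pi * 2 ^ (?d + 3) * (8 * 3 ^ ?d) * (norm l ^ ?d / jap l ^ (?d + 4))"
      by (simp only: power_mult_distrib times_divide_eq_left times_divide_eq_right mult_ac)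
    also have "\<dots> \<le> ?C4 * 1" by (intro mult_left_mono pw) auto
    finally show "?b * ?c4 \<le> ?C4" by (simp only: mult_1_right)
  qed auto
  finally show "(\<integral>\<^sup>+ k. (\<integral>\<^sup>+ t\<in>{\<tau>..T}. ennreal (echo_kernel_nc \<sigma> t \<tau> k l) \<partial>lborel) \<partial>nu L)
    \<le> ennreal (?C1 + real ?d * (?C2 + ?C3) + ?C4)" .
qed

lemma schur_minus_col:
  assumes d: "CARD('n::finite) \<ge> 2" and \<sigma>: "\<sigma> \<ge> real CARD('n) + 3" and L: "L \<ge> 1"
  shows "schur_minus L T (echo_kernel_col \<sigma> :: 'n kernel)
    \<le> ennreal ((8 * pi * (2 ^ (CARD('n) + 2) * 3) + pi * 2 ^ (CARD('n) + 3) * 24) * (1 + T)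
      * (L / L ^ CARD('n)))"
   (is "_ \<le> ennreal ((?C1 + ?C2) * (1 + T) * ?\<kappa>)")
  unfolding schur_minus_def
proof (intro SUP_least)
  let ?d = "CARD('n)"
  fix l :: "real^'n" and \<tau> assume l: "l \<in> lattice L" and "\<tau> \<in> {0..<T}"
  then have \<tau>: "0 \<le> \<tau>" "\<tau> \<le> T" by simp_all
  then have T: "0 \<le> T" by simp
  have \<kappa>: "?\<kappa> \<ge> 0" using L by simp
  obtain i where i: "norm l \<le> real ?d * \<bar>l $ i\<bar>" by (rule obtain_max_coordinate)
  have l0: "l \<noteq> 0" using lattice_nonzero[OF l] .
  then have li: "l $ i \<noteq> 0" and nl: "norm l > 0" using i by auto
  have J: "jap l \<ge> 1" "norm l \<le> jap l" by (rule jap_ge_1 jap_ge_norm)+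
  let ?W = "indicator {k. wedge l k = 0} :: real^'n \<Rightarrow> ennreal"
  let ?B = "indicator {k. norm k \<le> norm l} :: real^'n \<Rightarrow> ennreal"
  let ?X = "\<lambda>k. ennreal (1 / jap (k - l) ^ (?d + 1))"
  let ?S = "\<lambda>k. ennreal (sqrt (norm l / norm k))"
  let ?a = "8 * pi * (1 + T)"
  let ?b = "pi * 2 ^ (?d + 3) / jap l ^ (?d + 4)"
  let ?c1 = "2 ^ (?d + 2) * (3 * ?\<kappa>)"
  let ?c2 = "8 * (3 * norm l * ?\<kappa>)"
  have b0: "?b \<ge> 0" using jap_pos[of l] by simp
  have "(\<integral>\<^sup>+ k. (\<integral>\<^sup>+ t\<in>{\<tau>..T}. ennreal (echo_kernel_col \<sigma> t \<tau> k l) \<partial>lborel) \<partial>nu L)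
    \<le> (\<integral>\<^sup>+ k. ennreal ?a * (?W k * ?X k) + ennreal (?b * (1 + T)) * (?S k * ?W k * ?B k) \<partial>nu L)"
  proof (intro nn_integral_mono set_nn_integral_col_le)
    fix k assume "k \<in> space (nu L)" and w: "wedge k l = 0"
    then have k0: "k \<noteq> 0" by (simp add: lattice_nonzero)
    have w': "wedge l k = 0" using w wedge_commute_zero by blast
    have x: "norm l / (jap l)\<^sup>2 * (\<tau> / norm l) \<le> T"
    proof -
      have "norm l / (jap l)\<^sup>2 * (\<tau> / norm l) = \<tau> / (jap l)\<^sup>2" using nl by simp
      also have "\<dots> \<le> T / 1" using \<tau> J(1) by (intro frac_le) auto
      finally show ?thesis by simp
    qed
    \<comment> \<open>Again both indices are \<open>i\<close>, so every profile collapses to its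
      amplitude.\<close>
    have "(\<integral>\<^sup>+ t\<in>{\<tau>..T}. ennreal (echo_kernel \<sigma> t \<tau> k l) \<partial>lborel)
      \<le> ennreal (2 * pi) * ?X k + (ennreal (8 * pi * (norm l / (jap l)\<^sup>2))
        * (ennreal (\<tau> / norm l) * ?X k)
         + ennreal ?b * (?S k * ?B k + ?S k * ennreal \<tau> * ?B k))"
      using column_time_integral_le[OF d \<sigma> \<tau>(1) k0 l0, where i = i and j = i and T = T] by simp
    also have "\<dots> = ennreal (2 * pi + 8 * pi * (norm l / (jap l)\<^sup>2 * (\<tau> / norm l))) * ?X k
      + ennreal (?b * (1 + \<tau>)) * (?S k * ?B k)"
    proof -
      have 1: "ennreal (2 * pi + 8 * pi * (norm l / (jap l)\<^sup>2 * (\<tau> / norm l)))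
         = ennreal (2 * pi) + ennreal (8 * pi * (norm l / (jap l)\<^sup>2)) * ennreal (\<tau> / norm l)"
      proof -
        have "8 * pi * (norm l / (jap l)\<^sup>2 * (\<tau> / norm l)) = 8 * pi * (norm l / (jap l)\<^sup>2)
          * (\<tau> / norm l)"
          by (simp only: mult.assoc)
        moreover have "ennreal (8 * pi * (norm l / (jap l)\<^sup>2) * (\<tau> / norm l))
          = ennreal (8 * pi * (norm l / (jap l)\<^sup>2)) * ennreal (\<tau> / norm l)"
          by (rule ennreal_mult) (use \<tau> in auto)
        moreover have "ennreal (2 * pi + 8 * pi * (norm l / (jap l)\<^sup>2 * (\<tau> / norm l)))
          = ennreal (2 * pi) + ennreal (8 * pi * (norm l / (jap l)\<^sup>2 * (\<tau> / norm l)))"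
          by (rule ennreal_plus) (use \<tau> in auto)
        ultimately show ?thesis by simp
      qed
      have 2: "ennreal (?b * (1 + \<tau>)) = ennreal ?b * (1 + ennreal \<tau>)"
        using \<tau> by (subst ennreal_mult[OF b0]) auto
      show ?thesis unfolding 1 2 by
        (simp only: distrib_left distrib_right mult_ac add_ac mult_1_right mult_1_left)
    qed
    also have "\<dots> \<le> ennreal ?a * ?X k + ennreal (?b * (1 + T)) * (?S k * ?B k)"
    proof (intro add_mono mult_right_mono ennreal_leI)
      have "8 * pi * (norm l / (jap l)\<^sup>2 * (\<tau> / norm l)) \<le> 8 * pi * T" using x
        by (intro mult_left_mono) auto
      then show "2 * pi + 8 * pi * (norm l / (jap l)\<^sup>2 * (\<tau> / norm l)) \<le> ?a"
        using pi_gt_zero by (simp only: distrib_left mult_1_right)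
      show "?b * (1 + \<tau>) \<le> ?b * (1 + T)" using \<tau> b0 by (intro mult_left_mono) auto
    qed auto
    finally show "(\<integral>\<^sup>+ t\<in>{\<tau>..T}. ennreal (echo_kernel \<sigma> t \<tau> k l) \<partial>lborel)
      \<le> ennreal ?a * (?W k * ?X k) + ennreal (?b * (1 + T)) * (?S k * ?W k * ?B k)"
      using w' by simp
  qed
  also have "\<dots> = ennreal ?a * (\<integral>\<^sup>+ k. ?W k * ?X k \<partial>nu L) + ennreal (?b * (1 + T))
    * (\<integral>\<^sup>+ k. ?S k * ?W k * ?B k \<partial>nu L)"
    by (simp add: nn_integral_add nn_integral_cmult)
  also have "\<dots> \<le> ennreal ?a * ennreal ?c1 + ennreal (?b * (1 + T)) * ennreal ?c2"
    using L nl li by (intro add_mono mult_left_mono nn_integral_nu_collinear_jap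
      nn_integral_nu_collinear_singular) auto
  also have "\<dots> = ennreal (?a * ?c1 + ?b * (1 + T) * ?c2)"
  proof -
    have 1: "ennreal ?a * ennreal ?c1 = ennreal (?a * ?c1)" using T L
      by (intro ennreal_mult[symmetric]) auto
    have 2: "ennreal (?b * (1 + T)) * ennreal ?c2 = ennreal (?b * (1 + T) * ?c2)"
      using T L b0 by (intro ennreal_mult[symmetric] mult_nonneg_nonneg) auto
    have n1: "0 \<le> ?a * ?c1" using T L by (intro mult_nonneg_nonneg) auto
    have n2: "0 \<le> ?b * (1 + T) * ?c2" using T L b0 by (intro mult_nonneg_nonneg) auto
    show ?thesis unfolding 1 2 ennreal_plus[OF n1 n2] ..
  qed
  also have "\<dots> \<le> ennreal ((?C1 + ?C2) * (1 + T) * ?\<kappa>)"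
  proof (rule ennreal_leI)
    have "norm l / jap l ^ (?d + 4) \<le> 1"
    proof -
      have "norm l \<le> jap l ^ (?d + 4)" using J self_le_power[of "jap l" "?d + 4"] by linarith
      then show ?thesis using jap_pos[of l] by (simp add: divide_le_eq)
    qed
    then have "?C2 * (1 + T) * ?\<kappa> * (norm l / jap l ^ (?d + 4)) \<le> ?C2 * (1 + T) * ?\<kappa> * 1"
      using T \<kappa> by (intro mult_left_mono mult_nonneg_nonneg) auto
    moreover have "?b * (1 + T) * ?c2 = ?C2 * (1 + T) * ?\<kappa> * (norm l / jap l ^ (?d + 4))" by
      (simp add: mult_ac)
    moreover have "?a * ?c1 = ?C1 * (1 + T) * ?\<kappa>" by (simp only: mult_ac)
    ultimately show "?a * ?c1 + ?b * (1 + T) * ?c2 \<le> (?C1 + ?C2) * (1 + T) * ?\<kappa>"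
      by (simp only: distrib_right mult_1_right)
  qed
  finally show "(\<integral>\<^sup>+ k. (\<integral>\<^sup>+ t\<in>{\<tau>..T}. ennreal (echo_kernel_col \<sigma> t \<tau> k l) \<partial>lborel) \<partial>nu L)
    \<le> ennreal ((?C1 + ?C2) * (1 + T) * ?\<kappa>)" .
qed

section \<open>The Schur test for the Volterra operator\<close>

lemma countable_lattice: "countable (lattice L :: (real^'n) set)"
proof -
  have "lattice L \<subseteq> range (\<lambda>f :: 'n \<Rightarrow> int. (\<chi> i. of_int (f i) / L) :: real^'n)"
  proof
    fix z :: "real^'n" assume "z \<in> lattice L"
    then have "\<forall>i. \<exists>m::int. z $ i = of_int m / L" by (simp add: lattice_def)
    then obtain f :: "'n \<Rightarrow> int" where "\<forall>i. z $ i = of_int (f i) / L" by metis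
    then show "z \<in> range (\<lambda>f :: 'n \<Rightarrow> int. (\<chi> i. of_int (f i) / L) :: real^'n)"
      by (auto simp: vec_eq_iff image_iff)
  qed
  then show ?thesis by (rule countable_subset) simp
qed

lemma sigma_finite_nu:
  assumes L: "L > 0"
  shows "sigma_finite_measure (nu L :: (real^'n) measure)"
proof
  let ?A = "(\<lambda>a. {a}) ` (lattice L :: (real^'n) set)"
  have "emeasure (nu L) {a} \<noteq> \<infinity>" if "a \<in> lattice L" for a :: "real^'n"
  proof -
    have "emeasure (nu L) {a} = (\<integral>\<^sup>+z. ennreal 1 * indicator {a} z \<partial>nu L)"
      using that by (simp add: nu_def)
    also have "\<dots> < \<infinity>" using nn_integral_nu_finite[OF L, of "{a}" "\<lambda>_. 1"] that by simp
    finally show ?thesis by simp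
  qed
  then show "\<exists>A. countable A \<and> A \<subseteq> sets (nu L :: (real^'n) measure) \<and> \<Union> A = space (nu L)
    \<and> (\<forall>a\<in>A. emeasure (nu L) a \<noteq> \<infinity>)" 
    using countable_lattice[of L] by (intro exI[of _ ?A]) (auto simp: nu_def)
qed

lemma sets_nu: "sets (nu L) = sets (count_space (lattice L))"
  by (simp add: nu_def)

lemma sigma_finite_time: "sigma_finite_measure (restrict_space lborel {0..T::real})"
  by (rule sigma_finite_measure_restrict_space) (auto intro: sigma_finite_lborel)

lemma pair_sigma_finite_Y:
  "L > 0 \<Longrightarrow> pair_sigma_finite (restrict_space lborel {0..T::real}) (nu L :: (real^'n) measure)"
  by (simp add: pair_sigma_finite_def sigma_finite_time sigma_finite_nu)

lemma sigma_finite_Y: "L > 0 \<Longrightarrow> sigma_finite_measure (Y_measure L T :: (real \<times> (real^'n)) measure)"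
  unfolding Y_measure_def by (intro sigma_finite_pair_measure sigma_finite_time sigma_finite_nu)

lemma space_Y [simp]: "space (Y_measure L T) = {0..T} \<times> lattice L"
  by (simp add: Y_measure_def space_pair_measure space_restrict_space)

lemma measurable_fst_Y [measurable]: "fst \<in> borel_measurable (Y_measure L T)"
  unfolding Y_measure_def
  by (rule measurable_compose[OF measurable_fst]) (auto intro: measurable_restrict_space1)

lemma measurable_snd_Y [measurable]: "snd \<in> borel_measurable (Y_measure L T)"
  unfolding Y_measure_def
  by (rule measurable_compose[OF measurable_snd]) simp

lemma nn_integral_Y:
  fixes f :: "real \<times> (real^'n) \<Rightarrow> ennreal"
  assumes L: "L > 0" and f: "f \<in> borel_measurable (Y_measure L T)"
  shows "(\<integral>\<^sup>+p. f p \<partial>Y_measure L T) = (\<integral>\<^sup>+k. (\<integral>\<^sup>+t\<in>{0..T}. f (t, k) \<partial>lborel) \<partial>nu L)"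
proof -
  interpret pair_sigma_finite "restrict_space lborel {0..T}" "nu L :: (real^'n) measure"
    by (rule pair_sigma_finite_Y[OF L])
  show ?thesis
    using nn_integral_snd[OF f[unfolded Y_measure_def]] unfolding Y_measure_def
    by (simp add: nn_integral_restrict_space)
qed

text \<open>Cauchy-Schwarz with the kernel split into two square roots uses the row bound; after
  Tonelli the column bound remains. Almost everywhere bounds are assumed because the Schur suprema
  leave out t = 0 and \<tau> = T.\<close>

lemma schur_test:
  fixes M :: "'a measure" and K :: "'a \<Rightarrow> 'a \<Rightarrow> real" and f :: "'a \<Rightarrow> ennreal"
  assumes "sigma_finite_measure M"
    and K[measurable]: "case_prod K \<in> borel_measurable (M \<Otimes>\<^sub>M M)" and K0: "\<And>x y. K x y \<ge> 0"
    and f[measurable]: "f \<in> borel_measurable M"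
    and row: "AE x in M. (\<integral>\<^sup>+y. ennreal (K x y) \<partial>M) \<le> R"
    and col: "AE y in M. (\<integral>\<^sup>+x. ennreal (K x y) \<partial>M) \<le> R"
  shows "(\<integral>\<^sup>+x. (\<integral>\<^sup>+y. ennreal (K x y) * f y \<partial>M)\<^sup>2 \<partial>M) \<le> R\<^sup>2 * (\<integral>\<^sup>+y. (f y)\<^sup>2 \<partial>M)"
proof -
  interpret sigma_finite_measure M by fact
  interpret pair_sigma_finite M M by unfold_locales
  have sq: "ennreal (sqrt (K x y)) * ennreal (sqrt (K x y)) = ennreal (K x y)" for x y
    using K0 by (simp flip: ennreal_mult)
  have "(\<integral>\<^sup>+x. (\<integral>\<^sup>+y. ennreal (K x y) * f y \<partial>M)\<^sup>2 \<partial>M)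
    \<le> (\<integral>\<^sup>+x. R * (\<integral>\<^sup>+y. ennreal (K x y) * (f y)\<^sup>2 \<partial>M) \<partial>M)"
  proof (rule nn_integral_mono_AE)
    show "AE x in M. (\<integral>\<^sup>+y. ennreal (K x y) * f y \<partial>M)\<^sup>2 \<le> R * (\<integral>\<^sup>+y. ennreal (K x y) * (f y)\<^sup>2 \<partial>M)"
      using row AE_space
    proof eventually_elim
      fix x assume R: "(\<integral>\<^sup>+y. ennreal (K x y) \<partial>M) \<le> R" and [measurable]: "x \<in> space M"
      have [measurable]: "K x \<in> borel_measurable M"
        using measurable_compose_Pair1[OF \<open>x \<in> space M\<close> K] by simp
      have "(\<integral>\<^sup>+y. ennreal (K x y) * f y \<partial>M)\<^sup>2
        = (\<integral>\<^sup>+y. ennreal (sqrt (K x y)) * (ennreal (sqrt (K x y)) * f y) \<partial>M)\<^sup>2"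
        by (simp add: mult.assoc[symmetric] sq)
      also have "\<dots> \<le> (\<integral>\<^sup>+y. (ennreal (sqrt (K x y)))\<^sup>2 \<partial>M)
        * (\<integral>\<^sup>+y. (ennreal (sqrt (K x y)) * f y)\<^sup>2 \<partial>M)"
        by (rule Cauchy_Schwarz_nn_integral) measurable
      also have "\<dots> = (\<integral>\<^sup>+y. ennreal (K x y) \<partial>M) * (\<integral>\<^sup>+y. ennreal (K x y) * (f y)\<^sup>2 \<partial>M)"
        by (simp add: power_mult_distrib power2_eq_square[of "ennreal (sqrt _)"] sq)
      also have "\<dots> \<le> R * (\<integral>\<^sup>+y. ennreal (K x y) * (f y)\<^sup>2 \<partial>M)"
        by (intro mult_right_mono R) simp
      finally show "(\<integral>\<^sup>+y. ennreal (K x y) * f y \<partial>M)\<^sup>2 \<le> R * (\<integral>\<^sup>+y. ennreal (K x y) * (f y)\<^sup>2 \<partial>M)" .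
    qed
  qed
  also have "\<dots> = R * (\<integral>\<^sup>+x. \<integral>\<^sup>+y. ennreal (K x y) * (f y)\<^sup>2 \<partial>M \<partial>M)"
    by (rule nn_integral_cmult) measurable
  also have "(\<integral>\<^sup>+x. \<integral>\<^sup>+y. ennreal (K x y) * (f y)\<^sup>2 \<partial>M \<partial>M)
    = (\<integral>\<^sup>+y. \<integral>\<^sup>+x. ennreal (K x y) * (f y)\<^sup>2 \<partial>M \<partial>M)"
    by (rule Fubini'[symmetric]) measurable
  also have "\<dots> = (\<integral>\<^sup>+y. (\<integral>\<^sup>+x. ennreal (K x y) \<partial>M) * (f y)\<^sup>2 \<partial>M)"
  proof (rule nn_integral_cong)
    fix y assume y: "y \<in> space M"
    have [measurable]: "(\<lambda>x. K x y) \<in> borel_measurable M"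
      using measurable_Pair1[OF K y] by simp
    show "(\<integral>\<^sup>+x. ennreal (K x y) * (f y)\<^sup>2 \<partial>M) = (\<integral>\<^sup>+x. ennreal (K x y) \<partial>M) * (f y)\<^sup>2"
      by (rule nn_integral_multc) measurable
  qed
  also have "\<dots> \<le> (\<integral>\<^sup>+y. R * (f y)\<^sup>2 \<partial>M)"
    by (rule nn_integral_mono_AE) (use col in \<open>eventually_elim, auto intro: mult_right_mono\<close>)
  also have "\<dots> = R * (\<integral>\<^sup>+y. (f y)\<^sup>2 \<partial>M)"
    by (rule nn_integral_cmult) measurable
  finally show ?thesis by (simp add: power2_eq_square mult.assoc mult_left_mono)
qed

text \<open>A member of the space is measurable only over the restricted time interval. Extension by
  zero gives joint measurability over the whole time line, as required for integrals depending on a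
  parameter. As the lattice is countable, it suffices to look at each section.\<close>

lemma Y_space_section:
  fixes F :: "real \<times> (real^'n) \<Rightarrow> complex"
  assumes F: "F \<in> borel_measurable (Y_measure L T)"
  shows "(\<lambda>(l, \<tau>). indicator {0..T} \<tau> *\<^sub>R F (\<tau>, l)) \<in> borel_measurable (nu L \<Otimes>\<^sub>M lborel)"
proof -
  have "(\<lambda>(l, \<tau>). indicator {0..T} \<tau> *\<^sub>R F (\<tau>, l))
    \<in> borel_measurable (count_space (lattice L) \<Otimes>\<^sub>M lborel)"
  proof (rule measurable_pair_measure_countable1)
    show "countable (lattice L :: (real^'n) set)" by (rule countable_lattice)
    fix l :: "real^'n" assume l: "l \<in> lattice L"
    have "(\<lambda>\<tau>. F (\<tau>, l)) \<in> borel_measurable (restrict_space lborel {0..T})"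
      using measurable_Pair1[OF F[unfolded Y_measure_def], of l] l by simp
    then show "(\<lambda>\<tau>. case (l, \<tau>) of (l, \<tau>) \<Rightarrow> indicator {0..T} \<tau> *\<^sub>R F (\<tau>, l))
      \<in> borel_measurable lborel"
      by (simp add: borel_measurable_restrict_space_iff)
  qed
  also have "borel_measurable (count_space (lattice L) \<Otimes>\<^sub>M lborel)
    = borel_measurable (nu L \<Otimes>\<^sub>M (lborel :: real measure))"
    by (intro measurable_cong_sets sets_pair_measure_cong) (simp_all add: sets_nu)
  finally show ?thesis .
qed

text \<open>Every lattice point has positive mass, so finiteness almost everywhere is finiteness
  everywhere. This matters because \<open>volterra_converges\<close> demands convergence of the time
  integral for each l.\<close>

lemma nn_integral_section_nu_finite:
  assumes L: "L > 0" and fin: "(\<integral>\<^sup>+l. f l \<partial>nu L) < \<infinity>" and l: "l \<in> lattice L"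
  shows "f l < \<infinity>"
proof -
  have "AE l in nu L. f l \<noteq> \<infinity>" using fin by (intro nn_integral_noteq_infinite) auto
  then have "\<forall>l\<in>lattice L. f l \<noteq> \<infinity>"
    using L unfolding nu_def by (subst (asm) AE_density) (auto simp: AE_count_space)
  then show ?thesis using l by (simp add: less_top)
qed

text \<open>Integrability is not assumed: without it the integral on the left has the default value
  0.\<close>

lemma norm_integral_le_nn_integral:
  fixes f :: "'a \<Rightarrow> 'b::{banach, second_countable_topology}"
  shows "ennreal (norm (integral\<^sup>L M f)) \<le> (\<integral>\<^sup>+x. ennreal (norm (f x)) \<partial>M)"
  by (cases "integrable M f") (auto simp: integral_norm_bound_ennreal not_integrable_integral_eq)

text \<open>Everything is read off from one majorant, the operator applied to |F|. The Schur test
  bounds it in the square mean; hence it is finite almost everywhere, which yields convergence, and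
  it dominates the image pointwise, which yields the norm bound. Only measurability of the image
  needs a separate argument.\<close>

lemma volterra_norm_le:
  fixes K :: "'n::finite kernel"
  assumes L: "L > 0" and R: "R \<ge> 0" and K0: "\<And>t \<tau> k l. K t \<tau> k l \<ge> 0"
    and Km: "(\<lambda>p. K (fst (fst p)) (fst (snd p)) (snd (fst p)) (snd (snd p)))
      \<in> borel_measurable (borel \<Otimes>\<^sub>M borel)"
    and plus: "schur_plus L T K \<le> ennreal R" and minus: "schur_minus L T K \<le> ennreal R"
  shows "volterra_norm L T K \<le> ennreal R"
proof -
  let ?Y = "Y_measure L T :: (real \<times> (real^'n)) measure"
  let ?N = "nu L :: (real^'n) measure"
  interpret Y: sigma_finite_measure ?Y by (rule sigma_finite_Y[OF L])
  interpret N: sigma_finite_measure ?N by (rule sigma_finite_nu[OF L])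
  interpret P: pair_sigma_finite "restrict_space lborel {0..T}" ?N
    by (rule pair_sigma_finite_Y[OF L])
  have Kc: "(\<lambda>x. K (a x) (b x) (c x) (e x)) \<in> borel_measurable M"
    if [measurable]: "a \<in> borel_measurable M" "b \<in> borel_measurable M" "c \<in> borel_measurable M"
      "e \<in> borel_measurable M"
    for a b c e and M :: "'z measure"
  proof -
    have "(\<lambda>x. ((a x, c x), (b x, e x))) \<in> M \<rightarrow>\<^sub>M borel \<Otimes>\<^sub>M borel" by measurable
    from measurable_compose[OF this Km] show ?thesis by simp
  qed
  \<comment> \<open>The kernel on the product of two copies of the space, with causality built in by
    zero values, so that the Schur test for general measure spaces applies.\<close>
  define \<kappa> where "\<kappa> x y = (if 0 \<le> fst y \<and> fst y \<le> fst x then K (fst x) (fst y) (snd x) (snd y)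
    else 0)"
    for x y :: "real \<times> (real^'n)"
  have \<kappa>0: "\<kappa> x y \<ge> 0" for x y using K0 by (simp add: \<kappa>_def)
  have \<kappa>m: "case_prod \<kappa> \<in> borel_measurable (?Y \<Otimes>\<^sub>M ?Y)"
  proof -
    have "(\<lambda>p. K (fst (fst p)) (fst (snd p)) (snd (fst p)) (snd (snd p)))
      \<in> borel_measurable (?Y \<Otimes>\<^sub>M ?Y)"
    proof -
      have [measurable]: "(\<lambda>x. x) \<in> ?Y \<rightarrow>\<^sub>M borel"
      proof -
        have "(\<lambda>x. (fst x, snd x)) \<in> ?Y \<rightarrow>\<^sub>M borel \<Otimes>\<^sub>M borel" by measurable
        then show ?thesis by (simp add: borel_prod)
      qed
      have "(\<lambda>p. (fst p, snd p)) \<in> ?Y \<Otimes>\<^sub>M ?Y \<rightarrow>\<^sub>M borel \<Otimes>\<^sub>M borel"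
        by (intro measurable_Pair measurable_compose[OF measurable_fst]
          measurable_compose[OF measurable_snd]) measurable
      from measurable_compose[OF this Km] show ?thesis by simp
    qed
    note [measurable] = this
    have "(\<lambda>p. if 0 \<le> fst (snd p) \<and> fst (snd p)
      \<le> fst (fst p) then K (fst (fst p)) (fst (snd p)) (snd (fst p)) (snd (snd p)) else 0)
       \<in> borel_measurable (?Y \<Otimes>\<^sub>M ?Y)"
      by measurable
    then show ?thesis by (simp add: \<kappa>_def case_prod_beta')
  qed
  have \<kappa>1[measurable]: "(\<lambda>y. \<kappa> x y) \<in> borel_measurable ?Y" if "x \<in> space ?Y" for x
    using measurable_Pair2[OF \<kappa>m that] by simp
  have \<kappa>2[measurable]: "(\<lambda>x. \<kappa> x y) \<in> borel_measurable ?Y" if "y \<in> space ?Y" for y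
    using measurable_Pair1[OF \<kappa>m that] by simp
  \<comment> \<open>Removes the null sets at t = 0 and at \<tau> = T, for which the suprema give no
    information.\<close>
  have ne0: "AE x in ?Y. fst x \<noteq> c" for c
  proof -
    have "AE t in restrict_space lborel {0..T}. t \<noteq> c"
      by (subst AE_restrict_space_iff) (auto intro: AE_mp[OF AE_lborel_singleton[of c]])
    then have ae: "AE t in restrict_space lborel {0..T}. AE k in ?N. fst (t, k) \<noteq> c"
      by eventually_elim simp
    have "{x \<in> space ?Y. fst x \<noteq> c} \<in> sets ?Y" by measurable
    from P.AE_pair_measure[OF this[unfolded Y_measure_def] ae] show ?thesis
      unfolding Y_measure_def .
  qed
  have row: "AE x in ?Y. (\<integral>\<^sup>+y. ennreal (\<kappa> x y) \<partial>?Y) \<le> ennreal R"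
    using ne0[of 0] AE_space
  proof eventually_elim
    fix x assume "fst x \<noteq> 0" and x: "x \<in> space ?Y"
    then obtain t k where xtk: "x = (t, k)" and t: "0 < t" "t \<le> T" and k: "k \<in> lattice L"
      by (cases x) auto
    have "(\<integral>\<^sup>+y. ennreal (\<kappa> x y) \<partial>?Y) = (\<integral>\<^sup>+l. (\<integral>\<^sup>+\<tau>\<in>{0..T}. ennreal (\<kappa> x (\<tau>, l)) \<partial>lborel) \<partial>?N)"
      using x by (intro nn_integral_Y L) measurable
    also have "\<dots> = (\<integral>\<^sup>+l. (\<integral>\<^sup>+\<tau>\<in>{0..t}. ennreal (K t \<tau> k l) \<partial>lborel) \<partial>?N)"
      using t by (intro nn_integral_cong) (auto simp: \<kappa>_def xtk indicator_def)
    also have "\<dots> \<le> schur_plus L T K"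
      unfolding schur_plus_def using t k by (intro SUP_upper2[OF k] SUP_upper2[of t]) auto
    finally show "(\<integral>\<^sup>+y. ennreal (\<kappa> x y) \<partial>?Y) \<le> ennreal R" using plus by (rule order_trans)
  qed
  have col: "AE y in ?Y. (\<integral>\<^sup>+x. ennreal (\<kappa> x y) \<partial>?Y) \<le> ennreal R"
    using ne0[of T] AE_space
  proof eventually_elim
    fix y assume "fst y \<noteq> T" and y: "y \<in> space ?Y"
    then obtain \<tau> l where ytl: "y = (\<tau>, l)" and \<tau>: "0 \<le> \<tau>" "\<tau> < T" and l: "l \<in> lattice L"
      by (cases y) auto
    have "(\<integral>\<^sup>+x. ennreal (\<kappa> x y) \<partial>?Y) = (\<integral>\<^sup>+k. (\<integral>\<^sup>+t\<in>{0..T}. ennreal (\<kappa> (t, k) y) \<partial>lborel) \<partial>?N)"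
      using y by (intro nn_integral_Y L) measurable
    also have "\<dots> = (\<integral>\<^sup>+k. (\<integral>\<^sup>+t\<in>{\<tau>..T}. ennreal (K t \<tau> k l) \<partial>lborel) \<partial>?N)"
      using \<tau> by (intro nn_integral_cong) (auto simp: \<kappa>_def ytl indicator_def)
    also have "\<dots> \<le> schur_minus L T K"
      unfolding schur_minus_def using \<tau> l by (intro SUP_upper2[OF l] SUP_upper2[of \<tau>]) auto
    finally show "(\<integral>\<^sup>+x. ennreal (\<kappa> x y) \<partial>?Y) \<le> ennreal R" using minus by (rule order_trans)
  qed
  have main: "(AE p in ?Y. volterra_converges L K F p) \<and> volterra L K F \<in> Y_space L T \<and>
        Y_norm L T (volterra L K F) \<le> R * Y_norm L T F" if F: "F \<in> Y_space L T" for F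
  proof -
    have Fm[measurable]: "F \<in> borel_measurable ?Y" and Fi: "integrable ?Y (\<lambda>p. (norm (F p))\<^sup>2)"
      using F by (auto simp: Y_space_def)
    define G where "G t k l \<tau> = indicator {0..t} \<tau> *\<^sub>R (of_real (K t \<tau> k l) * F (\<tau>, l))" for t k l \<tau>
    have G_eta: "G t k l = (\<lambda>\<tau>. indicator {0..t} \<tau> *\<^sub>R (of_real (K t \<tau> k l) * F (\<tau>, l)))" for t k l
      by (simp add: G_def fun_eq_iff)
    \<comment> \<open>The extension of F by zero, with the variables interchanged; it replaces F
      wherever measurability over all times is needed.\<close>
    define S where "S = (\<lambda>(l, \<tau>). indicator {0..T} \<tau> *\<^sub>R F (\<tau>, l))"
    have Sm: "S \<in> borel_measurable (?N \<Otimes>\<^sub>M lborel)" unfolding S_def by (rule Y_space_section[OF Fm])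
    have GS: "G t k l \<tau> = (if 0 \<le> \<tau> \<and> \<tau> \<le> t then of_real (K t \<tau> k l) * S (l, \<tau>) else 0)" if "t \<le> T"
      for t k l \<tau>
      using that by (auto simp: G_def S_def indicator_def)
    have S1: "(\<lambda>\<tau>. S (l, \<tau>)) \<in> borel_measurable lborel" if "l \<in> lattice L" for l
      using measurable_Pair2[OF Sm, of l] that by simp
    have Gm: "G t k l \<in> borel_measurable lborel" if "t \<le> T" "l \<in> lattice L" for t k l
    proof -
      have [measurable]: "(\<lambda>\<tau>. K t \<tau> k l) \<in> borel_measurable lborel" by (rule Kc) auto
      note [measurable] = S1[OF that(2)]
      have "(\<lambda>\<tau>. if 0 \<le> \<tau> \<and> \<tau> \<le> t then of_real (K t \<tau> k l) * S (l, \<tau>) else 0)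
        \<in> borel_measurable lborel" by measurable
      then show ?thesis using GS[OF that(1)] by (simp add: fun_eq_iff cong: measurable_cong)
    qed
    \<comment> \<open>The majorant: the image of |F| as an extended nonnegative function, meaningful
      before any convergence is known.\<close>
    define H where "H x = (\<integral>\<^sup>+y. ennreal (\<kappa> x y) * ennreal (norm (F y)) \<partial>?Y)" for x
    have H: "H (t, k) = (\<integral>\<^sup>+l. (\<integral>\<^sup>+\<tau>. ennreal (norm (G t k l \<tau>)) \<partial>lborel) \<partial>?N)" if tk:
      "(t, k) \<in> space ?Y" for t k
    proof -
      have "H (t, k) = (\<integral>\<^sup>+l. (\<integral>\<^sup>+\<tau>\<in>{0..T}. ennreal (\<kappa> (t, k) (\<tau>, l))
        * ennreal (norm (F (\<tau>, l))) \<partial>lborel) \<partial>?N)"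
        unfolding H_def using tk by (intro nn_integral_Y L) measurable
      also have "\<dots> = (\<integral>\<^sup>+l. (\<integral>\<^sup>+\<tau>. ennreal (norm (G t k l \<tau>)) \<partial>lborel) \<partial>?N)"
        using tk K0 by (intro nn_integral_cong)
          (auto simp: \<kappa>_def G_def indicator_def norm_mult ennreal_mult)
      finally show ?thesis .
    qed
    have V: "volterra L K F (t, k) = (\<integral>l. (\<integral>\<tau>. G t k l \<tau> \<partial>lborel) \<partial>?N)" for t k
      by (simp add: volterra_def set_lebesgue_integral_def G_def)
    have VH: "ennreal (norm (volterra L K F x)) \<le> H x" if x: "x \<in> space ?Y" for x
    proof -
      obtain t k where tk: "x = (t, k)" by (cases x)
      have "ennreal (norm (volterra L K F x)) \<le> (\<integral>\<^sup>+l. ennreal (norm (\<integral>\<tau>. G t k l \<tau> \<partial>lborel)) \<partial>?N)"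
        unfolding tk V by (rule norm_integral_le_nn_integral)
      also have "\<dots> \<le> (\<integral>\<^sup>+l. (\<integral>\<^sup>+\<tau>. ennreal (norm (G t k l \<tau>)) \<partial>lborel) \<partial>?N)"
        by (intro nn_integral_mono norm_integral_le_nn_integral)
      also have "\<dots> = H x" using H x by (simp add: tk)
      finally show ?thesis .
    qed
    have conv: "volterra_converges L K F x" if x: "x \<in> space ?Y" and fin: "H x < \<infinity>" for x
    proof -
      obtain t k where tk: "x = (t, k)" by (cases x)
      have tT: "t \<le> T" using x tk by simp
      have fin': "(\<integral>\<^sup>+l. (\<integral>\<^sup>+\<tau>. ennreal (norm (G t k l \<tau>)) \<partial>lborel) \<partial>?N) < \<infinity>"
        using fin H x by (simp add: tk)
      have "integrable lborel (G t k l)" if "l \<in> lattice L" for l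
        by (rule integrableI_bounded[OF Gm[OF tT that] nn_integral_section_nu_finite[OF L fin'
          that]])
      moreover have "integrable ?N (\<lambda>l. \<integral>\<tau>. G t k l \<tau> \<partial>lborel)"
      proof (rule integrableI_bounded)
        have "(\<integral>\<^sup>+l. ennreal (norm (\<integral>\<tau>. G t k l \<tau> \<partial>lborel)) \<partial>?N)
          \<le> (\<integral>\<^sup>+l. (\<integral>\<^sup>+\<tau>. ennreal (norm (G t k l \<tau>)) \<partial>lborel) \<partial>?N)"
          by (intro nn_integral_mono norm_integral_le_nn_integral)
        also note fin'
        finally show "(\<integral>\<^sup>+l. ennreal (norm (\<integral>\<tau>. G t k l \<tau> \<partial>lborel)) \<partial>?N) < \<infinity>" .
      qed (simp add: nu_def)
      ultimately show ?thesis
        by (simp add: volterra_converges_def tk set_integrable_def set_lebesgue_integral_def G_eta)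
    qed
    have Hm[measurable]: "H \<in> borel_measurable ?Y"
      unfolding H_def by (rule Y.borel_measurable_nn_integral) (use \<kappa>m in measurable)
    have Vm[measurable]: "volterra L K F \<in> borel_measurable ?Y"
    proof -
      \<comment> \<open>Measurability of an iterated integral with a parameter needs an integrand on
        the full product space. Hence the integrand is written through \<open>S\<close>, with
        causality as a condition instead of a varying domain.\<close>
      have gm: "(\<lambda>x. \<integral>l. (\<integral>\<tau>. (if 0 \<le> \<tau> \<and> \<tau> \<le> fst x then of_real (K (fst x) \<tau> (snd x) l) * S (l, \<tau>)
        else 0) \<partial>lborel) \<partial>?N) \<in> borel_measurable ?Y"
      proof (rule N.borel_measurable_lebesgue_integral)
        have "(\<lambda>z. \<integral>\<tau>. (if 0 \<le> \<tau> \<and> \<tau>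
          \<le> fst (fst z) then of_real (K (fst (fst z)) \<tau> (snd (fst z)) (snd z)) * S (snd z, \<tau>)
            else 0) \<partial>lborel)
          \<in> borel_measurable (?Y \<Otimes>\<^sub>M ?N)"
        proof (rule lborel.borel_measurable_lebesgue_integral)
          let ?P = "(?Y \<Otimes>\<^sub>M ?N) \<Otimes>\<^sub>M (lborel :: real measure)"
          have m1[measurable]: "(\<lambda>p. fst (fst (fst p))) \<in> borel_measurable ?P"
            by (intro measurable_compose[OF measurable_fst] measurable_fst_Y)
          have m2[measurable]: "(\<lambda>p. snd (fst (fst p))) \<in> borel_measurable ?P"
            by (intro measurable_compose[OF measurable_fst] measurable_snd_Y)
          have m3[measurable]: "(\<lambda>p. snd (fst p)) \<in> borel_measurable ?P"
            by (rule measurable_compose[OF measurable_fst], rule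
              measurable_compose[OF measurable_snd]) simp
          have m4[measurable]: "(\<lambda>p. snd p) \<in> borel_measurable ?P"
            using measurable_snd[of "?Y \<Otimes>\<^sub>M ?N" "lborel :: real measure"] by simp
          have m5[measurable]: "(\<lambda>p. K (fst (fst (fst p))) (snd p) (snd (fst (fst p)))
            (snd (fst p))) \<in> borel_measurable ?P"
            by (rule Kc) (rule m1 m2 m3 m4)+
          have m6[measurable]: "(\<lambda>p. S (snd (fst p), snd p)) \<in> borel_measurable ?P"
            by (rule measurable_compose[OF _ Sm]) measurable
          have "(\<lambda>p. if 0 \<le> snd p \<and> snd p
            \<le> fst (fst (fst p)) then of_real (K (fst (fst (fst p))) (snd p) (snd (fst (fst p)))
              (snd (fst p))) * S (snd (fst p), snd p) else 0) \<in> borel_measurable ?P"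
            by measurable
          then show "(\<lambda>(z, \<tau>). if 0 \<le> \<tau> \<and> \<tau>
            \<le> fst (fst z) then of_real (K (fst (fst z)) \<tau> (snd (fst z)) (snd z)) * S (snd z, \<tau>)
              else 0) \<in> borel_measurable ?P"
            by (simp add: case_prod_beta')
        qed
        then show "(\<lambda>(x, l). \<integral>\<tau>. (if 0 \<le> \<tau> \<and> \<tau> \<le> fst x then of_real (K (fst x) \<tau> (snd x) l)
          * S (l, \<tau>) else 0) \<partial>lborel)
          \<in> borel_measurable (?Y \<Otimes>\<^sub>M ?N)"
          by (simp add: case_prod_beta')
      qed
      have eq: "volterra L K F x
        = (\<integral>l. (\<integral>\<tau>. (if 0 \<le> \<tau> \<and> \<tau> \<le> fst x then of_real (K (fst x) \<tau> (snd x) l) * S (l, \<tau>)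
          else 0) \<partial>lborel) \<partial>?N)"
        if "x \<in> space ?Y" for x
      proof -
        obtain t k where xtk: "x = (t, k)" by (cases x)
        then have tT: "t \<le> T" using that by simp
        show ?thesis unfolding xtk by (simp only: V fst_conv snd_conv GS[OF tT])
      qed
      show ?thesis using gm by (subst measurable_cong[OF eq])
    qed
    have "(\<integral>\<^sup>+x. (H x)\<^sup>2 \<partial>?Y) \<le> (ennreal R)\<^sup>2 * (\<integral>\<^sup>+y. (ennreal (norm (F y)))\<^sup>2 \<partial>?Y)"
      unfolding H_def by (rule schur_test[OF Y.sigma_finite_measure_axioms \<kappa>m \<kappa>0 _ row col])
        measurable
    also have "(\<integral>\<^sup>+y. (ennreal (norm (F y)))\<^sup>2 \<partial>?Y) = ennreal (\<integral>p. (norm (F p))\<^sup>2 \<partial>?Y)"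
      using nn_integral_eq_integral[OF Fi] by (simp add: ennreal_power)
    also have "(ennreal R)\<^sup>2 * \<dots> = ennreal (R\<^sup>2 * (\<integral>p. (norm (F p))\<^sup>2 \<partial>?Y))"
      using R by (simp add: ennreal_power ennreal_mult)
    finally have bound: "(\<integral>\<^sup>+x. (H x)\<^sup>2 \<partial>?Y) \<le> ennreal (R\<^sup>2 * (\<integral>p. (norm (F p))\<^sup>2 \<partial>?Y))" .
    \<comment> \<open>A finite integral of the square makes \<open>H\<close> finite almost
      everywhere, which is all that \<open>conv\<close> asks for.\<close>
    have "AE x in ?Y. (H x)\<^sup>2 \<noteq> \<infinity>"
      by (intro nn_integral_noteq_infinite) (use bound in \<open>auto simp: top_unique\<close>)
    then have 1: "AE x in ?Y. volterra_converges L K F x"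
      using AE_space by eventually_elim
        (auto intro!: conv simp: less_top power2_eq_square ennreal_mult_eq_top_iff)
    have Vb: "(\<integral>\<^sup>+x. ennreal ((norm (volterra L K F x))\<^sup>2) \<partial>?Y)
      \<le> ennreal (R\<^sup>2 * (\<integral>p. (norm (F p))\<^sup>2 \<partial>?Y))"
    proof -
      have "(\<integral>\<^sup>+x. ennreal ((norm (volterra L K F x))\<^sup>2) \<partial>?Y) \<le> (\<integral>\<^sup>+x. (H x)\<^sup>2 \<partial>?Y)"
        by (intro nn_integral_mono) (auto simp flip: ennreal_power intro!: power_mono VH)
      then show ?thesis using bound by (rule order_trans)
    qed
    have Vi: "integrable ?Y (\<lambda>x. (norm (volterra L K F x))\<^sup>2)"
      by (rule integrableI_bounded) (use Vb in \<open>auto simp: le_less_trans[OF _ ennreal_less_top]\<close>)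
    have 2: "volterra L K F \<in> Y_space L T" using Vm Vi by (simp add: Y_space_def)
    have "(\<integral>x. (norm (volterra L K F x))\<^sup>2 \<partial>?Y) \<le> R\<^sup>2 * (\<integral>p. (norm (F p))\<^sup>2 \<partial>?Y)"
      using Vb nn_integral_eq_integral[OF Vi] by (simp add: ennreal_le_iff)
    then have "Y_norm L T (volterra L K F) \<le> sqrt (R\<^sup>2 * (\<integral>p. (norm (F p))\<^sup>2 \<partial>?Y))"
      unfolding Y_norm_def by (rule real_sqrt_le_mono)
    also have "\<dots> = R * Y_norm L T F" using R by (simp add: Y_norm_def real_sqrt_mult)
    finally show ?thesis using 1 2 by blast
  qed
  show ?thesis
    unfolding volterra_norm_def by (rule Inf_lower) (use main R in blast)
qed

section \<open>Lower bounds\<close>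

lemma borel_measurable_Y_rectangle:
  fixes S :: "(real^'n) set"
  assumes "finite S"
  shows "(indicator ({a..b} \<times> S) :: _ \<Rightarrow> real) \<in> borel_measurable (Y_measure L T)"
proof -
  have "{p \<in> space (Y_measure L T). p \<in> {a..b} \<times> S} = {p \<in> space (Y_measure L T). a \<le> fst p \<and> fst p
    \<le> b \<and> (\<exists>l\<in>S. snd p = l)}"
    by auto
  also have "\<dots> \<in> sets (Y_measure L T)" using assms by measurable
  finally show ?thesis by (simp add: borel_measurable_indicator_iff Int_def conj_commute)
qed

lemma nn_integral_Y_rectangle:
  fixes S :: "(real^'n) set"
  assumes L: "L > 0" and S: "finite S" "S \<subseteq> lattice L" and ab: "0 \<le> a" "a \<le> b" "b \<le> T" and c:
    "c \<ge> 0"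
  shows "(\<integral>\<^sup>+p. ennreal (c * indicator ({a..b} \<times> S) p) \<partial>Y_measure L T)
    = ennreal (c * ((b - a) * real (card S) / L ^ CARD('n)))"
proof -
  note [measurable] = borel_measurable_Y_rectangle[OF S(1), of a b L T]
  have "(\<integral>\<^sup>+p. ennreal (c * indicator ({a..b} \<times> S) p) \<partial>Y_measure L T)
     = (\<integral>\<^sup>+k. (\<integral>\<^sup>+t\<in>{0..T}. ennreal (c * indicator ({a..b} \<times> S) (t, k)) \<partial>lborel) \<partial>nu L)"
    by (rule nn_integral_Y[OF L]) measurable
  also have "\<dots> = (\<integral>\<^sup>+k. ennreal (c * (b - a)) * indicator S k \<partial>nu L)"
  proof (rule nn_integral_cong)
    fix k
    have "(\<integral>\<^sup>+t\<in>{0..T}. ennreal (c * indicator ({a..b} \<times> S) (t, k)) \<partial>lborel)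
      = (\<integral>\<^sup>+t. ennreal c * indicator S k * indicator {a..b} t \<partial>lborel)"
      using ab by (intro nn_integral_cong) (auto simp: indicator_def)
    also have "\<dots> = ennreal (c * (b - a)) * indicator S k"
      using ab c by (subst nn_integral_cmult_indicator) (auto simp: ennreal_mult mult_ac)
    finally show "(\<integral>\<^sup>+t\<in>{0..T}. ennreal (c * indicator ({a..b} \<times> S) (t, k)) \<partial>lborel)
      = ennreal (c * (b - a)) * indicator S k" .
  qed
  also have "\<dots> = ennreal ((\<Sum>k\<in>S. c * (b - a)) / L ^ CARD('n))"
    using ab c by (intro nn_integral_nu_finite[OF L S]) auto
  also have "(\<Sum>k\<in>S. c * (b - a)) / L ^ CARD('n) = c * ((b - a) * real (card S) / L ^ CARD('n))"
    by simp
  finally show ?thesis .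
qed

lemma integral_nu_finite_support:
  fixes r :: "real^'n \<Rightarrow> real"
  assumes L: "L > 0" and S: "finite S" "S \<subseteq> lattice L" and r: "\<And>l. r l \<ge> 0" "\<And>l. l \<notin> S \<Longrightarrow> r l = 0"
  shows "(\<integral>l. r l \<partial>nu L) = (\<Sum>l\<in>S. r l) / L ^ CARD('n)"
proof -
  have "(\<integral>\<^sup>+l. ennreal (r l) \<partial>nu L) = (\<integral>\<^sup>+l. ennreal (r l) * indicator S l \<partial>nu L)"
    using r(2) by (intro nn_integral_cong) (auto simp: indicator_def)
  also have "\<dots> = ennreal ((\<Sum>l\<in>S. r l) / L ^ CARD('n))"
    using r(1) by (rule nn_integral_nu_finite[OF L S])
  finally have eq: "(\<integral>\<^sup>+l. ennreal (r l) \<partial>nu L) = ennreal ((\<Sum>l\<in>S. r l) / L ^ CARD('n))" .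
  moreover have "0 \<le> (\<Sum>l\<in>S. r l) / L ^ CARD('n)" using L r(1)
    by (intro divide_nonneg_nonneg sum_nonneg) auto
  ultimately show ?thesis
    using r(1) by (subst integral_eq_nn_integral) auto
qed

text \<open>The test function is the indicator of \<open>[a, b] \<times> S\<close>, and its image is bounded below on
  \<open>[a', b'] \<times> S'\<close>.\<close>

lemma volterra_norm_ge:
  fixes K :: "'n::finite kernel"
  assumes L: "L > 0" and K0: "\<And>t \<tau> k l. K t \<tau> k l \<ge> 0"
    and Kc: "\<And>t k l. continuous_on UNIV (\<lambda>\<tau>. K t \<tau> k l)"
    and S: "finite S" "S \<subseteq> lattice L" "S \<noteq> {}" and S': "finite S'" "S' \<subseteq> lattice L"
    and ab: "0 \<le> a" "a < b" "b \<le> T" and ab': "0 \<le> a'" "a' \<le> b'" "b' \<le> T"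
    and \<kappa>: "\<kappa> \<ge> 0" and \<delta>: "\<delta> \<ge> 0"
    and low: "\<And>t k l. a' \<le> t \<Longrightarrow> t \<le> b' \<Longrightarrow> k \<in> S' \<Longrightarrow> l \<in> S \<Longrightarrow>
       \<exists>\<alpha>\<ge>a. \<alpha> + \<delta> \<le> min t b \<and> (\<forall>\<tau>. \<alpha> \<le> \<tau> \<longrightarrow> \<tau> \<le> \<alpha> + \<delta> \<longrightarrow> \<kappa> \<le> K t \<tau> k l)"
  shows "ennreal (\<kappa> * \<delta> / L ^ CARD('n) * sqrt (real (card S) * real (card S')
    * (b' - a') / (b - a))) \<le> volterra_norm L T K"
  unfolding volterra_norm_def
proof (rule Inf_greatest)
  let ?r = "real (card S) * real (card S') * (b' - a') / (b - a)"
  let ?Y = "Y_measure L T :: (real \<times> (real^'n)) measure"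
  let ?d = "CARD('n)"
  fix x assume "x \<in> {ennreal B |B. 0 \<le> B \<and> (\<forall>F\<in>Y_space L T. (AE p in ?Y. volterra_converges L K F p)
    \<and>
     volterra L K F \<in> Y_space L T \<and> Y_norm L T (volterra L K F) \<le> B * Y_norm L T F)}"
  then obtain B where x: "x = ennreal B" and B0: "0 \<le> B"
    and B: "\<And>F. F \<in> Y_space L T \<Longrightarrow> volterra L K F \<in> Y_space L T \<and> Y_norm L T (volterra L K F) \<le> B
      * Y_norm L T F"
    by blast
  define F :: "real \<times> (real^'n) \<Rightarrow> complex" where "F p = of_real (indicator ({a..b} \<times> S) p)" for p
  have F2: "(norm (F p))\<^sup>2 = 1 * indicator ({a..b} \<times> S) p" for p by (simp add: F_def indicator_def)
  have nF: "(\<integral>\<^sup>+p. ennreal ((norm (F p))\<^sup>2) \<partial>?Y) = ennreal ((b - a) * real (card S) / L ^ ?d)"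
    unfolding F2 using nn_integral_Y_rectangle[OF L S(1,2), of a b T 1] ab by simp
  note m = borel_measurable_Y_rectangle[OF S(1), of a b L T]
  have Fm: "F \<in> borel_measurable ?Y"
    unfolding F_def using m by measurable
  have Fi: "integrable ?Y (\<lambda>p. (norm (F p))\<^sup>2)"
    by (rule integrableI_bounded) (use Fm nF in auto)
  have FY: "F \<in> Y_space L T" using Fm Fi by (simp add: Y_space_def)
  have "(\<integral>p. (norm (F p))\<^sup>2 \<partial>?Y) = (b - a) * real (card S) / L ^ ?d"
    using nn_integral_eq_integral[OF Fi] nF ab L by (simp add: ennreal_inj)
  then have normF: "Y_norm L T F = sqrt ((b - a) * real (card S) / L ^ ?d)" by
    (simp add: Y_norm_def)
  \<comment> \<open>Pointwise lower bound of the image: each l in \<open>S\<close> contributes at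
    least \<kappa> over a time window of length \<delta>, and the lattice sum is normalised by
    L^d.\<close>
  define q where "q = \<kappa> * \<delta> * real (card S) / L ^ ?d"
  have q0: "q \<ge> 0" using \<kappa> \<delta> L by (simp add: q_def)
  have low': "q \<le> norm (volterra L K F (t, k))" if t: "a' \<le> t" "t \<le> b'" and k: "k \<in> S'" for t k
  proof -
    define r where "r l = (\<integral>\<tau>. indicator {a..min t b} \<tau> *\<^sub>R K t \<tau> k l \<partial>lborel) * indicator S l"
      for l
    have int: "integrable lborel (\<lambda>\<tau>. indicator {a..min t b} \<tau> *\<^sub>R K t \<tau> k l)" for l
      using borel_integrable_atLeastAtMost'[OF continuous_on_subset[OF Kc[of t k l]], of a
        "min t b"]
      by (simp add: set_integrable_def)
    have r0: "r l \<ge> 0" for l unfolding r_def using K0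
      by (intro mult_nonneg_nonneg integral_nonneg_AE) (auto simp: indicator_def)
    have "(LINT \<tau>:{0..t}|lborel. of_real (K t \<tau> k l) * F (\<tau>, l)) = of_real (r l)" for l
    proof -
      have "(LINT \<tau>:{0..t}|lborel. of_real (K t \<tau> k l) * F (\<tau>, l))
        = (\<integral>\<tau>. complex_of_real (indicator {a..min t b} \<tau> *\<^sub>R K t \<tau> k l * indicator S l) \<partial>lborel)"
        unfolding set_lebesgue_integral_def using ab by (intro Bochner_Integration.integral_cong)
          (auto simp: F_def indicator_def)
      also have "\<dots> = of_real (r l)" by (subst integral_complex_of_real) (simp add: r_def)
      finally show ?thesis .
    qed
    then have "volterra L K F (t, k) = of_real (\<integral>l. r l \<partial>nu L)"
      by (simp add: volterra_def)
    also have "(\<integral>l. r l \<partial>nu L) = (\<Sum>l\<in>S. r l) / L ^ ?d"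
      by (rule integral_nu_finite_support[OF L S(1,2) r0]) (simp add: r_def)
    finally have V: "volterra L K F (t, k) = of_real ((\<Sum>l\<in>S. r l) / L ^ ?d)" .
    have "\<kappa> * \<delta> \<le> r l" if l: "l \<in> S" for l
    proof -
      obtain \<alpha> where \<alpha>: "a \<le> \<alpha>" "\<alpha> + \<delta> \<le> min t b" "\<And>\<tau>. \<alpha> \<le> \<tau> \<Longrightarrow> \<tau> \<le> \<alpha> + \<delta> \<Longrightarrow> \<kappa> \<le> K t \<tau> k l"
        using low[OF t k l] by blast
      have "\<kappa> * \<delta> = (\<integral>\<tau>. indicator {\<alpha>..\<alpha> + \<delta>} \<tau> *\<^sub>R \<kappa> \<partial>lborel)" using \<delta> by simp
      also have "\<dots> \<le> (\<integral>\<tau>. indicator {a..min t b} \<tau> *\<^sub>R K t \<tau> k l \<partial>lborel)"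
      proof (rule integral_mono[OF _ int])
        show "integrable lborel (\<lambda>\<tau>. indicator {\<alpha>..\<alpha> + \<delta>} \<tau> *\<^sub>R \<kappa>)"
          using borel_integrable_atLeastAtMost'[of \<alpha> "\<alpha> + \<delta>" "\<lambda>_. \<kappa>"] by
            (simp add: set_integrable_def)
        fix \<tau>
        show "indicator {\<alpha>..\<alpha> + \<delta>} \<tau> *\<^sub>R \<kappa> \<le> indicator {a..min t b} \<tau> *\<^sub>R K t \<tau> k l"
          using \<alpha> K0 by (auto simp: indicator_def)
      qed
      finally show ?thesis using l by (simp add: r_def)
    qed
    then have "(\<Sum>l\<in>S. \<kappa> * \<delta>) \<le> (\<Sum>l\<in>S. r l)" by (rule sum_mono)
    then have "q \<le> (\<Sum>l\<in>S. r l) / L ^ ?d" using L by (simp add: q_def divide_right_mono mult_ac)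
    also have "\<dots> \<le> norm (volterra L K F (t, k))" unfolding V by
      (simp only: norm_of_real abs_ge_self)
    finally show ?thesis .
  qed
  have Vi: "integrable ?Y (\<lambda>p. (norm (volterra L K F p))\<^sup>2)" using B[OF FY] by
    (simp add: Y_space_def)
  have "ennreal (q\<^sup>2 * ((b' - a') * real (card S') / L ^ ?d))
    = (\<integral>\<^sup>+p. ennreal (q\<^sup>2 * indicator ({a'..b'} \<times> S') p) \<partial>?Y)"
    using ab' by (intro nn_integral_Y_rectangle[OF L S', symmetric]) auto
  also have "\<dots> \<le> (\<integral>\<^sup>+p. ennreal ((norm (volterra L K F p))\<^sup>2) \<partial>?Y)"
    using low' q0 by (intro nn_integral_mono ennreal_leI)
      (auto simp: indicator_def intro!: power_mono)
  also have "\<dots> = ennreal (\<integral>p. (norm (volterra L K F p))\<^sup>2 \<partial>?Y)"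
    by (rule nn_integral_eq_integral[OF Vi]) simp
  finally have "q\<^sup>2 * ((b' - a') * real (card S') / L ^ ?d) \<le> (\<integral>p. (norm (volterra L K F p))\<^sup>2 \<partial>?Y)"
    by (simp add: ennreal_le_iff)
  then have "sqrt (q\<^sup>2 * ((b' - a') * real (card S') / L ^ ?d)) \<le> Y_norm L T (volterra L K F)"
    unfolding Y_norm_def by (rule real_sqrt_le_mono)
  also have "\<dots> \<le> B * Y_norm L T F" using B[OF FY] by blast
  finally have "sqrt (q\<^sup>2 * ((b' - a') * real (card S') / L ^ ?d)) \<le> B
    * sqrt ((b - a) * real (card S) / L ^ ?d)"
    unfolding normF .
  then have "sqrt (q\<^sup>2 * ((b' - a') * real (card S') / L ^ ?d)) / sqrt ((b - a)
    * real (card S) / L ^ ?d) \<le> B"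
    using ab S L by (subst pos_divide_le_eq) (auto simp: card_gt_0_iff)
  moreover have "sqrt (q\<^sup>2 * ((b' - a') * real (card S') / L ^ ?d)) / sqrt ((b - a)
    * real (card S) / L ^ ?d)
    = \<kappa> * \<delta> / L ^ ?d * sqrt ?r"
  proof -
    have c: "real (card S) > 0" using S by (simp add: card_gt_0_iff)
    have "sqrt (q\<^sup>2 * ((b' - a') * real (card S') / L ^ ?d)) / sqrt ((b - a)
      * real (card S) / L ^ ?d)
      = sqrt (q\<^sup>2 * ((b' - a') * real (card S') / L ^ ?d) / ((b - a) * real (card S) / L ^ ?d))"
      by (rule real_sqrt_divide[symmetric])
    also have "q\<^sup>2 * ((b' - a') * real (card S') / L ^ ?d) / ((b - a) * real (card S) / L ^ ?d)
      = (\<kappa> * \<delta> / L ^ ?d)\<^sup>2 * ?r"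
      using c L ab by (simp add: q_def field_simps power2_eq_square)
    also have "sqrt \<dots> = \<kappa> * \<delta> / L ^ ?d * sqrt ?r"
    proof -
      have "\<bar>\<kappa> * \<delta> / L ^ ?d\<bar> = \<kappa> * \<delta> / L ^ ?d" using \<kappa> \<delta> L by simp
      then show ?thesis by (simp only: real_sqrt_mult[of "(\<kappa> * \<delta> / L ^ ?d)\<^sup>2"] real_sqrt_abs)
    qed
    finally show ?thesis .
  qed
  ultimately show "ennreal (\<kappa> * \<delta> / L ^ ?d * sqrt ?r) \<le> x"
    unfolding x by (intro ennreal_leI) simp
qed


section \<open>Lower bounds for the kernel, and the lattice points of the test functions\<close>

lemma jap_powr_ge:
  fixes x :: "real^'n"
  assumes "jap x \<le> b" "\<sigma> \<ge> 0"
  shows "b powr (- \<sigma>) \<le> jap x powr (- \<sigma>)"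
  using assms jap_pos[of x] by (intro powr_mono2') auto

lemma continuous_echo_kernel: "continuous_on UNIV (\<lambda>\<tau>. echo_kernel \<sigma> t \<tau> k l)"
proof -
  have "1 + (norm x)\<^sup>2 \<noteq> 0" for x :: "real^'n"
    by (metis add_pos_nonneg less_irrefl zero_le_power2 zero_less_one)
  then show ?thesis
    unfolding echo_kernel_def jap_def by (intro continuous_intros) auto
qed

lemma continuous_echo_kernel_col: "continuous_on UNIV (\<lambda>\<tau>. echo_kernel_col \<sigma> t \<tau> k l)"
  by (cases "wedge k l = 0") (simp_all add: echo_kernel_col_def continuous_echo_kernel)

lemma echo_kernel_col_nonneg: "0 \<le> echo_kernel_col \<sigma> t \<tau> k l"
  by (simp add: echo_kernel_col_def echo_kernel_nonneg)

lemma echo_kernel_ge: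
  fixes k l :: "real^'n"
  assumes \<sigma>: "\<sigma> \<ge> 0" and k: "1 \<le> norm k" and l: "1 \<le> norm l" and a: "0 \<le> a" "a \<le> t - \<tau>"
    and J: "(jap l)\<^sup>2 \<le> c" "jap (k - l) \<le> b" "jap (t *\<^sub>R k - \<tau> *\<^sub>R l) \<le> b"
  shows "a / c * (b powr (- \<sigma>))\<^sup>2 \<le> echo_kernel \<sigma> t \<tau> k l"
proof -
  have 1: "1 / c \<le> sqrt (norm k) * sqrt (norm l) / (jap l)\<^sup>2"
  proof (rule frac_le)
    show "1 \<le> sqrt (norm k) * sqrt (norm l)"
      using k l mult_mono[of 1 "sqrt (norm k)" 1 "sqrt (norm l)"] by simp
  qed (use J jap_pos[of l] in auto)
  have 2: "a \<le> norm ((t - \<tau>) *\<^sub>R k)"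
    using mult_mono[of a "t - \<tau>" 1 "norm k"] a k by simp
  have c: "c > 0" using J(1) jap_pos[of l] by (meson less_le_trans zero_less_power)
  have "a / c * (b powr (- \<sigma>))\<^sup>2 = 1 / c * a * b powr (- \<sigma>) * b powr (- \<sigma>)"
    by (simp add: power2_eq_square)
  also have "\<dots> \<le> echo_kernel \<sigma> t \<tau> k l"
    unfolding echo_kernel_def using a c
    by (intro mult_mono 1 2 jap_powr_ge J \<sigma>) auto
  finally show ?thesis .
qed

lemma axis_points:
  fixes i :: "'n::finite" and u v :: real
  assumes L: "L > 0" and u: "u > 0"
  defines "S \<equiv> (\<lambda>m::int. axis i (of_int m / L) :: real^'n) ` {m. u * L \<le> of_int m \<and> of_int m \<le> v
    * L}"
  shows "finite S" "S \<subseteq> lattice L" "real (card S) \<ge> (v - u) * L - 1"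
    and "u \<le> v \<Longrightarrow> real (card S) \<le> (v - u) * L + 1"
    and "z \<in> S \<Longrightarrow> \<exists>x. z = axis i x \<and> u \<le> x \<and> x \<le> v"
proof -
  let ?I = "{m::int. u * L \<le> of_int m \<and> of_int m \<le> v * L}"
  have inj: "inj_on (\<lambda>m::int. axis i (of_int m / L) :: real^'n) ?I"
    using L by (auto simp: inj_on_def axis_eq_axis)
  show "finite S" unfolding S_def by (intro finite_imageI finite_int_interval)
  have "card S = card ?I" unfolding S_def by (rule card_image[OF inj])
  then show "real (card S) \<ge> (v - u) * L - 1" "u \<le> v \<Longrightarrow> real (card S) \<le> (v - u) * L + 1"
    using card_int_interval_ge[where a = "u * L" and b = "v * L"] card_int_interval_le[of "u * L" "v
      * L"] L
    by (auto simp: left_diff_distrib)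
  show "S \<subseteq> lattice L"
  proof
    fix z assume "z \<in> S"
    then obtain m :: int where m: "z = axis i (of_int m / L)" "u * L \<le> of_int m" by
      (auto simp: S_def)
    have "0 < u * L" using u L by simp
    then have "real_of_int m \<noteq> 0" using m(2) by linarith
    moreover have "\<exists>n::int. z $ j = of_int n / L" for j
      by (cases "j = i") (auto simp: m(1) axis_def intro: exI[of _ m] exI[of _ 0])
    ultimately show "z \<in> lattice L" using L m(1) by (auto simp: lattice_def axis_eq_0_iff)
  qed
  show "\<exists>x. z = axis i x \<and> u \<le> x \<and> x \<le> v" if "z \<in> S"
    using that L by (auto simp: S_def field_simps)
qed

lemma box_points:
  assumes L: "L \<ge> 2"
  defines "S \<equiv> (\<lambda>f. (\<chi> i. of_int (f i) / L) :: real^'n) ` (\<Pi>\<^sub>E i\<in>UNIV. {m::int. 1 * L \<le> of_int m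
    \<and> of_int m \<le> 2 * L})"
  shows "finite S" "S \<subseteq> lattice L" "real (card S) \<ge> (L / 2) ^ CARD('n)"
    and "z \<in> S \<Longrightarrow> 1 \<le> z $ i \<and> z $ i \<le> 2"
proof -
  let ?I = "{m::int. 1 * L \<le> of_int m \<and> of_int m \<le> 2 * L}"
  let ?P = "\<Pi>\<^sub>E i\<in>(UNIV :: 'n set). ?I"
  show bd: "1 \<le> z $ i \<and> z $ i \<le> 2" if "z \<in> S" for z i
    using that L by (auto simp: S_def field_simps PiE_def Pi_def)
  show "finite S" unfolding S_def by (intro finite_imageI finite_PiE finite_int_interval) simp
  have "inj_on (\<lambda>f. (\<chi> i. of_int (f i) / L) :: real^'n) ?P"
    using L by (auto simp: inj_on_def vec_eq_iff fun_eq_iff)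
  then have "card S = card ?P" unfolding S_def by (rule card_image)
  also have "\<dots> = card ?I ^ CARD('n)" by (simp add: card_PiE)
  finally have c: "real (card S) = real (card ?I) ^ CARD('n)" by simp
  have "L / 2 \<le> real (card ?I)"
    using card_int_interval_ge[where a = "1 * L" and b = "2 * L"] L by simp
  then show "real (card S) \<ge> (L / 2) ^ CARD('n)" unfolding c using L by (intro power_mono) auto
  show "S \<subseteq> lattice L"
  proof
    fix z assume z: "z \<in> S"
    then have "\<forall>i. \<exists>m::int. z $ i = of_int m / L" by (auto simp: S_def)
    moreover have "z \<noteq> 0" using bd[OF z] by (auto simp: vec_eq_iff) (metis not_one_le_zero)
    ultimately show "z \<in> lattice L" by (simp add: lattice_def)
  qed
qed

section \<open>Measurability of the kernels, and Schur quantities of the split kernel\<close>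

lemma borel_measurable_jap [measurable]: "(jap :: real^'n \<Rightarrow> real) \<in> borel_measurable borel"
  unfolding jap_def by measurable

lemma borel_measurable_echo_kernel:
  "(\<lambda>p. echo_kernel \<sigma> (fst (fst p)) (fst (snd p)) (snd (fst p) :: real^'n) (snd (snd p)))
    \<in> borel_measurable (borel \<Otimes>\<^sub>M borel)"
proof -
  have [measurable]: "fst \<in> (borel :: (real \<times> (real^'n)) measure) \<rightarrow>\<^sub>M borel"
    "snd \<in> (borel :: (real \<times> (real^'n)) measure) \<rightarrow>\<^sub>M borel"
    by (auto intro!: borel_measurable_continuous_onI continuous_intros)
  show ?thesis unfolding echo_kernel_def by measurable
qed

lemma borel_measurable_echo_kernel_col:
  "(\<lambda>p. echo_kernel_col \<sigma> (fst (fst p)) (fst (snd p)) (snd (fst p) :: real^'n) (snd (snd p)))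
    \<in> borel_measurable (borel \<Otimes>\<^sub>M borel)"
proof -
  have [measurable]: "fst \<in> (borel :: (real \<times> (real^'n)) measure) \<rightarrow>\<^sub>M borel"
    "snd \<in> (borel :: (real \<times> (real^'n)) measure) \<rightarrow>\<^sub>M borel"
    by (auto intro!: borel_measurable_continuous_onI continuous_intros)
  note [measurable] = borel_measurable_echo_kernel
  \<comment> \<open>Collinearity as a finite conjunction of polynomial equations, which makes the
    condition in the kernel measurable.\<close>
  have w: "wedge k l = 0 \<longleftrightarrow> (\<forall>i j. minor k l i j = 0)" for k l :: "real^'n"
    by (simp add: wedge_def vec_eq_iff)
  have [measurable]: "(\<lambda>x :: real^'n. x $ i) \<in> borel_measurable borel" for i
    by (intro borel_measurable_continuous_onI continuous_intros)
  show ?thesis unfolding echo_kernel_col_def w by measurable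
qed

text \<open>The condition in the split does not involve time, so for fixed k and l one of the two
  summands is identically zero.\<close>

lemma set_nn_integral_echo_kernel_split:
  "(\<integral>\<^sup>+s\<in>A. ennreal (echo_kernel \<sigma> (f s) (g s) k l) \<partial>lborel)
   = (\<integral>\<^sup>+s\<in>A. ennreal (echo_kernel_nc \<sigma> (f s) (g s) k l) \<partial>lborel)
     + (\<integral>\<^sup>+s\<in>A. ennreal (echo_kernel_col \<sigma> (f s) (g s) k l) \<partial>lborel)"
  by (cases "wedge k l = 0") (simp_all add: echo_kernel_nc_def echo_kernel_col_def)

lemma schur_plus_split:
  "schur_plus L T (echo_kernel \<sigma> :: 'n::finite kernel)
    \<le> schur_plus L T (echo_kernel_nc \<sigma> :: 'n kernel)
      + schur_plus L T (echo_kernel_col \<sigma> :: 'n kernel)"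
  unfolding schur_plus_def[of L T "echo_kernel \<sigma>"]
proof (intro SUP_least)
  fix k :: "real^'n" and t assume k: "k \<in> lattice L" and t: "t \<in> {0<..T}"
  have "(\<integral>\<^sup>+ l. (\<integral>\<^sup>+ \<tau>\<in>{0..t}. ennreal (K t \<tau> k l) \<partial>lborel) \<partial>nu L) \<le> schur_plus L T K" for K ::
    "'n kernel"
    unfolding schur_plus_def by (intro SUP_upper2[OF k] SUP_upper2[OF t] order_refl)
  then show "(\<integral>\<^sup>+ l. (\<integral>\<^sup>+ \<tau>\<in>{0..t}. ennreal (echo_kernel \<sigma> t \<tau> k l) \<partial>lborel) \<partial>nu L)
     \<le> schur_plus L T (echo_kernel_nc \<sigma> :: 'n kernel)
       + schur_plus L T (echo_kernel_col \<sigma> :: 'n kernel)"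
    by (simp add: set_nn_integral_echo_kernel_split nn_integral_add add_mono)
qed

lemma schur_minus_split:
  "schur_minus L T (echo_kernel \<sigma> :: 'n::finite kernel)
    \<le> schur_minus L T (echo_kernel_nc \<sigma> :: 'n kernel)
      + schur_minus L T (echo_kernel_col \<sigma> :: 'n kernel)"
  unfolding schur_minus_def[of L T "echo_kernel \<sigma>"]
proof (intro SUP_least)
  fix l :: "real^'n" and \<tau> assume l: "l \<in> lattice L" and \<tau>: "\<tau> \<in> {0..<T}"
  have "(\<integral>\<^sup>+ k. (\<integral>\<^sup>+ t\<in>{\<tau>..T}. ennreal (K t \<tau> k l) \<partial>lborel) \<partial>nu L) \<le> schur_minus L T K" for K ::
    "'n kernel"
    unfolding schur_minus_def by (intro SUP_upper2[OF l] SUP_upper2[OF \<tau>] order_refl)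
  then show "(\<integral>\<^sup>+ k. (\<integral>\<^sup>+ t\<in>{\<tau>..T}. ennreal (echo_kernel \<sigma> t \<tau> k l) \<partial>lborel) \<partial>nu L)
     \<le> schur_minus L T (echo_kernel_nc \<sigma> :: 'n kernel)
       + schur_minus L T (echo_kernel_col \<sigma> :: 'n kernel)"
    by (simp add: set_nn_integral_echo_kernel_split nn_integral_add add_mono)
qed

section \<open>The two test configurations\<close>

lemma norm_axis_real: "norm (axis i (x::real)) = \<bar>x\<bar>"
  by (simp add: norm_eq_sqrt_inner inner_axis_axis)

text \<open>On an axis the phase t x - \<tau> y vanishes at \<tau> = (x/y) t, and stays below 1 in
  modulus within distance 1/2 of it, because y is at most 2. As x/y is at most 5/6, the delay t -
  \<tau> is at least t/6 - 1/2, which is at least t/12 once t is at least 6. The 5 bounds <l>^2;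
  both sqrt 2 come from vectors of length at most 1.\<close>

lemma echo_kernel_ge_axis:
  fixes i :: "'n::finite"
  assumes \<sigma>: "\<sigma> \<ge> 0" and x: "1 \<le> x" "x \<le> 5 / 4" and y: "3 / 2 \<le> y" "y \<le> 2" and t: "6 \<le> t"
    and \<tau>: "x / y * t - 1 / 2 \<le> \<tau>" "\<tau> \<le> x / y * t + 1 / 2"
  shows "t / 12 / 5 * (sqrt 2 powr (- \<sigma>))\<^sup>2 \<le> echo_kernel \<sigma> t \<tau> (axis i x :: real^'n) (axis i y)"
proof (rule echo_kernel_ge[OF \<sigma>])
  have sc: "c *\<^sub>R (axis i z :: real^'n) = axis i (c * z)" and di: "(axis i z - axis i z' :: real^'n)
    = axis i (z - z')" for c z z' :: real
    by (auto simp: vec_eq_iff axis_def)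
  have jap_axis: "jap (axis i z :: real^'n) \<le> sqrt 2" if "\<bar>z\<bar> \<le> 1" for z
    using that by (simp add: jap_def norm_axis_real abs_square_le_1)
  have "x / y \<le> (5 / 4) / (3 / 2)" using x y by (intro frac_le) auto
  then have "x / y * t \<le> 5 / 6 * t" using t by (intro mult_right_mono) auto
  then show "t / 12 \<le> t - \<tau>" using \<tau>(2) t by linarith
  show "0 \<le> t / 12" using t by simp
  show "1 \<le> norm (axis i x :: real^'n)" "1 \<le> norm (axis i y :: real^'n)" using x y by
    (auto simp: norm_axis_real)
  have "y\<^sup>2 \<le> 2\<^sup>2" using y by (intro power_mono) auto
  then show "(jap (axis i y :: real^'n))\<^sup>2 \<le> 5" by (simp add: jap_power2 norm_axis_real)
  show "jap (axis i x - axis i y :: real^'n) \<le> sqrt 2" unfolding di by (rule jap_axis)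
    (use x y in auto)
  show "jap (t *\<^sub>R axis i x - \<tau> *\<^sub>R axis i y :: real^'n) \<le> sqrt 2"
    unfolding di sc
  proof (rule jap_axis)
    have "\<bar>t * x - \<tau> * y\<bar> = y * \<bar>x / y * t - \<tau>\<bar>" using y by
      (simp add: abs_mult_pos' algebra_simps flip: abs_mult_pos)
    also have "\<dots> \<le> 2 * (1 / 2)"
    proof (rule mult_mono)
      show "\<bar>x / y * t - \<tau>\<bar> \<le> 1 / 2" using \<tau> by linarith
    qed (use y in auto)
    finally show "\<bar>t * x - \<tau> * y\<bar> \<le> 1" by simp
  qed
qed

lemma wedge_axis: "wedge (axis i x) (axis i y) = (0 :: real^'n^'n)"
  by (simp add: wedge_def vec_eq_iff axis_def)

text \<open>The kernel is only prescribed on collinear pairs, where the test functions live;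
  nonnegativity takes care of the rest. So the collinear and the full operator are treated
  together.\<close>

lemma volterra_norm_ge_collinear:
  fixes K :: "'n::finite kernel"
  assumes \<sigma>: "\<sigma> \<ge> 0" and L: "L \<ge> 8" and T: "T \<ge> 12"
    and K0: "\<And>t \<tau> k l. K t \<tau> k l \<ge> 0" and Kc: "\<And>t k l. continuous_on UNIV (\<lambda>\<tau>. K t \<tau> k l)"
    and K: "\<And>t \<tau> k l. wedge k l = 0 \<Longrightarrow> K t \<tau> k l = echo_kernel \<sigma> t \<tau> k l"
  shows "ennreal ((sqrt 2 powr (- \<sigma>))\<^sup>2 / 960 * T * (L / L ^ CARD('n))) \<le> volterra_norm L T K"
proof -
  define i :: 'n where "i = undefined"
  let ?A = "\<lambda>u v. (\<lambda>m::int. axis i (of_int m / L) :: real^'n) ` {m. u * L \<le> of_int m \<and> of_int m \<le> v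
    * L}"
  let ?S = "?A (3 / 2) 2" and ?S' = "?A 1 (5 / 4)"
  let ?q = "(sqrt 2 powr (- \<sigma>))\<^sup>2"
  let ?r = "real (card ?S) * real (card ?S') * (T - T / 2) / (T - 0)"
  have L0: "L > 0" using L by simp
  \<comment> \<open>The counts are at least L/2 - 1 here and L/4 - 1 for the shorter interval; L at
    least 8 makes them at least L/4 and L/8.\<close>
  have cS: "L / 4 \<le> real (card ?S)" using axis_points(3)[OF L0, where u = "3 / 2" and v = 2 and i
    = i] L by simp
  have cS': "L / 8 \<le> real (card ?S')" using axis_points(3)[OF L0, where u = 1 and v = "5 / 4" and i
    = i] L by simp
  have ne: "?S \<noteq> {}" using cS L0
    by (metis card.empty divide_pos_pos not_less of_nat_0 zero_less_numeral)
  have "ennreal (T / 24 / 5 * ?q * 1 / L ^ CARD('n) * sqrt ?r) \<le> volterra_norm L T K"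
  proof (rule volterra_norm_ge[OF L0 K0 Kc])
    fix t k l assume t: "T / 2 \<le> t" "t \<le> T" and k: "k \<in> ?S'" and l: "l \<in> ?S"
    obtain x where x: "k = axis i x" "1 \<le> x" "x \<le> 5 / 4" using axis_points(5)[OF L0 _ k] by auto
    obtain y where y: "l = axis i y" "3 / 2 \<le> y" "y \<le> 2" using axis_points(5)[OF L0 _ l] by auto
    have t6: "6 \<le> t" using t T by simp
    have xy1: "x / y \<le> 5 / 6" using frac_le[of "5 / 4" x "3 / 2" y] x y by simp
    have xy2: "1 / 2 \<le> x / y" using frac_le[of x 1 y 2] x y by simp
    have xy: "x / y * t \<le> 5 / 6 * t" "1 / 2 * t \<le> x / y * t"
      by (rule mult_right_mono[OF xy1] mult_right_mono[OF xy2]; use t6 in simp)+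
    show "\<exists>\<alpha>\<ge>0. \<alpha> + 1 \<le> min t T \<and> (\<forall>\<tau>. \<alpha> \<le> \<tau> \<longrightarrow> \<tau> \<le> \<alpha> + 1 \<longrightarrow> T / 24 / 5 * ?q \<le> K t \<tau> k l)"
    \<comment> \<open>The window of length 1 centred at the resonant time; since t is at least 6 and
      x/y lies between 1/2 and 5/6, it is contained in [0, t].\<close>
    proof (intro exI[of _ "x / y * t - 1 / 2"] conjI allI impI)
      show "0 \<le> x / y * t - 1 / 2" using xy t6 by linarith
      have "x / y * t - 1 / 2 + 1 \<le> t" using xy t6 by linarith
      then show "x / y * t - 1 / 2 + 1 \<le> min t T" using t by linarith
      fix \<tau> assume \<tau>: "x / y * t - 1 / 2 \<le> \<tau>" "\<tau> \<le> x / y * t - 1 / 2 + 1"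
      have "T / 24 / 5 * ?q \<le> t / 12 / 5 * ?q" using t by (intro mult_right_mono) auto
      also have "\<dots> \<le> echo_kernel \<sigma> t \<tau> k l"
        unfolding x(1) y(1) using \<tau> by (intro echo_kernel_ge_axis \<sigma> x y t6) auto
      also have "\<dots> = K t \<tau> k l" using K[of k l] by (simp add: x(1) y(1) wedge_axis)
      finally show "T / 24 / 5 * ?q \<le> K t \<tau> k l" .
    qed
  qed (use T axis_points(1,2)[OF L0, where u = "3 / 2" and v = 2 and i = i] axis_points(1,2)[OF L0,
    where u = 1 and v = "5 / 4" and i = i] ne in auto)
  moreover have "?q / 960 * T * (L / L ^ CARD('n)) \<le> T / 24 / 5 * ?q * 1 / L ^ CARD('n) * sqrt ?r"
  proof -
    \<comment> \<open>The two counts give L^2/32, and the output interval [T/2, T] is half as long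
      as the input interval. The remaining L/8 combines with 24 and 5 to 960.\<close>
    have "(L / 8)\<^sup>2 \<le> ?r"
    proof -
      have "(L / 4) * (L / 8) \<le> real (card ?S) * real (card ?S')" using cS cS' L0
        by (intro mult_mono) auto
      then show ?thesis using T by (simp add: power2_eq_square field_simps)
    qed
    then have "L / 8 \<le> sqrt ?r" by (rule real_le_rsqrt)
    then have "T / 24 / 5 * ?q * 1 / L ^ CARD('n) * (L / 8) \<le> T / 24 / 5 * ?q * 1 / L ^ CARD('n)
      * sqrt ?r"
      using T L0 by (intro mult_left_mono) auto
    moreover have "T / 24 / 5 * ?q * 1 / L ^ CARD('n) * (L / 8) = ?q / 960 * T * (L / L ^ CARD('n))"
      by simp
    ultimately show ?thesis by linarith
  qed
  ultimately show ?thesis by (meson ennreal_leI order_trans)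
qed

lemma jap_le: "jap x \<le> 1 + norm x"
  unfolding jap_def by (rule real_le_lsqrt) (auto simp: power2_eq_square algebra_simps)

text \<open>No resonance is involved: with frequencies in a box and times at most 1 the phase is
  bounded. Input on [0, 1/2] and output on [3/4, 1] keep the delay at least 1/4, and the box
  contains a fixed proportion of L^d points, so no power of L is lost.\<close>

lemma volterra_norm_ge_one:
  fixes \<sigma> :: real
  assumes \<sigma>: "\<sigma> \<ge> 0" and L: "L \<ge> 2" and T: "T \<ge> 1"
  shows "ennreal (1 / 4 / (1 + (2 * real CARD('n))\<^sup>2) * ((1 + 4 * real CARD('n)) powr (- \<sigma>))\<^sup>2 / 4
    * (1 / 2) ^ CARD('n))
    \<le> volterra_norm L T (echo_kernel \<sigma> :: 'n::finite kernel)"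
proof -
  let ?d = "real CARD('n)"
  let ?S = "(\<lambda>f. (\<chi> i. of_int (f i) / L) :: real^'n) ` (\<Pi>\<^sub>E i\<in>UNIV. {m::int. 1 * L \<le> of_int m
    \<and> of_int m \<le> 2 * L})"
  let ?\<kappa> = "1 / 4 / (1 + (2 * ?d)\<^sup>2) * ((1 + 4 * ?d) powr (- \<sigma>))\<^sup>2"
  let ?r = "real (card ?S) * real (card ?S) * (1 - 3 / 4) / (1 / 2 - 0)"
  note S = box_points[OF L, where 'n = 'n]
  have L0: "L > 0" using L by simp
  have "(L / 2) ^ CARD('n) > 0" using L0 by simp
  then have cS: "real (card ?S) > 0" using S(3) by linarith
  then have ne: "?S \<noteq> {}" by (metis card.empty less_irrefl of_nat_0)
  have nS: "1 \<le> norm z" "norm z \<le> 2 * ?d" if z: "z \<in> ?S" for z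
  proof -
    have "1 \<le> \<bar>z $ undefined\<bar>" using S(4)[OF z] by (meson abs_ge_self order_trans)
    then show "1 \<le> norm z" using component_le_norm_cart[of z undefined] by linarith
    have "norm z \<le> (\<Sum>j\<in>UNIV. \<bar>z $ j\<bar>)" by (rule norm_le_l1_cart)
    also have "\<dots> \<le> (\<Sum>j\<in>(UNIV :: 'n set). 2)"
    proof (rule sum_mono)
      fix j show "\<bar>z $ j\<bar> \<le> 2" using S(4)[OF z, of j] by simp
    qed
    finally show "norm z \<le> 2 * ?d" by simp
  qed
  have "ennreal (?\<kappa> * (1 / 2) / L ^ CARD('n) * sqrt ?r)
    \<le> volterra_norm L T (echo_kernel \<sigma> :: 'n kernel)"
  proof (rule volterra_norm_ge[OF L0 echo_kernel_nonneg continuous_echo_kernel])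
    fix t k l assume t: "3 / 4 \<le> t" "t \<le> (1 :: real)" and k: "k \<in> ?S" and l: "l \<in> ?S"
    show "\<exists>\<alpha>\<ge>0. \<alpha> + 1 / 2 \<le> min t (1 / 2) \<and> (\<forall>\<tau>. \<alpha> \<le> \<tau> \<longrightarrow> \<tau> \<le> \<alpha> + 1 / 2 \<longrightarrow> ?\<kappa>
      \<le> echo_kernel \<sigma> t \<tau> k l)"
    proof (intro exI[of _ 0] conjI allI impI)
      fix \<tau> :: real assume \<tau>: "0 \<le> \<tau>" "\<tau> \<le> 0 + 1 / 2"
      show "?\<kappa> \<le> echo_kernel \<sigma> t \<tau> k l"
      proof (rule echo_kernel_ge[OF \<sigma> nS(1)[OF k] nS(1)[OF l]])
        show "(jap l)\<^sup>2 \<le> 1 + (2 * ?d)\<^sup>2"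
          unfolding jap_power2 using nS(2)[OF l] by (intro add_left_mono power_mono) auto
        have "norm (k - l) \<le> 4 * ?d" using norm_triangle_ineq4[of k l] nS(2)[OF k] nS(2)[OF l]
          by linarith
        then show "jap (k - l) \<le> 1 + 4 * ?d" using jap_le[of "k - l"] by linarith
        have "norm (t *\<^sub>R k) \<le> 1 * (2 * ?d)" unfolding norm_scaleR using t nS(2)[OF k]
          by (intro mult_mono) auto
        moreover have "norm (\<tau> *\<^sub>R l) \<le> 1 * (2 * ?d)" unfolding norm_scaleR using \<tau> nS(2)[OF l]
          by (intro mult_mono) auto
        ultimately have "norm (t *\<^sub>R k - \<tau> *\<^sub>R l) \<le> 4 * ?d" using norm_triangle_ineq4[of "t *\<^sub>R k"
          "\<tau> *\<^sub>R l"] by linarith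
        then show "jap (t *\<^sub>R k - \<tau> *\<^sub>R l) \<le> 1 + 4 * ?d" using jap_le[of "t *\<^sub>R k - \<tau> *\<^sub>R l"]
          by linarith
      qed (use t \<tau> in auto)
    qed (use t in auto)
  qed (use S ne T in auto)
  moreover have "?\<kappa> / 4 * (1 / 2) ^ CARD('n) \<le> ?\<kappa> * (1 / 2) / L ^ CARD('n) * sqrt ?r"
  proof -
    have k0: "?\<kappa> \<ge> 0" by simp
    have "real (card ?S) / 2 \<le> sqrt ?r"
      by (rule real_le_rsqrt) (simp add: power2_eq_square)
    moreover have "(L / 2) ^ CARD('n) / 2 \<le> real (card ?S) / 2" using S(3) by simp
    ultimately have *: "(L / 2) ^ CARD('n) / 2 \<le> sqrt ?r" by linarith
    have "?\<kappa> / 4 * (1 / 2) ^ CARD('n) = ?\<kappa> * (1 / 2) / L ^ CARD('n) * ((L / 2) ^ CARD('n) / 2)"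
      using L0 by (simp add: power_divide)
    also have "\<dots> \<le> ?\<kappa> * (1 / 2) / L ^ CARD('n) * sqrt ?r"
      using k0 L0 by (intro mult_left_mono *) auto
    finally show ?thesis .
  qed
  ultimately show ?thesis by (meson ennreal_leI order_trans)
qed


section \<open>Assembly of the constants\<close>

lemma powi_one_minus:
  assumes "L > (0::real)"
  shows "L powi (1 - int d) = L / L ^ d"
  using assms by (simp add: power_int_diff)

theorem theorem1p2:
  fixes \<sigma> :: real
  assumes "CARD('n::finite) \<ge> 2"
    and "\<sigma> \<ge> real CARD('n) + 3"
  shows "\<exists>C>0.
    (\<forall>L\<ge>5. \<forall>T>0.
        schur_R L T (echo_kernel_nc \<sigma> :: 'n kernel) \<le> ennreal C \<and>
        schur_R L T (echo_kernel_col \<sigma> :: 'n kernel)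
          \<le> ennreal (C * (1 + T) * L powi (1 - int CARD('n))) \<and>
        volterra_norm L T (echo_kernel \<sigma> :: 'n kernel)
          \<le> ennreal (C * (1 + (1 + T) * L powi (1 - int CARD('n))))) \<and>
    (\<exists>c>0. \<exists>T0\<ge>1. \<exists>L0\<ge>5. \<forall>T\<ge>T0. \<forall>L\<ge>L0.
        ennreal (c * T * L powi (1 - int CARD('n)))
          \<le> volterra_norm L T (echo_kernel_col \<sigma> :: 'n kernel) \<and>
        volterra_norm L T (echo_kernel_col \<sigma> :: 'n kernel)
          \<le> ennreal (C * T * L powi (1 - int CARD('n))) \<and>
        ennreal (c * (1 + T * L powi (1 - int CARD('n))))
          \<le> volterra_norm L T (echo_kernel \<sigma> :: 'n kernel) \<and>
        volterra_norm L T (echo_kernel \<sigma> :: 'n kernel)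
          \<le> ennreal (C * (1 + T * L powi (1 - int CARD('n)))))"
proof -
  let ?nc = "echo_kernel_nc \<sigma> :: 'n kernel" and ?col = "echo_kernel_col \<sigma> :: 'n kernel"
    and ?full = "echo_kernel \<sigma> :: 'n kernel"
  note d = assms(1) and \<sigma> = assms(2)
  have \<sigma>0: "\<sigma> \<ge> 0" using \<sigma> by simp
  obtain A where A: "A > 0" "\<And>L T. L \<ge> 1 \<Longrightarrow> schur_R L T ?nc \<le> ennreal A"
  proof -
    obtain a b where ab: "\<And>L T. L \<ge> 1 \<Longrightarrow> schur_plus L T ?nc \<le> ennreal a"
       "\<And>L T. L \<ge> 1 \<Longrightarrow> schur_minus L T ?nc \<le> ennreal b"
      using schur_plus_nc[OF d \<sigma>] schur_minus_nc[OF d \<sigma>] by blast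
    \<comment> \<open>The explicit constants are hidden behind \<open>a\<close> and
      \<open>b\<close>, so their signs are no longer visible; absolute values and the 1 restore
      positivity.\<close>
    have "schur_R L T ?nc \<le> ennreal (1 + \<bar>a\<bar> + \<bar>b\<bar>)" if "L \<ge> 1" for L T
      unfolding schur_R_def using ab(1)[OF that, of T] ab(2)[OF that, of T]
      by (intro max.boundedI) (erule order_trans, intro ennreal_leI, simp)+
    then show ?thesis by (intro that[of "1 + \<bar>a\<bar> + \<bar>b\<bar>"]) auto
  qed
  obtain B where B: "B > 0" "\<And>L T. L \<ge> 1 \<Longrightarrow> T > 0 \<Longrightarrow> schur_R L T ?col
    \<le> ennreal (B * (1 + T) * (L / L ^ CARD('n)))"
  proof -
    obtain a b where ab: "\<And>L T. L \<ge> 1 \<Longrightarrow> T > 0 \<Longrightarrow> schur_plus L T ?col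
      \<le> ennreal (a * (1 + T) * (L / L ^ CARD('n)))"
       "\<And>L T. L \<ge> 1 \<Longrightarrow> schur_minus L T ?col \<le> ennreal (b * (1 + T) * (L / L ^ CARD('n)))"
      using schur_plus_col[OF d \<sigma>] schur_minus_col[OF d \<sigma>] by blast
    have "schur_R L T ?col \<le> ennreal ((1 + \<bar>a\<bar> + \<bar>b\<bar>) * (1 + T) * (L / L ^ CARD('n)))"
      if L: "L \<ge> 1" and T: "T > 0" for L T :: real
      unfolding schur_R_def
    proof (intro max.boundedI)
      have "0 \<le> (1 + T)" "0 \<le> L / L ^ CARD('n)" using L T by auto
      then have *: "c * (1 + T) * (L / L ^ CARD('n)) \<le> (1 + \<bar>a\<bar> + \<bar>b\<bar>) * (1 + T)
        * (L / L ^ CARD('n))" if "c \<le> 1 + \<bar>a\<bar> + \<bar>b\<bar>" for c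
        using that by (intro mult_right_mono)
      show "schur_plus L T ?col \<le> ennreal ((1 + \<bar>a\<bar> + \<bar>b\<bar>) * (1 + T) * (L / L ^ CARD('n)))"
        by (rule order_trans[OF ab(1)[OF L T] ennreal_leI[OF *]]) simp
      show "schur_minus L T ?col \<le> ennreal ((1 + \<bar>a\<bar> + \<bar>b\<bar>) * (1 + T) * (L / L ^ CARD('n)))"
        by (rule order_trans[OF ab(2)[OF L] ennreal_leI[OF *]]) simp
    qed
    then show ?thesis by (intro that[of "1 + \<bar>a\<bar> + \<bar>b\<bar>"]) auto
  qed
  \<comment> \<open>The factor 2 is for large times, where 1 + T is replaced by 2 T.\<close>
  define C where "C = 2 * (A + B)"
  have C: "C > 0" "A \<le> C" "B \<le> C" "A + B \<le> C" "2 * B \<le> C" using A(1) B(1) by (auto simp: C_def)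
  have col: "volterra_norm L T ?col \<le> ennreal (B * (1 + T) * (L / L ^ CARD('n)))"
    if L: "L \<ge> 1" and T: "T > 0" for L T
  proof (rule volterra_norm_le[OF _ _ echo_kernel_col_nonneg borel_measurable_echo_kernel_col])
    show "schur_plus L T ?col \<le> ennreal (B * (1 + T) * (L / L ^ CARD('n)))"
      "schur_minus L T ?col \<le> ennreal (B * (1 + T) * (L / L ^ CARD('n)))"
      using B(2)[OF L T] by (auto simp: schur_R_def)
  qed (use L T B(1) in auto)
  have full: "volterra_norm L T ?full \<le> ennreal (A + B * (1 + T) * (L / L ^ CARD('n)))"
    if L: "L \<ge> 1" and T: "T > 0" for L T
  proof (rule volterra_norm_le[OF _ _ echo_kernel_nonneg borel_measurable_echo_kernel])
    have "0 \<le> B * (1 + T) * (L / L ^ CARD('n))" using L T B(1) by simp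
    then have eq: "ennreal (A + B * (1 + T) * (L / L ^ CARD('n))) = ennreal A
      + ennreal (B * (1 + T) * (L / L ^ CARD('n)))"
      using A(1) by (intro ennreal_plus) auto
    have r: "schur_plus L T ?nc \<le> ennreal A" "schur_minus L T ?nc \<le> ennreal A"
      "schur_plus L T ?col \<le> ennreal (B * (1 + T) * (L / L ^ CARD('n)))"
      "schur_minus L T ?col \<le> ennreal (B * (1 + T) * (L / L ^ CARD('n)))"
      using A(2)[OF L, of T] B(2)[OF L T] by (auto simp: schur_R_def)
    show "schur_plus L T ?full \<le> ennreal (A + B * (1 + T) * (L / L ^ CARD('n)))"
      unfolding eq by (rule order_trans[OF schur_plus_split add_mono[OF r(1,3)]])
    show "schur_minus L T ?full \<le> ennreal (A + B * (1 + T) * (L / L ^ CARD('n)))"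
      unfolding eq by (rule order_trans[OF schur_minus_split add_mono[OF r(2,4)]])
    show "0 \<le> A + B * (1 + T) * (L / L ^ CARD('n))" using L T A(1) B(1) by simp
  qed (use L in auto)
  define c1 where "c1 = (sqrt 2 powr (- \<sigma>))\<^sup>2 / 960"
  define c2 where "c2 = 1 / 4 / (1 + (2 * real CARD('n))\<^sup>2)
    * ((1 + 4 * real CARD('n)) powr (- \<sigma>))\<^sup>2 / 4 * (1 / 2) ^ CARD('n)"
  have c1: "c1 > 0" by (simp add: c1_def)
  have c2: "c2 > 0" by (auto simp: c2_def intro!: divide_pos_pos mult_pos_pos add_pos_nonneg)
  \<comment> \<open>The two lower bounds for the full operator come from different test functions
    and combine to a maximum; half of the sum is below it.\<close>
  define c where "c = min c1 c2 / 2"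
  have c: "c > 0" "2 * c \<le> c1" "2 * c \<le> c2" using c1 c2 by (auto simp: c_def)
  let ?P = "\<lambda>c T L. ennreal (c * T * L powi (1 - int CARD('n)))
          \<le> volterra_norm L T ?col \<and>
        volterra_norm L T ?col
          \<le> ennreal (C * T * L powi (1 - int CARD('n))) \<and>
        ennreal (c * (1 + T * L powi (1 - int CARD('n))))
          \<le> volterra_norm L T ?full \<and>
        volterra_norm L T ?full
          \<le> ennreal (C * (1 + T * L powi (1 - int CARD('n))))"
  show ?thesis
  proof (rule exI[of _ C], intro conjI allI impI)
    show "0 < C" by (rule C)
    fix L T :: real assume L: "5 \<le> L" and T: "0 < T"
    have L1: "L \<ge> 1" using L by simp
    define k where "k = L / L ^ CARD('n)"
    have pk: "L powi (1 - int CARD('n)) = k" unfolding k_def using L by (intro powi_one_minus) simp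
    have k0: "k \<ge> 0" using L by (simp add: k_def)
    show "schur_R L T ?nc \<le> ennreal C"
      by (rule order_trans[OF A(2)[OF L1] ennreal_leI[OF C(2)]])
    have "B * (1 + T) * k \<le> C * (1 + T) * k" using C(3) T k0 by (intro mult_right_mono) auto
    then show "schur_R L T ?col \<le> ennreal (C * (1 + T) * L powi (1 - int CARD('n)))"
      unfolding pk by (rule order_trans[OF B(2)[OF L1 T, folded k_def] ennreal_leI])
    have "A + B * (1 + T) * k \<le> C * 1 + C * (1 + T) * k"
      using C T k0 by (intro add_mono mult_right_mono) auto
    also have "C * 1 + C * (1 + T) * k = C * (1 + (1 + T) * k)" by (simp add: algebra_simps)
    finally have "A + B * (1 + T) * k \<le> C * (1 + (1 + T) * k)" .
    then show "volterra_norm L T ?full \<le> ennreal (C * (1 + (1 + T) * L powi (1 - int CARD('n))))"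
      unfolding pk by (rule order_trans[OF full[OF L1 T, folded k_def] ennreal_leI])
  next
    show "\<exists>c>0. \<exists>T0\<ge>1. \<exists>L0\<ge>5. \<forall>T\<ge>T0. \<forall>L\<ge>L0. ?P c T L"
    \<comment> \<open>The thresholds 12 and 8 are those of the collinear test: output times from T/2
      on are at least 6, and both axis segments contain enough lattice points.\<close>
    proof (rule exI[of _ c], rule conjI[OF c(1)], rule exI[of _ 12], rule conjI, simp, rule
      exI[of _ 8], rule conjI, simp,
        intro allI impI)
      fix T L :: real assume T: "12 \<le> T" and L: "8 \<le> L"
      have L1: "L \<ge> 1" and T0: "T > 0" and L2: "L \<ge> 2" and T1: "T \<ge> 1" using L T by auto
      define k where "k = L / L ^ CARD('n)"
      have pk: "L powi (1 - int CARD('n)) = k" unfolding k_def using L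
        by (intro powi_one_minus) simp
      have k0: "k \<ge> 0" using L by (simp add: k_def)
      have Tk0: "0 \<le> T * k" using T k0 by simp
      have lcol: "ennreal (c1 * T * k) \<le> volterra_norm L T ?col"
        unfolding c1_def k_def
        by (rule volterra_norm_ge_collinear[OF \<sigma>0 L T echo_kernel_col_nonneg
          continuous_echo_kernel_col])
          (simp add: echo_kernel_col_def)
      have lfull: "ennreal (c1 * T * k) \<le> volterra_norm L T ?full"
        unfolding c1_def k_def
        by (rule volterra_norm_ge_collinear[OF \<sigma>0 L T echo_kernel_nonneg continuous_echo_kernel
          refl])
      have lone: "ennreal c2 \<le> volterra_norm L T ?full"
        unfolding c2_def by (rule volterra_norm_ge_one[OF \<sigma>0 L2 T1])
      have "c * T * k \<le> c1 * T * k" using c T k0 by (intro mult_right_mono) auto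
      then have 1: "ennreal (c * T * k) \<le> volterra_norm L T ?col"
        by (rule order_trans[OF ennreal_leI lcol])
      have "B * (1 + T) * k \<le> (2 * B) * T * k"
      proof -
        have "B * (1 + T) \<le> B * (2 * T)" using B(1) T by (intro mult_left_mono) auto
        also have "\<dots> = 2 * B * T" by simp
        finally show ?thesis using k0 by (rule mult_right_mono)
      qed
      also have "\<dots> \<le> C * T * k" using C T k0 by (intro mult_right_mono) auto
      finally have BC: "B * (1 + T) * k \<le> C * T * k" .
      have 2: "volterra_norm L T ?col \<le> ennreal (C * T * k)"
        by (rule order_trans[OF col[OF L1 T0, folded k_def] ennreal_leI[OF BC]])
      have "c * (1 + T * k) \<le> max (c1 * T * k) c2"
      proof -
        have "2 * c * (T * k) \<le> c1 * (T * k)" using c Tk0 by (intro mult_right_mono) auto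
        then have "2 * (c * (1 + T * k)) \<le> c1 * T * k + c2" using c by (simp add: algebra_simps)
        then show ?thesis by linarith
      qed
      then have "ennreal (c * (1 + T * k)) \<le> ennreal (max (c1 * T * k) c2)" by (rule ennreal_leI)
      also have "\<dots> \<le> volterra_norm L T ?full"
        using lfull lone by (simp add: max_def)
      finally have 3: "ennreal (c * (1 + T * k)) \<le> volterra_norm L T ?full" .
      have "A + B * (1 + T) * k \<le> C * 1 + C * T * k" using C(2) BC by simp
      also have "C * 1 + C * T * k = C * (1 + T * k)" by (simp add: algebra_simps)
      finally have "A + B * (1 + T) * k \<le> C * (1 + T * k)" .
      then have 4: "volterra_norm L T ?full \<le> ennreal (C * (1 + T * k))"
        by (rule order_trans[OF full[OF L1 T0, folded k_def] ennreal_leI])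
      show "?P c T L"
        unfolding pk using 1 2 3 4 by blast
    qed
  qed
qed

end
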